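(* Let $S\subset R\oplus C$ be a closed subspace. If there is a completely bounded projection $P\colon R\oplus C\to S$ (onto $S$), then there are Hilbert spaces $H,K$ such that $S$ is completely isomorphic to $H_r\oplus K_c$. Moreover, there is a numerical constant $\kappa$ (independent of $S$ and $P$) such that $d_{cb}(S,H_r\oplus K_c)\le \kappa\,\|P\|_{cb}$.
   Context: The row and column spaces are $R=\overline{\mathrm{span}}\{e_{1j}\mid j\ge1\}$ and $C=\overline{\mathrm{span}}\{e_{i1}\mid i\ge1\}$ in $B(\ell_2)$, with the induced operator space structures. $R\oplus C$ is their block-diagonal ($\ell_\infty$-type) direct sum, and similarly for $H_r\oplus K_c$. For a Hilbert space $H$ (of any dimension), $H_c=B(\mathbb C,H)$ is the column operator space and $H_r=B(H^*,\mathbb C)$ is the row operator space. For operator spaces $E,F$, $d_{cb}(E,F)=\inf\|u\|_{cb}\|u^{-1}\|_{cb}$, the infimum running over all linear isomorphisms $u\colon E\to F$ with $u,u^{-1}$ completely bounded. $E,F$ are completely isomorphic if such a $u$ exists. *)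

theory Defs
  imports "HOL-Analysis.Analysis" "HOL-Library.Function_Algebras"
begin

section \<open>Complex vector spaces\<close>

class complex_vector = ab_group_add +
  fixes scaleC :: "complex \<Rightarrow> 'a \<Rightarrow> 'a" (infixr "*\<^sub>C" 75)
  assumes scaleC_add_right: "c *\<^sub>C (x + y) = c *\<^sub>C x + c *\<^sub>C y"
    and scaleC_add_left: "(c + d) *\<^sub>C x = c *\<^sub>C x + d *\<^sub>C x"
    and scaleC_scaleC: "c *\<^sub>C d *\<^sub>C x = (c * d) *\<^sub>C x"
    and scaleC_one: "1 *\<^sub>C x = x"

global_interpretation complex_vector: vector_space "scaleC :: complex \<Rightarrow> 'a \<Rightarrow> 'a::complex_vector"
  by unfold_locales (simp_all add: scaleC_add_right scaleC_add_left scaleC_scaleC scaleC_one)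

instantiation complex :: complex_vector
begin
definition scaleC_complex_def: "c *\<^sub>C (z::complex) = c * z"
instance by standard (simp_all add: scaleC_complex_def algebra_simps)
end

instantiation "fun" :: (type, complex_vector) complex_vector
begin
definition scaleC_fun_def: "c *\<^sub>C f = (\<lambda>x. c *\<^sub>C f x)"
instance
  by standard (simp_all add: scaleC_fun_def fun_eq_iff scaleC_add_right scaleC_add_left
      scaleC_scaleC scaleC_one)
end

instantiation prod :: (complex_vector, complex_vector) complex_vector
begin
definition scaleC_prod_def: "c *\<^sub>C p = (c *\<^sub>C fst p, c *\<^sub>C snd p)"
instance
  by standard (simp_all add: scaleC_prod_def prod_eq_iff scaleC_add_right scaleC_add_left
      scaleC_scaleC scaleC_one)
end

definition clinear_on :: "'a::complex_vector set \<Rightarrow> ('a \<Rightarrow> 'b::complex_vector) \<Rightarrow> bool" where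
  "clinear_on V T \<longleftrightarrow>
     (\<forall>x\<in>V. \<forall>y\<in>V. T (x + y) = T x + T y) \<and> (\<forall>c. \<forall>x\<in>V. T (c *\<^sub>C x) = c *\<^sub>C T x)"

section \<open>Hilbert spaces and bounded operators\<close>

text \<open>
  A normed space is a linear subspace of an ambient complex vector space together with a norm;
  the values of the norm off that subspace are irrelevant.
\<close>

record 'a nspace =
  vecs :: "'a set"
  nrm :: "'a \<Rightarrow> real"

definition hilbert_space :: "'a::complex_vector nspace \<Rightarrow> bool" where
  "hilbert_space X \<longleftrightarrow>
     complex_vector.subspace (vecs X) \<and>
     (\<exists>ip :: 'a \<Rightarrow> 'a \<Rightarrow> complex.
        (\<forall>x\<in>vecs X. \<forall>y\<in>vecs X. \<forall>z\<in>vecs X. ip (x + y) z = ip x z + ip y z) \<and>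
        (\<forall>c. \<forall>x\<in>vecs X. \<forall>y\<in>vecs X. ip (c *\<^sub>C x) y = c * ip x y) \<and>
        (\<forall>x\<in>vecs X. \<forall>y\<in>vecs X. ip y x = cnj (ip x y)) \<and>
        (\<forall>x\<in>vecs X. nrm X x \<ge> 0 \<and> ip x x = complex_of_real ((nrm X x)\<^sup>2)) \<and>
        (\<forall>x\<in>vecs X. nrm X x = 0 \<longrightarrow> x = 0)) \<and>
     (\<forall>s :: nat \<Rightarrow> 'a.
        (\<forall>n. s n \<in> vecs X) \<and> (\<forall>e>0. \<exists>N. \<forall>m\<ge>N. \<forall>n\<ge>N. nrm X (s m - s n) < e) \<longrightarrow>
        (\<exists>l\<in>vecs X. (\<lambda>n. nrm X (s n - l)) \<longlonglongrightarrow> 0))"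

definition scalars :: "complex nspace" where
  "scalars = \<lparr>vecs = UNIV, nrm = cmod\<rparr>"

definition ell2 :: "(nat \<Rightarrow> complex) nspace" where
  "ell2 = \<lparr>vecs = {x. summable (\<lambda>i. (cmod (x i))\<^sup>2)},
           nrm = (\<lambda>x. sqrt (\<Sum>i. (cmod (x i))\<^sup>2))\<rparr>"

text \<open>
  Operators are extended by 0 off the domain, so that equality of operators is equality of
  functions and the pointwise operations are the operations of \<open>B(X, Y)\<close>.
\<close>

definition bounded_ops ::
    "'a::complex_vector nspace \<Rightarrow> 'b::complex_vector nspace \<Rightarrow> ('a \<Rightarrow> 'b) set" where
  "bounded_ops X Y =
     {T. clinear_on (vecs X) T \<and> T ` vecs X \<subseteq> vecs Y \<and> (\<forall>x. x \<notin> vecs X \<longrightarrow> T x = 0) \<and>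
         (\<exists>c. \<forall>x\<in>vecs X. nrm Y (T x) \<le> c * nrm X x)}"

definition op_norm :: "'a nspace \<Rightarrow> 'b nspace \<Rightarrow> ('a \<Rightarrow> 'b) \<Rightarrow> real" where
  "op_norm X Y T = (SUP x\<in>{x\<in>vecs X. nrm X x \<le> 1}. nrm Y (T x))"

definition dual :: "'a::complex_vector nspace \<Rightarrow> ('a \<Rightarrow> complex) nspace" where
  "dual X = \<lparr>vecs = bounded_ops X scalars, nrm = op_norm X scalars\<rparr>"

text \<open>The Hilbertian direct sum of \<open>n\<close> copies of \<open>X\<close>, indexed by \<open>{..<n}\<close>.\<close>

definition hsum :: "nat \<Rightarrow> 'a::complex_vector nspace \<Rightarrow> (nat \<Rightarrow> 'a) nspace" where
  "hsum n X = \<lparr>vecs = {x. (\<forall>i<n. x i \<in> vecs X) \<and> (\<forall>i\<ge>n. x i = 0)},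
               nrm = (\<lambda>x. sqrt (\<Sum>i<n. (nrm X (x i))\<^sup>2))\<rparr>"

text \<open>The operator from \<open>hsum n X\<close> to \<open>hsum n Y\<close> given by an \<open>n \<times> n\<close> matrix of operators.\<close>

definition matrix_op ::
    "nat \<Rightarrow> (nat \<Rightarrow> nat \<Rightarrow> 'a \<Rightarrow> 'b::complex_vector) \<Rightarrow> (nat \<Rightarrow> 'a) \<Rightarrow> (nat \<Rightarrow> 'b)" where
  "matrix_op n a x = (\<lambda>i. if i < n then \<Sum>j<n. a i j (x j) else 0)"

section \<open>Operator spaces\<close>

text \<open>
  An operator space is a linear subspace with its sequence of matrix norms: \<open>mnorm E n a\<close> is the
  norm in \<open>M\<^sub>n(E)\<close> of the matrix with entries \<open>a i j\<close>, \<open>i, j < n\<close>.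
\<close>

record 'a opspace =
  elems :: "'a set"
  mnorm :: "nat \<Rightarrow> (nat \<Rightarrow> nat \<Rightarrow> 'a) \<Rightarrow> real"

definition mats :: "nat \<Rightarrow> 'a opspace \<Rightarrow> (nat \<Rightarrow> nat \<Rightarrow> 'a) set" where
  "mats n E = {a. \<forall>i<n. \<forall>j<n. a i j \<in> elems E}"

definition enorm :: "'a opspace \<Rightarrow> 'a \<Rightarrow> real" where
  "enorm E x = mnorm E 1 (\<lambda>i j. x)"

text \<open>\<open>B(X, Y)\<close>, with \<open>M\<^sub>n(B(X, Y)) = B(X\<^sup>n, Y\<^sup>n)\<close>.\<close>

definition op_algebra ::
    "'a::complex_vector nspace \<Rightarrow> 'b::complex_vector nspace \<Rightarrow> ('a \<Rightarrow> 'b) opspace" where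
  "op_algebra X Y = \<lparr>elems = bounded_ops X Y,
                     mnorm = (\<lambda>n a. op_norm (hsum n X) (hsum n Y) (matrix_op n a))\<rparr>"

definition sub_opspace :: "'a opspace \<Rightarrow> 'a set \<Rightarrow> 'a opspace" where
  "sub_opspace E S = \<lparr>elems = S, mnorm = mnorm E\<rparr>"

text \<open>
  A block-diagonal matrix \<open>x \<oplus> y\<close> has norm \<open>max \<parallel>x\<parallel> \<parallel>y\<parallel>\<close>, at every matrix level.
\<close>

definition dsum :: "'a opspace \<Rightarrow> 'b opspace \<Rightarrow> ('a \<times> 'b) opspace" (infixr "\<oplus>\<^sub>\<infinity>" 65) where
  "E \<oplus>\<^sub>\<infinity> F = \<lparr>elems = elems E \<times> elems F,
             mnorm = (\<lambda>n a. max (mnorm E n (\<lambda>i j. fst (a i j))) (mnorm F n (\<lambda>i j. snd (a i j))))\<rparr>"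

definition norm_closure :: "'a::complex_vector opspace \<Rightarrow> 'a set \<Rightarrow> 'a set" where
  "norm_closure E A = {x\<in>elems E. \<forall>e>0. \<exists>a\<in>A. enorm E (x - a) < e}"

definition closed_subspace :: "'a::complex_vector set \<Rightarrow> 'a opspace \<Rightarrow> bool" where
  "closed_subspace S E \<longleftrightarrow>
     complex_vector.subspace S \<and> S \<subseteq> elems E \<and> norm_closure E S = S"

section \<open>Completely bounded maps\<close>

text \<open>The value is \<open>\<infinity>\<close> if \<open>u\<close> is not completely bounded; the level \<open>n = 0\<close> contributes 0.\<close>

definition cb_norm :: "'a opspace \<Rightarrow> 'b opspace \<Rightarrow> ('a \<Rightarrow> 'b) \<Rightarrow> ennreal" where
  "cb_norm E F u =
     (SUP n. SUP a\<in>{a\<in>mats n E. mnorm E n a \<le> 1}. ennreal (mnorm F n (\<lambda>i j. u (a i j))))"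

definition cb_map ::
    "'a::complex_vector opspace \<Rightarrow> 'b::complex_vector opspace \<Rightarrow> ('a \<Rightarrow> 'b) \<Rightarrow> bool" where
  "cb_map E F u \<longleftrightarrow>
     clinear_on (elems E) u \<and> u ` elems E \<subseteq> elems F \<and> cb_norm E F u < \<infinity>"

definition cb_projection ::
    "'a::complex_vector opspace \<Rightarrow> 'a set \<Rightarrow> ('a \<Rightarrow> 'a) \<Rightarrow> bool" where
  "cb_projection E S P \<longleftrightarrow>
     cb_map E (sub_opspace E S) P \<and> P ` elems E = S \<and> (\<forall>x\<in>elems E. P (P x) = P x)"

definition complete_iso ::
    "'a::complex_vector opspace \<Rightarrow> 'b::complex_vector opspace \<Rightarrow> ('a \<Rightarrow> 'b) \<Rightarrow> bool" where
  "complete_iso E F u \<longleftrightarrow>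
     bij_betw u (elems E) (elems F) \<and> cb_map E F u \<and> cb_map F E (inv_into (elems E) u)"

definition completely_isomorphic ::
    "'a::complex_vector opspace \<Rightarrow> 'b::complex_vector opspace \<Rightarrow> bool" where
  "completely_isomorphic E F \<longleftrightarrow> (\<exists>u. complete_iso E F u)"

definition d_cb ::
    "'a::complex_vector opspace \<Rightarrow> 'b::complex_vector opspace \<Rightarrow> ennreal" where
  "d_cb E F = (INF u\<in>{u. complete_iso E F u}.
     cb_norm E F u * cb_norm F E (inv_into (elems E) u))"

section \<open>Row and column spaces\<close>

text \<open>Indices start at 0, so \<open>e\<^sub>1\<^sub>j\<close> is \<open>matrix_unit 0 (j - 1)\<close>.\<close>

definition matrix_unit :: "nat \<Rightarrow> nat \<Rightarrow> (nat \<Rightarrow> complex) \<Rightarrow> (nat \<Rightarrow> complex)" where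
  "matrix_unit i j x = (if x \<in> vecs ell2 then (\<lambda>k. if k = i then x j else 0) else 0)"

definition row_space :: "((nat \<Rightarrow> complex) \<Rightarrow> (nat \<Rightarrow> complex)) opspace" where
  "row_space = sub_opspace (op_algebra ell2 ell2)
     (norm_closure (op_algebra ell2 ell2) (complex_vector.span (range (\<lambda>j. matrix_unit 0 j))))"

definition col_space :: "((nat \<Rightarrow> complex) \<Rightarrow> (nat \<Rightarrow> complex)) opspace" where
  "col_space = sub_opspace (op_algebra ell2 ell2)
     (norm_closure (op_algebra ell2 ell2) (complex_vector.span (range (\<lambda>i. matrix_unit i 0))))"

definition hilbert_col :: "'a::complex_vector nspace \<Rightarrow> (complex \<Rightarrow> 'a) opspace" where
  "hilbert_col H = op_algebra scalars H"

definition hilbert_row :: "'a::complex_vector nspace \<Rightarrow> (('a \<Rightarrow> complex) \<Rightarrow> complex) opspace" where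
  "hilbert_row H = op_algebra (dual H) scalars"

end

theory Submission
  imports Defs
begin

text \<open>
  Identify \<open>S\<close> with a closed subspace \<open>V\<close> of \<open>\<ell>\<^sub>2 \<times> \<ell>\<^sub>2\<close>, and let \<open>\<sigma>(x, y) = (x, -y)\<close>. The
  compression \<open>X\<close> of \<open>\<sigma>\<close> to \<open>V\<close> is self-adjoint; with \<open>\<bar>X\<bar> = \<surd>(X\<^sup>2)\<close>, obtained from a norm convergent
  iteration, \<open>V\<close> splits as \<open>H \<oplus> K\<close> where \<open>X = \<bar>X\<bar>\<close> on \<open>H\<close> and \<open>X = -\<bar>X\<bar>\<close> on \<open>K\<close>. On \<open>H\<close> the row
  component dominates the column component, on \<open>K\<close> it is the reverse, and \<open>H\<close>, \<open>K\<close> are orthogonal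
  in each component. Hence \<open>v = h + k \<mapsto> (fst h, snd k)\<close> is completely contractive into a row
  space plus a column space.

  For its inverse, the off-diagonal corners of a completely bounded projection are maps between \<open>R\<close>
  and \<open>C\<close>, so they are Hilbert--Schmidt with norm at most the cb norm of \<open>P\<close>. Projecting
  \<open>h = P (fst h, 0) + P (0, snd h)\<close> back to \<open>H\<close> bounds the column norm of \<open>snd h\<close> by \<open>2 \<parallel>P\<parallel>\<^sub>c\<^sub>b\<close> times the
  row norm of \<open>fst h\<close>, and symmetrically on \<open>K\<close>. The inverse has cb norm at most \<open>1 + 2 \<parallel>P\<parallel>\<^sub>c\<^sub>b \<le> 3 \<parallel>P\<parallel>\<^sub>c\<^sub>b\<close>,
  as \<open>\<parallel>P\<parallel>\<^sub>c\<^sub>b \<ge> 1\<close> unless \<open>S = 0\<close>.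
\<close>

section \<open>The Hilbert space of square summable sequences\<close>

text \<open>The final bound must be linear in the cb norm of \<open>P\<close>, and \<open>P\<close>
  need not be orthogonal. Because \<open>H\<close> and \<open>K\<close> are orthogonal in both
  components at once, the projections of \<open>V\<close> onto them contract the row part and the
  column part separately, so they cost no constant. The delicate summand is
  \<open>P (0, snd h)\<close>. Its column part comes from a diagonal corner of \<open>P\<close>, and
  bounding it by the column norm of \<open>snd h\<close> would be circular. After projection to
  \<open>H\<close>, however, the column part is dominated by the row part, and the latter is at most
  an off-diagonal corner applied to \<open>snd h\<close>. So each of the two summands contributes
  one off-diagonal corner, which explains the factor 2, and no product of norms arises.
  Hilbert--Schmidt maps are what is needed here because they turn a bound for the row norm of a
  matrix into one for its column norm; a pointwise norm estimate does not exchange the two. The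
  absolute value of \<open>X\<close> enters only through its square, its positivity and its
  commutation relations. The operators are treated over the reals, and multiplication by \<i> is one
  more operator commuting with \<open>X\<close>.\<close>

lemma summable_sq_add:
  fixes f g :: "nat \<Rightarrow> complex"
  assumes "summable (\<lambda>i. (cmod (f i))\<^sup>2)" "summable (\<lambda>i. (cmod (g i))\<^sup>2)"
  shows "summable (\<lambda>i. (cmod (f i + g i))\<^sup>2)"
proof (rule summable_comparison_test')
  show "summable (\<lambda>i. 2 * (cmod (f i))\<^sup>2 + 2 * (cmod (g i))\<^sup>2)"
    using assms by (intro summable_add summable_mult)
  show "norm ((cmod (f i + g i))\<^sup>2) \<le> 2 * (cmod (f i))\<^sup>2 + 2 * (cmod (g i))\<^sup>2" if "i \<ge> 0" for i
  proof -
    have "(cmod (f i + g i))\<^sup>2 \<le> (cmod (f i) + cmod (g i))\<^sup>2"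
      by (intro power_mono norm_triangle_ineq) auto
    also have "\<dots> \<le> 2 * (cmod (f i))\<^sup>2 + 2 * (cmod (g i))\<^sup>2"
      using sum_squares_bound[of "cmod (f i)" "cmod (g i)"] by (simp add: power2_sum)
    finally show ?thesis by simp
  qed
qed

lemma summable_sq_mult:
  fixes f :: "nat \<Rightarrow> complex"
  assumes "summable (\<lambda>i. (cmod (f i))\<^sup>2)"
  shows "summable (\<lambda>i. (cmod (c * f i))\<^sup>2)"
  using summable_mult[OF assms, of "(cmod c)\<^sup>2"] by (simp add: norm_mult power_mult_distrib)

lemma summable_mult_sq:
  fixes f g :: "nat \<Rightarrow> complex"
  assumes "summable (\<lambda>i. (cmod (f i))\<^sup>2)" "summable (\<lambda>i. (cmod (g i))\<^sup>2)"
  shows "summable (\<lambda>i. cmod (f i * g i))"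
proof (rule summable_comparison_test')
  show "summable (\<lambda>i. (cmod (f i))\<^sup>2 + (cmod (g i))\<^sup>2)"
    using assms by (intro summable_add)
  show "norm (cmod (f i * g i)) \<le> (cmod (f i))\<^sup>2 + (cmod (g i))\<^sup>2" if "i \<ge> 0" for i
  proof -
    have "2 * (cmod (f i) * cmod (g i)) \<le> (cmod (f i))\<^sup>2 + (cmod (g i))\<^sup>2"
      using sum_squares_bound[of "cmod (f i)" "cmod (g i)"] by simp
    moreover have "0 \<le> cmod (f i) * cmod (g i)" by simp
    ultimately have "cmod (f i) * cmod (g i) \<le> (cmod (f i))\<^sup>2 + (cmod (g i))\<^sup>2" by linarith
    then show ?thesis by (simp add: norm_mult)
  qed
qed

text \<open>As a type, the space can carry the real inner product, the real part of the usual one,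
  and thereby a topology, completeness and bounded real-linear operators. The complex structure is
  kept beside it as \<open>scaleC\<close>.\<close>

typedef l2 = "{x :: nat \<Rightarrow> complex. summable (\<lambda>i. (cmod (x i))\<^sup>2)}"
  by (rule exI[of _ "\<lambda>_. 0"]) simp

setup_lifting type_definition_l2

lemma summable_Rep_l2: "summable (\<lambda>i. (cmod (Rep_l2 x i))\<^sup>2)"
  using Rep_l2[of x] by simp

lemma summable_Re_l2: "summable (\<lambda>i. Re (Rep_l2 x i * cnj (Rep_l2 y i)))"
proof -
  have "summable (\<lambda>i. cmod (Rep_l2 x i * cnj (Rep_l2 y i)))"
    using summable_mult_sq[OF summable_Rep_l2[of x], of "\<lambda>i. cnj (Rep_l2 y i)"] summable_Rep_l2[of y]
    by simp
  then have "summable (\<lambda>i. Rep_l2 x i * cnj (Rep_l2 y i))" by (rule summable_norm_cancel)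
  then show ?thesis by (rule summable_Re)
qed

instantiation l2 :: real_inner
begin

lift_definition zero_l2 :: l2 is "\<lambda>_. 0" by simp
lift_definition plus_l2 :: "l2 \<Rightarrow> l2 \<Rightarrow> l2" is "\<lambda>x y i. x i + y i"
  by (rule summable_sq_add)
lift_definition uminus_l2 :: "l2 \<Rightarrow> l2" is "\<lambda>x i. - x i" by simp
lift_definition minus_l2 :: "l2 \<Rightarrow> l2 \<Rightarrow> l2" is "\<lambda>x y i. x i - y i"
  using summable_sq_add[of _ "\<lambda>i. - _ i"] by simp
lift_definition scaleR_l2 :: "real \<Rightarrow> l2 \<Rightarrow> l2" is "\<lambda>r x i. of_real r * x i"
  by (rule summable_sq_mult)
definition inner_l2 :: "l2 \<Rightarrow> l2 \<Rightarrow> real" where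
  "inner_l2 x y = (\<Sum>i. Re (Rep_l2 x i * cnj (Rep_l2 y i)))"
definition norm_l2 :: "l2 \<Rightarrow> real" where "norm_l2 x = sqrt (inner x x)"
definition dist_l2 :: "l2 \<Rightarrow> l2 \<Rightarrow> real" where "dist_l2 x y = norm (x - y)"
definition sgn_l2 :: "l2 \<Rightarrow> l2" where "sgn_l2 x = inverse (norm x) *\<^sub>R x"
definition uniformity_l2 :: "(l2 \<times> l2) filter" where
  "uniformity_l2 = (INF e\<in>{0 <..}. principal {(x, y). dist x y < e})"
definition open_l2 :: "l2 set \<Rightarrow> bool" where
  "open_l2 U \<longleftrightarrow> (\<forall>x\<in>U. eventually (\<lambda>(x', y). x' = x \<longrightarrow> y \<in> U) uniformity)"

instance
proof
  fix x y z :: l2 and r s :: real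
  show "x + y + z = x + (y + z)" by transfer (simp add: add.assoc)
  show "x + y = y + x" by transfer (simp add: add.commute)
  show "0 + x = x" by transfer simp
  show "- x + x = 0" by transfer simp
  show "x - y = x + - y" by transfer simp
  show "r *\<^sub>R (x + y) = r *\<^sub>R x + r *\<^sub>R y" by transfer (simp add: algebra_simps)
  show "(r + s) *\<^sub>R x = r *\<^sub>R x + s *\<^sub>R x" by transfer (simp add: algebra_simps)
  show "r *\<^sub>R s *\<^sub>R x = (r * s) *\<^sub>R x" by transfer (simp add: algebra_simps)
  show "1 *\<^sub>R x = x" by transfer simp
  show "dist x y = norm (x - y)" by (simp add: dist_l2_def)
  show "sgn x = inverse (norm x) *\<^sub>R x" by (simp add: sgn_l2_def)
  show "uniformity = (INF e\<in>{0 <..}. principal {(x :: l2, y). dist x y < e})"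
    by (simp add: uniformity_l2_def)
  show "open U \<longleftrightarrow> (\<forall>x\<in>U. \<forall>\<^sub>F (x', y) in uniformity. x' = x \<longrightarrow> y \<in> U)" for U :: "l2 set"
    by (simp add: open_l2_def)
  show "inner x y = inner y x" unfolding inner_l2_def by (simp add: mult.commute)
  show "inner (x + y) z = inner x z + inner y z"
    unfolding inner_l2_def
    using suminf_add[OF summable_Re_l2[of x z] summable_Re_l2[of y z]]
    by (simp add: plus_l2.rep_eq algebra_simps)
  show "inner (r *\<^sub>R x) y = r * inner x y"
    unfolding inner_l2_def using suminf_mult[OF summable_Re_l2[of x y], of r]
    by (simp add: scaleR_l2.rep_eq algebra_simps)
  have eq: "Re (Rep_l2 x i * cnj (Rep_l2 x i)) = (cmod (Rep_l2 x i))\<^sup>2" for i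
    unfolding cmod_power2 by (simp add: power2_eq_square)
  show "0 \<le> inner x x" unfolding inner_l2_def eq
    by (rule suminf_nonneg[OF summable_Rep_l2]) simp
  show "inner x x = 0 \<longleftrightarrow> x = 0" unfolding inner_l2_def eq
    by (subst suminf_eq_zero_iff[OF summable_Rep_l2]) (auto simp: Rep_l2_inject[symmetric] zero_l2.rep_eq)
  show "norm x = sqrt (inner x x)" by (rule norm_l2_def)
qed

end

instantiation l2 :: complex_vector
begin
lift_definition scaleC_l2 :: "complex \<Rightarrow> l2 \<Rightarrow> l2" is "\<lambda>c x i. c * x i"
  by (rule summable_sq_mult)
instance
  by standard (transfer, simp add: algebra_simps)+
end

lemma norm_l2: "norm x = sqrt (\<Sum>i. (cmod (Rep_l2 x i))\<^sup>2)"
  unfolding norm_l2_def inner_l2_def cmod_power2 by (simp add: power2_eq_square)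

lemma norm_l2_sq: "(norm x)\<^sup>2 = (\<Sum>i. (cmod (Rep_l2 x i))\<^sup>2)"
  unfolding norm_l2 by (rule real_sqrt_pow2[OF suminf_nonneg[OF summable_Rep_l2]]) simp

lemma sums_norm_l2_sq: "(\<lambda>i. (cmod (Rep_l2 x i))\<^sup>2) sums (norm x)\<^sup>2"
  unfolding norm_l2_sq by (rule summable_sums[OF summable_Rep_l2])

lemma sum_le_norm_l2_sq: "finite I \<Longrightarrow> (\<Sum>i\<in>I. (cmod (Rep_l2 x i))\<^sup>2) \<le> (norm x)\<^sup>2"
  unfolding norm_l2_sq by (rule sum_le_suminf[OF summable_Rep_l2]) auto

lemma Rep_l2_le_norm: "cmod (Rep_l2 x i) \<le> norm x"
  using sum_le_norm_l2_sq[of "{i}" x] by (auto intro: power2_le_imp_le)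

lemma norm_scaleC_l2 [simp]: "norm (c *\<^sub>C x :: l2) = cmod c * norm x"
proof -
  have "(norm (c *\<^sub>C x))\<^sup>2 = (cmod c * norm x)\<^sup>2"
    unfolding norm_l2_sq power_mult_distrib
    by (subst suminf_mult[symmetric, OF summable_Rep_l2])
      (simp add: scaleC_l2.rep_eq norm_mult power_mult_distrib)
  then show ?thesis by (simp add: power2_eq_iff_nonneg)
qed

lemma scaleR_scaleC_l2: "r *\<^sub>R (x :: l2) = complex_of_real r *\<^sub>C x"
  by transfer simp

lemma inner_ii_l2: "inner (\<i> *\<^sub>C x :: l2) (\<i> *\<^sub>C y) = inner x y"
  unfolding inner_l2_def scaleC_l2.rep_eq by (simp add: algebra_simps)

lemma Rep_l2_sum: "Rep_l2 (sum f A) i = (\<Sum>a\<in>A. Rep_l2 (f a) i)"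
  by (induction A rule: infinite_finite_induct) (auto simp: zero_l2.rep_eq plus_l2.rep_eq)

instance l2 :: complete_space
proof
  fix X :: "nat \<Rightarrow> l2" assume X: "Cauchy X"
  have "Cauchy (\<lambda>n. Rep_l2 (X n) i)" for i
  proof (rule CauchyI)
    fix e :: real assume "e > 0"
    with X obtain M where M: "\<forall>m\<ge>M. \<forall>n\<ge>M. norm (X m - X n) < e" by (auto dest: CauchyD)
    show "\<exists>M. \<forall>m\<ge>M. \<forall>n\<ge>M. norm (Rep_l2 (X m) i - Rep_l2 (X n) i) < e"
      using M order.strict_trans1[OF Rep_l2_le_norm[of "X _ - X _" i]]
      by (intro exI[of _ M]) (simp add: minus_l2.rep_eq)
  qed
  then obtain l where l: "\<And>i. (\<lambda>n. Rep_l2 (X n) i) \<longlonglongrightarrow> l i"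
    unfolding Cauchy_convergent_iff convergent_def by metis
  \<comment> \<open>A Fatou argument: bounds on finite partial sums pass to the coordinatewise
    limit, which yields summability of the difference and its norm estimate together.\<close>
  have fatou: "summable (\<lambda>i. (cmod (Rep_l2 (X n) i - l i))\<^sup>2) \<and>
      (\<Sum>i. (cmod (Rep_l2 (X n) i - l i))\<^sup>2) \<le> e\<^sup>2"
    if "\<forall>m\<ge>M. norm (X n - X m) \<le> e" for e n M
  proof -
    have part: "(\<Sum>i<N. (cmod (Rep_l2 (X n) i - l i))\<^sup>2) \<le> e\<^sup>2" for N
    proof (rule LIMSEQ_le_const2)
      show "(\<lambda>m. \<Sum>i<N. (cmod (Rep_l2 (X n) i - Rep_l2 (X m) i))\<^sup>2)
          \<longlonglongrightarrow> (\<Sum>i<N. (cmod (Rep_l2 (X n) i - l i))\<^sup>2)"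
        by (intro tendsto_intros l)
      have "(\<Sum>i<N. (cmod (Rep_l2 (X n) i - Rep_l2 (X m) i))\<^sup>2) \<le> e\<^sup>2" if "m \<ge> M" for m
      proof -
        have "(\<Sum>i<N. (cmod (Rep_l2 (X n) i - Rep_l2 (X m) i))\<^sup>2) \<le> (norm (X n - X m))\<^sup>2"
          using sum_le_norm_l2_sq[of "{..<N}" "X n - X m"] by (simp add: minus_l2.rep_eq)
        also have "\<dots> \<le> e\<^sup>2" using \<open>\<forall>m\<ge>M. norm (X n - X m) \<le> e\<close> that by (intro power_mono) auto
        finally show ?thesis .
      qed
      then show "\<exists>M. \<forall>m\<ge>M. (\<Sum>i<N. (cmod (Rep_l2 (X n) i - Rep_l2 (X m) i))\<^sup>2) \<le> e\<^sup>2" by blast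
    qed
    have "summable (\<lambda>i. (cmod (Rep_l2 (X n) i - l i))\<^sup>2)"
      by (rule bounded_imp_summable[of _ "e\<^sup>2"])
        (use part[of "Suc _"] in \<open>auto simp: lessThan_Suc_atMost\<close>)
    moreover from this have "(\<Sum>i. (cmod (Rep_l2 (X n) i - l i))\<^sup>2) \<le> e\<^sup>2"
      by (intro suminf_le_const) (auto intro: part)
    ultimately show ?thesis ..
  qed
  obtain M where "\<forall>m\<ge>M. \<forall>n\<ge>M. norm (X m - X n) < 1"
    using X by (auto dest: CauchyD[where e = 1])
  then have "\<forall>m\<ge>M. norm (X M - X m) \<le> 1" by (meson less_imp_le order_refl)
  then have "summable (\<lambda>i. (cmod (Rep_l2 (X M) i - l i))\<^sup>2)" using fatou by blast
  then have "summable (\<lambda>i. (cmod (l i - Rep_l2 (X M) i))\<^sup>2)" by (simp add: norm_minus_commute)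
  from summable_sq_add[OF this summable_Rep_l2[of "X M"]]
  have L: "Rep_l2 (Abs_l2 l) = l" by (simp add: Abs_l2_inverse)
  have "X \<longlonglongrightarrow> Abs_l2 l"
  proof (rule LIMSEQ_I)
    fix e :: real assume "e > 0"
    with X obtain M where M: "\<forall>m\<ge>M. \<forall>n\<ge>M. norm (X m - X n) < e / 2"
      by (meson CauchyD half_gt_zero)
    have "norm (X n - Abs_l2 l) < e" if "n \<ge> M" for n
    proof -
      have "\<forall>m\<ge>M. norm (X n - X m) \<le> e / 2" using M that by (meson less_imp_le)
      then have "(norm (X n - Abs_l2 l))\<^sup>2 \<le> (e / 2)\<^sup>2"
        unfolding norm_l2_sq minus_l2.rep_eq L by (rule fatou[THEN conjunct2])
      then have "norm (X n - Abs_l2 l) \<le> e / 2" 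
        by (rule power2_le_imp_le) (use \<open>e > 0\<close> in simp)
      then show ?thesis using \<open>e > 0\<close> by simp
    qed
    then show "\<exists>M. \<forall>n\<ge>M. norm (X n - Abs_l2 l) < e" by blast
  qed
  then show "convergent X" by (rule convergentI)
qed

instance l2 :: banach ..

section \<open>Riesz representation and orthogonal projections\<close>

text \<open>Minimise \<open>(norm y)\<^sup>2 / 2 - f y\<close> over \<open>V\<close>. The
  parallelogram law makes minimising sequences Cauchy, and the vanishing first variation at the
  minimiser is the representation formula.\<close>

lemma riesz_closed_subspace:
  fixes V :: "'a::{real_inner,banach} set" and f :: "'a \<Rightarrow> real"
  assumes V: "subspace V" "closed V"
    and add: "\<And>x y. x \<in> V \<Longrightarrow> y \<in> V \<Longrightarrow> f (x + y) = f x + f y"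
    and scale: "\<And>r x. x \<in> V \<Longrightarrow> f (r *\<^sub>R x) = r * f x"
    and bound: "\<And>x. x \<in> V \<Longrightarrow> \<bar>f x\<bar> \<le> C * norm x"
  shows "\<exists>y\<in>V. \<forall>v\<in>V. f v = inner y v"
proof -
  define g where "g y = (norm y)\<^sup>2 / 2 - f y" for y
  \<comment> \<open>The parallelogram identity for \<open>g\<close>; the linear terms in
    \<open>f\<close> cancel.\<close>
  have gmid: "(norm (y - z))\<^sup>2 = 4 * g y + 4 * g z - 8 * g ((1/2) *\<^sub>R (y + z))"
    if "y \<in> V" "z \<in> V" for y z
  proof -
    have "f ((1/2) *\<^sub>R (y + z)) = (f y + f z) / 2"
      using add[OF that] scale[OF subspace_add[OF V(1) that], of "1/2"] by simp
    moreover have "(norm (y - z))\<^sup>2 = 2 * (norm y)\<^sup>2 + 2 * (norm z)\<^sup>2 - 4 * (norm ((1/2) *\<^sub>R (y + z)))\<^sup>2"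
      unfolding norm_scaleR power_mult_distrib
      by (simp add: power_divide power2_norm_eq_inner inner_add inner_diff inner_commute add_divide_distrib)
    ultimately show ?thesis by (simp add: g_def)
  qed
  have glow: "g y \<ge> - C\<^sup>2 / 2" if "y \<in> V" for y
  proof -
    have "0 \<le> (norm y - C)\<^sup>2" by simp
    then have "C * norm y \<le> (norm y)\<^sup>2 / 2 + C\<^sup>2 / 2" by (simp add: power2_diff field_simps)
    then show ?thesis using bound[OF that] by (simp add: g_def)
  qed
  define m where "m = (INF y\<in>V. g y)"
  have V0: "V \<noteq> {}" using subspace_0[OF V(1)] by auto
  have bdd: "bdd_below (g ` V)" using glow by (intro bdd_belowI2)
  have mle: "m \<le> g y" if "y \<in> V" for y unfolding m_def using bdd that by (rule cINF_lower)
  have "\<exists>y\<in>V. g y < m + inverse (real (Suc n))" for n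
    using cINF_less_iff[OF V0 bdd, of "m + inverse (real (Suc n))"] by (simp add: m_def)
  then obtain Y where YV: "\<And>n. Y n \<in> V" and Yg: "\<And>n. g (Y n) < m + inverse (real (Suc n))"
    by metis
  have close: "(norm (Y i - Y j))\<^sup>2 \<le> 4 * inverse (real (Suc i)) + 4 * inverse (real (Suc j))" for i j
    using gmid[OF YV[of i] YV[of j]] Yg[of i] Yg[of j]
      mle[OF subspace_scale[OF V(1) subspace_add[OF V(1) YV[of i] YV[of j]], of "1/2"]]
    by linarith
  have "Cauchy Y"
  proof (rule CauchyI)
    fix e :: real assume "e > 0"
    then obtain N where N: "inverse (real (Suc N)) < e\<^sup>2 / 8" using reals_Archimedean[of "e\<^sup>2 / 8"] by auto
    have small: "inverse (real (Suc n)) < e\<^sup>2 / 8" if "n \<ge> N" for n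
    proof -
      have "inverse (real (Suc n)) \<le> inverse (real (Suc N))" using that by (intro le_imp_inverse_le) auto
      then show ?thesis using N by linarith
    qed
    have "norm (Y i - Y j) < e" if "i \<ge> N" "j \<ge> N" for i j
    proof (rule power2_less_imp_less)
      show "(norm (Y i - Y j))\<^sup>2 < e\<^sup>2"
        using close[of i j] small[OF that(1)] small[OF that(2)] by linarith
    qed (use \<open>e > 0\<close> in simp)
    then show "\<exists>M. \<forall>m\<ge>M. \<forall>n\<ge>M. norm (Y m - Y n) < e" by blast
  qed
  then obtain y where lim: "Y \<longlonglongrightarrow> y" unfolding Cauchy_convergent_iff convergent_def by blast
  have yV: "y \<in> V" using closed_sequentially[OF V(2)] YV lim by blast
  have flim: "(\<lambda>n. f (Y n)) \<longlonglongrightarrow> f y"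
  proof (rule LIM_zero_cancel, rule Lim_null_comparison)
    have "f (Y n) - f y = f (Y n - y)" for n
      using add[OF subspace_diff[OF V(1) YV[of n] yV] yV] by simp
    then show "\<forall>\<^sub>F n in sequentially. norm (f (Y n) - f y) \<le> C * norm (Y n - y)"
      using bound[OF subspace_diff[OF V(1) YV yV]] by simp
    show "(\<lambda>n. C * norm (Y n - y)) \<longlonglongrightarrow> 0"
      using tendsto_mult_right_zero[OF tendsto_norm_zero[OF LIM_zero[OF lim]], of C] by simp
  qed
  have "(\<lambda>n. g (Y n)) \<longlonglongrightarrow> g y" unfolding g_def by (intro tendsto_intros lim flim) auto
  moreover have "(\<lambda>n. m + inverse (real (Suc n))) \<longlonglongrightarrow> m + 0"
    by (intro tendsto_intros LIMSEQ_inverse_real_of_nat)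
  ultimately have gy: "g y \<le> m" using Yg by (intro LIMSEQ_le[of _ "g y" _ m]) (auto intro: less_imp_le)
  have "f v = inner y v" if "v \<in> V" for v
  proof -
    have key: "0 \<le> t * (inner y v - f v) + t * (t * ((norm v)\<^sup>2 / 2))" for t
    proof -
      have tv: "t *\<^sub>R v \<in> V" using V(1) that by (rule subspace_scale)
      have "g y \<le> g (y + t *\<^sub>R v)"
        using gy mle[OF subspace_add[OF V(1) yV tv]] by linarith
      then show ?thesis
        using add[OF yV tv] scale[OF that, of t]
        by (simp add: g_def power2_norm_eq_inner inner_simps inner_commute algebra_simps)
    qed
    define d where "d = inner y v - f v"
    \<comment> \<open>For \<open>t = - d / q\<close> the variation inequality collapses to
      \<open>0 \<le> - (d / q)\<^sup>2\<close>. The added 1 keeps \<open>q\<close> positive when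
      \<open>v = 0\<close>.\<close>
    define q where "q = (norm v)\<^sup>2 / 2 + 1"
    have q: "q > 0" by (simp add: q_def add_nonneg_pos)
    have n: "(norm v)\<^sup>2 / 2 = q - 1" by (simp add: q_def)
    have "0 \<le> (- d / q) * d + (- d / q) * ((- d / q) * (q - 1))"
      using key[of "- d / q"] unfolding d_def n .
    also have "\<dots> = - (d / q)\<^sup>2" using q by (simp add: field_simps power2_eq_square)
    finally have "(d / q)\<^sup>2 = 0" by simp
    then show ?thesis using q by (simp add: d_def)
  qed
  with yV show ?thesis by blast
qed

section \<open>Orthogonal projections onto closed subspaces\<close>

definition proj :: "'a::real_inner set \<Rightarrow> 'a \<Rightarrow> 'a" where
  "proj V x = (THE p. p \<in> V \<and> (\<forall>v\<in>V. inner (x - p) v = 0))"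

context
  fixes V :: "'a::{real_inner,banach} set"
  assumes V: "subspace V" "closed V"
begin

lemma proj_unique:
  assumes "p \<in> V" "\<And>v. v \<in> V \<Longrightarrow> inner (x - p) v = 0"
  shows "proj V x = p"
  unfolding proj_def
proof (rule the_equality)
  show "p \<in> V \<and> (\<forall>v\<in>V. inner (x - p) v = 0)" using assms by blast
  fix q assume q: "q \<in> V \<and> (\<forall>v\<in>V. inner (x - q) v = 0)"
  then have "q - p \<in> V" using V(1) assms(1) by (simp add: subspace_diff)
  then have "inner (x - p) (q - p) = 0" "inner (x - q) (q - p) = 0" using assms q by auto
  then have "inner (q - p) (q - p) = 0" by (simp add: inner_simps)
  then show "q = p" by simp
qed

text \<open>The projection is the Riesz vector of the functional \<open>inner x\<close> restricted
  to \<open>V\<close>.\<close>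

lemma proj_properties: "proj V x \<in> V \<and> (\<forall>v\<in>V. inner (x - proj V x) v = 0)"
proof -
  obtain p where "p \<in> V" "\<forall>v\<in>V. inner x v = inner p v"
    using riesz_closed_subspace[OF V, of "inner x" "norm x"]
    by (auto simp: inner_simps Cauchy_Schwarz_ineq2)
  then show ?thesis using proj_unique[of p x] by (simp add: inner_simps)
qed

lemma proj_in: "proj V x \<in> V" using proj_properties by blast

lemma proj_orthogonal: "v \<in> V \<Longrightarrow> inner (x - proj V x) v = 0" using proj_properties by blast

lemma proj_id: "x \<in> V \<Longrightarrow> proj V x = x" by (rule proj_unique) auto

lemma proj_self_adjoint: "inner (proj V x) y = inner x (proj V y)"
  using proj_orthogonal[OF proj_in[of x], of y] proj_orthogonal[OF proj_in[of y], of x]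
  by (simp add: inner_simps inner_commute)

lemma norm_proj_le: "norm (proj V x) \<le> norm x"
proof -
  have "(norm (proj V x))\<^sup>2 = inner x (proj V x)"
    using proj_self_adjoint[of x "proj V x"] by (simp add: proj_id[OF proj_in] power2_norm_eq_inner)
  also have "\<dots> \<le> norm x * norm (proj V x)" by (rule norm_cauchy_schwarz)
  finally have "norm (proj V x) * norm (proj V x) \<le> norm x * norm (proj V x)"
    by (simp add: power2_eq_square)
  then show ?thesis by (cases "norm (proj V x) = 0") (simp, simp only: mult_le_cancel_right, simp)
qed

lemma proj_add: "proj V (x + y) = proj V x + proj V y"
proof (rule proj_unique)
  show "proj V x + proj V y \<in> V" by (intro subspace_add V proj_in)
  fix v assume "v \<in> V"
  then show "inner (x + y - (proj V x + proj V y)) v = 0"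
    using proj_orthogonal[of v x] proj_orthogonal[of v y] by (simp add: inner_add inner_diff)
qed

lemma proj_scaleR: "proj V (r *\<^sub>R x) = r *\<^sub>R proj V x"
proof (rule proj_unique)
  show "r *\<^sub>R proj V x \<in> V" by (intro subspace_scale V proj_in)
  fix v assume "v \<in> V"
  then show "inner (r *\<^sub>R x - r *\<^sub>R proj V x) v = 0"
    using proj_orthogonal[of v x] by (simp add: inner_diff)
qed

lemma bounded_linear_proj: "bounded_linear (proj V)"
  by (rule bounded_linear_intro[where K = 1]) (simp_all add: proj_add proj_scaleR norm_proj_le)

end
section \<open>Square roots by the Newton iteration\<close>

text \<open>
  The scalar iteration \<open>y \<mapsto> (1 + y\<^sup>2) / 2\<close> dominates the operator iteration both in norm and in its
  increments; the operators therefore converge in norm.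
\<close>

primrec sqrt_iter :: "('a::real_normed_vector \<Rightarrow>\<^sub>L 'a) \<Rightarrow> nat \<Rightarrow> 'a \<Rightarrow>\<^sub>L 'a" where
  "sqrt_iter Z 0 = 0"
| "sqrt_iter Z (Suc n) = (1/2) *\<^sub>R (Z + (sqrt_iter Z n o\<^sub>L sqrt_iter Z n))"

primrec sqrt_bound :: "nat \<Rightarrow> real" where
  "sqrt_bound 0 = 0"
| "sqrt_bound (Suc n) = (1 + (sqrt_bound n)\<^sup>2) / 2"

lemma sqrt_bound_range: "0 \<le> sqrt_bound n \<and> sqrt_bound n \<le> 1"
proof (induction n)
  case (Suc n)
  then have "(sqrt_bound n)\<^sup>2 \<le> 1" by (simp add: power_le_one)
  then show ?case by simp
qed simp

lemma sqrt_bound_mono: "sqrt_bound n \<le> sqrt_bound (Suc n)"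
proof -
  have "0 \<le> (1 - sqrt_bound n)\<^sup>2" by simp
  then show ?thesis by (simp add: power2_diff)
qed

lemma norm_sqrt_iter:
  assumes "norm Z \<le> 1"
  shows "norm (sqrt_iter Z n) \<le> sqrt_bound n"
proof (induction n)
  case (Suc n)
  have "norm (Z + (sqrt_iter Z n o\<^sub>L sqrt_iter Z n)) \<le> 1 + sqrt_bound n * sqrt_bound n"
    using assms Suc sqrt_bound_range[of n]
    by (intro norm_triangle_le add_mono order_trans[OF norm_blinfun_compose] mult_mono) auto
  then show ?case by (simp add: power2_eq_square)
qed simp

text \<open>Every iterate is a polynomial in \<open>Z\<close>.\<close>

lemma sqrt_iter_commute: "J o\<^sub>L Z = Z o\<^sub>L J \<Longrightarrow> J o\<^sub>L sqrt_iter Z n = sqrt_iter Z n o\<^sub>L J"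
proof (induction n)
  case (Suc n)
  have c: "J (Z x) = Z (J x)" for x
    using Suc.prems by (metis blinfun_apply_blinfun_compose)
  have "J (sqrt_iter Z n x) = sqrt_iter Z n (J x)" for x
    using Suc by (metis blinfun_apply_blinfun_compose)
  then show ?case
    by (intro blinfun_eqI) (simp add: blinfun.bilinear_simps c)
qed simp

lemma blinfun_diff_squares:
  fixes A B :: "'a::real_normed_vector \<Rightarrow>\<^sub>L 'a"
  assumes "A o\<^sub>L B = B o\<^sub>L A"
  shows "(A o\<^sub>L A) - (B o\<^sub>L B) = (A + B) o\<^sub>L (A - B)"
proof (rule blinfun_eqI)
  fix x
  have "A (B x) = B (A x)" using assms by (metis blinfun_apply_blinfun_compose)
  then show "((A o\<^sub>L A) - (B o\<^sub>L B)) x = ((A + B) o\<^sub>L (A - B)) x"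
    by (simp add: blinfun.bilinear_simps)
qed

text \<open>Consecutive iterates commute, so the difference of their squares factors as sum times
  difference. The scalar recursion factors in the same way, and the factors are compared one by
  one.\<close>

lemma sqrt_iter_increment:
  fixes Z :: "'a::real_normed_vector \<Rightarrow>\<^sub>L 'a"
  assumes Z: "norm Z \<le> 1"
  shows "norm (sqrt_iter Z (Suc n) - sqrt_iter Z n) \<le> sqrt_bound (Suc n) - sqrt_bound n"
proof (induction n)
  case 0
  show ?case using Z by simp
next
  case (Suc n)
  let ?A = "sqrt_iter Z (Suc n)" and ?B = "sqrt_iter Z n"
  \<comment> \<open>The commutation lemma is used twice: with \<open>J = Z\<close>, then with the
    iterate \<open>?A\<close> itself in the place of \<open>J\<close>.\<close>
  have "Z o\<^sub>L ?A = ?A o\<^sub>L Z" by (rule sqrt_iter_commute) simp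
  then have "?A o\<^sub>L Z = Z o\<^sub>L ?A" by simp
  then have comm: "?A o\<^sub>L ?B = ?B o\<^sub>L ?A" by (rule sqrt_iter_commute)
  have step: "sqrt_iter Z (Suc m) = (1/2) *\<^sub>R (Z + (sqrt_iter Z m o\<^sub>L sqrt_iter Z m))" for m by simp
  have "sqrt_iter Z (Suc (Suc n)) - ?A =
      (1/2) *\<^sub>R (Z + (?A o\<^sub>L ?A)) - (1/2) *\<^sub>R (Z + (?B o\<^sub>L ?B))"
    by (simp only: step)
  also have "\<dots> = (1/2) *\<^sub>R ((?A + ?B) o\<^sub>L (?A - ?B))"
    unfolding blinfun_diff_squares[OF comm, symmetric] scaleR_right_diff_distrib scaleR_right_distrib
    by (rule add_diff_cancel_left)
  also have "norm \<dots> = (1/2) * norm ((?A + ?B) o\<^sub>L (?A - ?B))" by simp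
  also have "\<dots> \<le> (1/2) * (norm (?A + ?B) * norm (?A - ?B))"
    by (intro mult_left_mono norm_blinfun_compose) simp
  also have "\<dots> \<le> (1/2) * ((sqrt_bound (Suc n) + sqrt_bound n) * (sqrt_bound (Suc n) - sqrt_bound n))"
  proof -
    have "norm (?A + ?B) \<le> sqrt_bound (Suc n) + sqrt_bound n"
      using norm_sqrt_iter[OF Z, of "Suc n"] norm_sqrt_iter[OF Z, of n] by (rule norm_triangle_mono)
    moreover have nonneg: "0 \<le> sqrt_bound (Suc n) + sqrt_bound n"
      using sqrt_bound_range[of n] sqrt_bound_range[of "Suc n"] by linarith
    ultimately have "norm (?A + ?B) * norm (?A - ?B)
        \<le> (sqrt_bound (Suc n) + sqrt_bound n) * (sqrt_bound (Suc n) - sqrt_bound n)"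
      using mult_mono[OF _ Suc.IH nonneg norm_ge_zero] by blast
    then show ?thesis by (rule mult_left_mono) simp
  qed
  also have "\<dots> = (1 + (sqrt_bound (Suc n))\<^sup>2) / 2 - (1 + (sqrt_bound n)\<^sup>2) / 2"
    by (simp add: field_simps power2_eq_square del: sqrt_bound.simps)
  also have "\<dots> = sqrt_bound (Suc (Suc n)) - sqrt_bound (Suc n)"
    by (simp only: sqrt_bound.simps)
  finally show ?case by simp
qed

text \<open>The fixed point equation says that \<open>1 - Y\<close> squares to \<open>1 - Z\<close>,
  and \<open>norm Y \<le> 1\<close> makes \<open>1 - Y\<close> positive: it is the positive square
  root of \<open>1 - Z\<close>. Commutation and self-adjointness pass from the iterates to their
  limit.\<close>

lemma sqrt_operator_exists:
  fixes Z :: "'a::{real_inner,banach} \<Rightarrow>\<^sub>L 'a"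
  assumes Z: "norm Z \<le> 1" and sa: "\<And>x y. inner (Z x) y = inner x (Z y)"
  obtains Y where "norm Y \<le> 1" "2 *\<^sub>R Y = Z + (Y o\<^sub>L Y)"
    "\<And>J. J o\<^sub>L Z = Z o\<^sub>L J \<Longrightarrow> J o\<^sub>L Y = Y o\<^sub>L J"
    "\<And>x y. inner (Y x) y = inner x (Y y)"
proof -
  let ?Y = "sqrt_iter Z"
  have "incseq sqrt_bound" by (intro incseq_SucI sqrt_bound_mono)
  then have cb: "Cauchy sqrt_bound"
    using sqrt_bound_range by (intro convergent_Cauchy Bseq_mono_convergent BseqI'[of _ 1])
      (auto simp: incseq_def)
  have tele: "norm (?Y (n + k) - ?Y n) \<le> sqrt_bound (n + k) - sqrt_bound n" for n k
  proof (induction k)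
    case (Suc k)
    have "norm (?Y (n + Suc k) - ?Y n) \<le> norm (?Y (Suc (n + k)) - ?Y (n + k)) + norm (?Y (n + k) - ?Y n)"
      using norm_triangle_ineq[of "?Y (Suc (n + k)) - ?Y (n + k)" "?Y (n + k) - ?Y n"] by simp
    also have "\<dots> \<le> sqrt_bound (n + Suc k) - sqrt_bound n"
      using Suc sqrt_iter_increment[OF Z, of "n + k"] by simp
    finally show ?case .
  qed simp
  have tele': "norm (?Y m - ?Y n) \<le> norm (sqrt_bound m - sqrt_bound n)" for m n
    using tele[of n "m - n"] tele[of m "n - m"] by (cases "n \<le> m") (auto simp: norm_minus_commute)
  have "Cauchy ?Y"
  proof (rule CauchyI)
    fix e :: real assume "e > 0"
    then obtain M where M: "\<forall>m\<ge>M. \<forall>n\<ge>M. norm (sqrt_bound m - sqrt_bound n) < e"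
      using CauchyD[OF cb] by blast
    have "norm (?Y m - ?Y n) < e" if "m \<ge> M" "n \<ge> M" for m n
      using M that by (intro order.strict_trans1[OF tele']) blast
    then show "\<exists>M. \<forall>m\<ge>M. \<forall>n\<ge>M. norm (?Y m - ?Y n) < e" by blast
  qed
  then obtain Y where lim: "?Y \<longlonglongrightarrow> Y" unfolding Cauchy_convergent_iff convergent_def by blast
  show ?thesis
  proof
    show "norm Y \<le> 1"
      using tendsto_norm[OF lim] norm_sqrt_iter[OF Z] sqrt_bound_range
      by (intro LIMSEQ_le_const2[of "\<lambda>n. norm (?Y n)"]) (auto intro: order_trans)
    have "(\<lambda>n. 2 *\<^sub>R ?Y (Suc n)) \<longlonglongrightarrow> 2 *\<^sub>R Y"
      by (intro tendsto_intros LIMSEQ_Suc lim)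
    moreover have "(\<lambda>n. 2 *\<^sub>R ?Y (Suc n)) \<longlonglongrightarrow> Z + (Y o\<^sub>L Y)"
      by (simp, intro tendsto_intros lim bounded_bilinear.tendsto[OF bounded_bilinear_blinfun_compose])
    ultimately show "2 *\<^sub>R Y = Z + (Y o\<^sub>L Y)" by (rule LIMSEQ_unique)
    show "J o\<^sub>L Y = Y o\<^sub>L J" if "J o\<^sub>L Z = Z o\<^sub>L J" for J
    proof (rule LIMSEQ_unique)
      show "(\<lambda>n. J o\<^sub>L ?Y n) \<longlonglongrightarrow> (J o\<^sub>L Y)"
        by (intro bounded_bilinear.tendsto[OF bounded_bilinear_blinfun_compose] tendsto_const lim)
      show "(\<lambda>n. J o\<^sub>L ?Y n) \<longlonglongrightarrow> (Y o\<^sub>L J)"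
        unfolding sqrt_iter_commute[OF that]
        by (intro bounded_bilinear.tendsto[OF bounded_bilinear_blinfun_compose] tendsto_const lim)
    qed
    fix x y
    have "inner (?Y n x) y = inner x (?Y n y)" for n x y
      by (induction n arbitrary: x y) (simp_all add: blinfun.bilinear_simps inner_simps sa)
    moreover have "(\<lambda>n. inner (?Y n x) y) \<longlonglongrightarrow> inner (Y x) y" "(\<lambda>n. inner x (?Y n y)) \<longlonglongrightarrow> inner x (Y y)"
      by (intro tendsto_intros lim)+
    ultimately show "inner (Y x) y = inner x (Y y)" by (auto intro: LIMSEQ_unique)
  qed
qed

section \<open>Two projections\<close>

lemma scaleR_scaleC_prod: "r *\<^sub>R (p :: l2 \<times> l2) = complex_of_real r *\<^sub>C p"
  by (cases p) (simp add: scaleC_prod_def scaleR_scaleC_l2)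

lemma subspace_of_complex_l2: "complex_vector.subspace V \<Longrightarrow> subspace (V :: l2 set)"
  unfolding subspace_def complex_vector.subspace_def scaleR_scaleC_l2 by blast

lemma subspace_of_complex_prod: "complex_vector.subspace V \<Longrightarrow> subspace (V :: (l2 \<times> l2) set)"
  unfolding subspace_def complex_vector.subspace_def scaleR_scaleC_prod by blast

text \<open>A complex multiple is a real combination of \<open>x\<close> and
  \<open>\<i> *\<^sub>C x\<close>. Spaces obtained by real methods thus become complex once they are
  invariant under \<i>.\<close>

lemma complex_subspace_from_real:
  fixes V :: "(l2 \<times> l2) set"
  assumes V: "subspace V" and ii: "\<And>v. v \<in> V \<Longrightarrow> \<i> *\<^sub>C v \<in> V"
  shows "complex_vector.subspace V"
proof (rule complex_vector.subspaceI)
  fix c x assume x: "x \<in> V"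
  have "c *\<^sub>C x = Re c *\<^sub>R x + Im c *\<^sub>R (\<i> *\<^sub>C x)"
    unfolding scaleR_scaleC_prod scaleC_scaleC scaleC_add_left[symmetric]
    by (simp add: complex_eq[symmetric] mult.commute)
  then show "c *\<^sub>C x \<in> V" using V x ii by (simp add: subspace_add subspace_scale)
qed (use V in \<open>auto simp: subspace_0 subspace_add\<close>)

lemma inner_ii_prod: "inner (\<i> *\<^sub>C p) (\<i> *\<^sub>C q) = inner p (q :: l2 \<times> l2)"
  by (simp add: scaleC_prod_def inner_prod_def inner_ii_l2)

text \<open>An isometry with square -1 is skew-adjoint for the real inner product.\<close>

lemma inner_ii_prod_left: "inner (\<i> *\<^sub>C p) q = - inner p (\<i> *\<^sub>C q :: l2 \<times> l2)"
proof -
  have "\<i> *\<^sub>C \<i> *\<^sub>C q = - q"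
    using scaleR_scaleC_prod[of "-1" q] by (simp add: scaleC_scaleC)
  then show ?thesis using inner_ii_prod[of p "\<i> *\<^sub>C q"] by (simp add: inner_ii_prod)
qed

lemma bounded_linear_ii: "bounded_linear (\<lambda>p :: l2 \<times> l2. \<i> *\<^sub>C p)"
proof (rule bounded_linear_intro[where K = 1])
  show "\<i> *\<^sub>C (r *\<^sub>R p) = r *\<^sub>R \<i> *\<^sub>C p" for r and p :: "l2 \<times> l2"
    by (simp add: scaleR_scaleC_prod scaleC_scaleC mult.commute)
  show "norm (\<i> *\<^sub>C p) \<le> norm p * 1" for p :: "l2 \<times> l2"
    by (simp add: norm_eq_sqrt_inner inner_ii_prod)
qed (simp add: scaleC_add_right)

text \<open>Its quadratic form is the squared norm of the row part minus that of the column part;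
  the sign of the form tells which part dominates.\<close>

definition reflect :: "l2 \<times> l2 \<Rightarrow> l2 \<times> l2" where
  "reflect p = (fst p, - snd p)"

lemma bounded_linear_reflect: "bounded_linear reflect"
proof (rule bounded_linear_intro[where K = 1])
  show "norm (reflect p) \<le> norm p * 1" for p
    by (simp add: reflect_def norm_prod_def)
qed (simp_all add: reflect_def)

lemma reflect_self_adjoint: "inner (reflect p) q = inner p (reflect q)"
  by (simp add: reflect_def inner_prod_def)

lemma norm_reflect [simp]: "norm (reflect p) = norm p"
  by (simp add: reflect_def norm_prod_def)

lemma reflect_ii: "reflect (\<i> *\<^sub>C p) = \<i> *\<^sub>C reflect p"
  using scaleR_scaleC_l2[of "-1"]
  by (simp add: reflect_def scaleC_prod_def scaleC_scaleC)

text \<open>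
  \<open>H\<close> and \<open>K\<close> are spectral subspaces of the compression \<open>X\<close> of \<open>reflect\<close> to \<open>V\<close>: with \<open>G = \<bar>X\<bar>\<close>,
  \<open>X = G\<close> on \<open>H\<close> and \<open>X = - G\<close> on its complement \<open>K\<close>.
\<close>

lemma two_projections_decomposition:
  fixes V :: "(l2 \<times> l2) set"
  assumes V: "complex_vector.subspace V" "closed V"
  obtains H K where "complex_vector.subspace H" "closed H" "H \<subseteq> V"
    "complex_vector.subspace K" "closed K" "K \<subseteq> V"
    "\<And>v. v \<in> V \<Longrightarrow> \<exists>h\<in>H. \<exists>k\<in>K. v = h + k"
    "\<And>h k. h \<in> H \<Longrightarrow> k \<in> K \<Longrightarrow> inner (fst h) (fst k) = 0 \<and> inner (snd h) (snd k) = 0"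
    "\<And>h. h \<in> H \<Longrightarrow> norm (snd h) \<le> norm (fst h)"
    "\<And>k. k \<in> K \<Longrightarrow> norm (fst k) \<le> norm (snd k)"
proof -
  have Vr: "subspace V" by (rule subspace_of_complex_prod[OF V(1)])
  note P = proj_in[OF Vr V(2)] proj_id[OF Vr V(2)] norm_proj_le[OF Vr V(2)]
    proj_self_adjoint[OF Vr V(2)] proj_orthogonal[OF Vr V(2)]
  define Q where "Q = Blinfun (proj V)"
  have Q: "Q p = proj V p" for p
    unfolding Q_def by (subst bounded_linear_Blinfun_apply[OF bounded_linear_proj[OF Vr V(2)]]) simp
  define R where "R = Blinfun reflect"
  have R: "R p = reflect p" for p
    unfolding R_def by (subst bounded_linear_Blinfun_apply[OF bounded_linear_reflect]) simp
  define J where "J = Blinfun (\<lambda>p :: l2 \<times> l2. \<i> *\<^sub>C p)"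
  have J: "J p = \<i> *\<^sub>C p" for p
    unfolding J_def by (subst bounded_linear_Blinfun_apply[OF bounded_linear_ii]) simp
  have JV: "\<i> *\<^sub>C v \<in> V" if "v \<in> V" for v
    using V(1) that by (rule complex_vector.subspace_scale)
  have Qii: "proj V (\<i> *\<^sub>C p) = \<i> *\<^sub>C proj V p" for p
  proof (rule proj_unique[OF Vr V(2)])
    show "\<i> *\<^sub>C proj V p \<in> V" by (intro JV P)
    fix v assume v: "v \<in> V"
    have "inner (\<i> *\<^sub>C p - \<i> *\<^sub>C proj V p) v = - inner (p - proj V p) (\<i> *\<^sub>C v)"
      by (simp add: inner_diff inner_ii_prod_left)
    then show "inner (\<i> *\<^sub>C p - \<i> *\<^sub>C proj V p) v = 0" using P(5)[OF JV[OF v]] by simp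
  qed
  \<comment> \<open>The compression is extended by 0 to the orthogonal complement of
    \<open>V\<close>, so that it is an operator on the whole space.\<close>
  define X where "X = Q o\<^sub>L R o\<^sub>L Q"
  have X: "X p = proj V (reflect (proj V p))" for p by (simp add: X_def Q R)
  have Xsa: "inner (X p) q = inner p (X q)" for p q
    by (simp add: X P(4) reflect_self_adjoint)
  have Xnorm: "norm (X p) \<le> norm p" for p
    using P(3)[of "reflect (proj V p)"] P(3)[of p] by (simp add: X)
  have XV: "X p \<in> V" for p by (simp add: X P(1))
  define Z where "Z = id_blinfun - (X o\<^sub>L X)"
  have Z: "Z p = p - X (X p)" for p by (simp add: Z_def blinfun.bilinear_simps)
  have Zsa: "inner (Z p) q = inner p (Z q)" for p q
    by (simp add: Z inner_diff Xsa)
  have "norm (Z p) \<le> 1 * norm p" for p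
  proof -
    have "inner (X (X p)) p = inner (X p) (X p)" by (rule Xsa)
    then have "(norm (Z p))\<^sup>2 = (norm p)\<^sup>2 - 2 * (norm (X p))\<^sup>2 + (norm (X (X p)))\<^sup>2"
      by (simp add: Z power2_norm_eq_inner inner_diff inner_commute)
    moreover have "(norm (X (X p)))\<^sup>2 \<le> (norm (X p))\<^sup>2" by (intro power_mono Xnorm) simp
    ultimately have "(norm (Z p))\<^sup>2 \<le> (norm p)\<^sup>2" using zero_le_power2[of "norm (X p)"] by linarith
    then show ?thesis by (simp add: power2_le_iff_abs_le)
  qed
  then have "norm Z \<le> 1" by (intro norm_blinfun_bound) auto
  then obtain Y where Y: "norm Y \<le> 1" "2 *\<^sub>R Y = Z + (Y o\<^sub>L Y)"
    and Ycomm: "\<And>J. J o\<^sub>L Z = Z o\<^sub>L J \<Longrightarrow> J o\<^sub>L Y = Y o\<^sub>L J"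
    and Ysa: "\<And>x y. inner (Y x) y = inner x (Y y)"
    using sqrt_operator_exists[OF _ Zsa] by metis
  \<comment> \<open>What commutes with \<open>X\<close> commutes with \<open>Z\<close>, hence with
    \<open>Y\<close>. Taking \<open>X\<close>, \<open>Q\<close> and \<open>J\<close> for
    \<open>T\<close> shows that \<open>Y\<close> commutes with \<open>X\<close>, preserves
    \<open>V\<close> and is complex linear.\<close>
  have commI: "T (Y p) = Y (T p)" if "\<And>p. T (X p) = X (T p)" for T :: "(l2 \<times> l2) \<Rightarrow>\<^sub>L (l2 \<times> l2)" and p
  proof -
    have "T o\<^sub>L Z = Z o\<^sub>L T"
      by (rule blinfun_eqI) (simp add: Z blinfun.bilinear_simps that)
    then have "T o\<^sub>L Y = Y o\<^sub>L T" by (rule Ycomm)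
    then show ?thesis by (metis blinfun_apply_blinfun_compose)
  qed
  have XY: "X (Y p) = Y (X p)" for p by (rule commI) simp
  have QX: "Q (X p) = X (Q p)" for p by (simp add: Q X P(1,2))
  have QY: "proj V (Y p) = Y (proj V p)" for p using commI[of Q, OF QX] by (simp add: Q)
  have JX: "J (X p) = X (J p)" for p by (simp add: J X Qii reflect_ii)
  have JY: "\<i> *\<^sub>C Y p = Y (\<i> *\<^sub>C p)" for p using commI[of J, OF JX] by (simp add: J)
  have JX': "\<i> *\<^sub>C X p = X (\<i> *\<^sub>C p)" for p using JX by (simp add: J)
  have YV: "Y v \<in> V" if "v \<in> V" for v using P(1)[of "Y v"] QY[of v] P(2)[OF that] by simp
  have YY: "Y (Y p) = 2 *\<^sub>R Y p - p + X (X p)" for p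
    using arg_cong[OF Y(2), of "\<lambda>T. T p"] by (simp add: blinfun.bilinear_simps Z algebra_simps)
  \<comment> \<open>\<open>G\<close> is the absolute value of \<open>X\<close>: since
    \<open>2 Y = Z + Y^2\<close>, one has \<open>(1 - Y)^2 = 1 - Z = X^2\<close>.\<close>
  define G where "G = id_blinfun - Y"
  have G: "G p = p - Y p" for p by (simp add: G_def blinfun.bilinear_simps)
  have GG: "G (G p) = X (X p)" for p
    by (simp add: G blinfun.bilinear_simps YY scaleR_2)
  have XG: "X (G p) = G (X p)" for p by (simp add: G blinfun.bilinear_simps XY)
  have Gpos: "0 \<le> inner (G p) p" for p
  proof -
    have "inner (Y p) p \<le> norm (Y p) * norm p" by (rule norm_cauchy_schwarz)
    also have "\<dots> \<le> (1 * norm p) * norm p"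
      by (intro mult_right_mono order_trans[OF norm_blinfun] Y(1)) simp_all
    finally show ?thesis by (simp add: G inner_diff power2_norm_eq_inner[symmetric] power2_eq_square)
  qed
  have GV: "G v \<in> V" if "v \<in> V" for v using that YV Vr by (simp add: G subspace_diff)
  have refl_X: "inner (reflect v) w = inner (X v) w" if "v \<in> V" "w \<in> V" for v w
    using P(4)[of "reflect v" w] that by (simp add: X P(2))
  define H where "H = {v \<in> V. X v = G v}"
  \<comment> \<open>\<open>K\<close> is taken as the complement of \<open>H\<close> in
    \<open>V\<close> rather than as the kernel of \<open>X + G\<close>: vectors of \<open>V\<close>
    killed by \<open>X\<close> are killed by \<open>G\<close> too and lie in \<open>H\<close>, so
    both kernels would contain them.\<close>
  define K where "K = {k \<in> V. \<forall>h\<in>H. inner h k = 0}"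
  have Hsub: "subspace H"
    unfolding H_def subspace_def using Vr
    by (auto simp: blinfun.bilinear_simps subspace_0 subspace_add subspace_scale)
  have Hclosed: "closed H"
    unfolding H_def Collect_conj_eq by (intro closed_Int closed_Collect_eq) (auto intro: V continuous_intros)
  have HH: "complex_vector.subspace H"
    by (rule complex_subspace_from_real[OF Hsub])
      (auto simp: H_def JV JX'[symmetric] G JY[symmetric] complex_vector.scale_right_diff_distrib)
  have Ksub: "subspace K"
    unfolding K_def subspace_def using Vr
    by (auto simp: inner_add subspace_0 subspace_add subspace_scale)
  have Kclosed: "closed K"
    unfolding K_def Collect_conj_eq Ball_def
    by (intro closed_Int closed_Collect_all closed_Collect_imp closed_Collect_eq)
       (auto intro: V continuous_intros)
  have KK: "complex_vector.subspace K"
  proof (rule complex_subspace_from_real[OF Ksub])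
    fix k assume k: "k \<in> K"
    have "inner h (\<i> *\<^sub>C k) = 0" if "h \<in> H" for h
    proof -
      have "\<i> *\<^sub>C h \<in> H" using HH that by (rule complex_vector.subspace_scale)
      then have "inner (\<i> *\<^sub>C h) k = 0" using k by (simp add: K_def)
      then show ?thesis by (simp add: inner_ii_prod_left)
    qed
    then show "\<i> *\<^sub>C k \<in> K" using k JV by (simp add: K_def)
  qed
  \<comment> \<open>\<open>(X - G) (X + G) = X^2 - G^2 = 0\<close>, because \<open>G\<close>
    commutes with \<open>X\<close>.\<close>
  have XGH: "X w + G w \<in> H" if "w \<in> V" for w
    using XV GV[OF that] Vr by (simp add: H_def subspace_add blinfun.bilinear_simps GG XG)
  \<comment> \<open>With \<open>w = (X + G) k\<close>, the vector \<open>(X + G) w\<close> lies in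
    \<open>H\<close> and is orthogonal to \<open>k\<close>. Moving the self-adjoint
    \<open>X + G\<close> to the other side turns this into \<open>inner w w = 0\<close>.\<close>
  have KX: "X k = - G k" if k: "k \<in> K" for k
  proof -
    have kV: "k \<in> V" using k by (simp add: K_def)
    let ?w = "X k + G k"
    have "X ?w + G ?w \<in> H" by (intro XGH subspace_add Vr XV GV kV)
    then have "inner (X ?w + G ?w) k = 0" using k by (simp add: K_def)
    moreover have "inner (G ?w) k = inner ?w (G k)" by (simp add: G inner_diff Ysa)
    ultimately have "inner ?w ?w = 0" by (simp only: inner_add_left inner_add_right Xsa)
    then show ?thesis by (simp add: eq_neg_iff_add_eq_0)
  qed
  show ?thesis
  proof
    show "complex_vector.subspace H" "closed H" "complex_vector.subspace K" "closed K" by fact+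
    show "H \<subseteq> V" "K \<subseteq> V" by (auto simp: H_def K_def)
    fix v assume v: "v \<in> V"
    let ?h = "proj H v"
    have h: "?h \<in> H" by (rule proj_in[OF Hsub Hclosed])
    then have "v - ?h \<in> K"
      using v Vr proj_orthogonal[OF Hsub Hclosed] by (auto simp: K_def H_def subspace_diff inner_commute)
    with h show "\<exists>h\<in>H. \<exists>k\<in>K. v = h + k" by (metis add_diff_cancel_left' diff_add_cancel add.commute)
  next
    fix h k assume h: "h \<in> H" and k: "k \<in> K"
    have kV: "k \<in> V" "h \<in> V" using h k by (auto simp: K_def H_def)
    \<comment> \<open>\<open>H\<close> is invariant under \<open>X\<close>, so \<open>h\<close> and
      \<open>reflect h\<close> are both orthogonal to \<open>k\<close>. Sum and difference of the
      two relations separate the components.\<close>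
    have "X (X h) = G (X h)" using h XG[of h] by (simp add: H_def)
    then have "X h \<in> H" using XV by (simp add: H_def)
    then have "inner (reflect h) k = 0" using k refl_X[OF kV(2,1)] by (simp add: K_def)
    moreover have "inner h k = 0" using h k by (simp add: K_def)
    ultimately show "inner (fst h) (fst k) = 0 \<and> inner (snd h) (snd k) = 0"
      by (simp add: reflect_def inner_prod_def)
  next
    fix h assume h: "h \<in> H"
    then have "0 \<le> inner (reflect h) h" using Gpos[of h] refl_X[of h h] by (simp add: H_def)
    then have "(norm (snd h))\<^sup>2 \<le> (norm (fst h))\<^sup>2"
      by (simp add: reflect_def inner_prod_def power2_norm_eq_inner)
    then show "norm (snd h) \<le> norm (fst h)" by (rule power2_le_imp_le) simp
  next
    fix k assume k: "k \<in> K"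
    then have "inner (reflect k) k \<le> 0" using Gpos[of k] refl_X[of k k] KX[OF k] by (simp add: K_def)
    then have "(norm (fst k))\<^sup>2 \<le> (norm (snd k))\<^sup>2"
      by (simp add: reflect_def inner_prod_def power2_norm_eq_inner)
    then show "norm (fst k) \<le> norm (snd k)" by (rule power2_le_imp_le) simp
  qed
qed

section \<open>The complex inner product and functionals\<close>

definition cinner :: "l2 \<Rightarrow> l2 \<Rightarrow> complex" where
  "cinner x y = (\<Sum>i. Rep_l2 x i * cnj (Rep_l2 y i))"

lemma summable_cinner: "summable (\<lambda>i. Rep_l2 x i * cnj (Rep_l2 y i))"
  using summable_mult_sq[OF summable_Rep_l2[of x], of "\<lambda>i. cnj (Rep_l2 y i)"] summable_Rep_l2[of y]
  by (intro summable_norm_cancel[of "\<lambda>i. Rep_l2 x i * cnj (Rep_l2 y i)"]) simp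

lemma Re_cinner: "Re (cinner x y) = inner x y"
  unfolding cinner_def inner_l2_def by (rule Re_suminf[OF summable_cinner])

lemma cinner_add_left: "cinner (x + y) z = cinner x z + cinner y z"
  unfolding cinner_def suminf_add[OF summable_cinner summable_cinner]
  by (simp add: plus_l2.rep_eq algebra_simps)

lemma cinner_scaleC_left: "cinner (c *\<^sub>C x) y = c * cinner x y"
  unfolding cinner_def suminf_mult[OF summable_cinner, symmetric]
  by (simp add: scaleC_l2.rep_eq algebra_simps)

lemma cinner_commute: "cinner y x = cnj (cinner x y)"
proof -
  have "(\<lambda>i. cnj (Rep_l2 x i * cnj (Rep_l2 y i))) sums cnj (cinner x y)"
    unfolding cinner_def using summable_sums[OF summable_cinner[of x y]] by (simp only: sums_cnj)
  then show ?thesis by (simp add: cinner_def sums_iff mult.commute)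
qed

lemma cinner_self: "cinner x x = complex_of_real ((norm x)\<^sup>2)"
proof (rule complex_eqI)
  show "Re (cinner x x) = Re (complex_of_real ((norm x)\<^sup>2))"
    by (simp add: Re_cinner power2_norm_eq_inner)
  have "Im (cinner x x) = - Im (cinner x x)" using arg_cong[OF cinner_commute[of x x], of Im] by simp
  then show "Im (cinner x x) = Im (complex_of_real ((norm x)\<^sup>2))" by simp
qed

text \<open>Multiplying \<open>x\<close> by the conjugate of the inner product makes that product
  real and nonnegative, which reduces the claim to the real Cauchy-Schwarz inequality.\<close>

lemma cmod_cinner_le: "cmod (cinner x y) \<le> norm x * norm y"
proof -
  define z where "z = cinner x y"
  have "(cmod z)\<^sup>2 = Re (cinner (cnj z *\<^sub>C x) y)"
    unfolding cinner_scaleC_left z_def[symmetric] cmod_power2 by (simp add: power2_eq_square)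
  also have "\<dots> \<le> norm (cnj z *\<^sub>C x) * norm y" unfolding Re_cinner by (rule norm_cauchy_schwarz)
  also have "\<dots> = cmod z * (norm x * norm y)" by simp
  finally have "cmod z * cmod z \<le> cmod z * (norm x * norm y)" by (simp only: power2_eq_square)
  then show ?thesis
    unfolding z_def[symmetric] by (cases "z = 0") (simp_all add: mult_le_cancel_left)
qed

lemma clinear_onD:
  assumes "clinear_on V T"
  shows "x \<in> V \<Longrightarrow> y \<in> V \<Longrightarrow> T (x + y) = T x + T y" "x \<in> V \<Longrightarrow> T (c *\<^sub>C x) = c *\<^sub>C T x"
  using assms by (auto simp: clinear_on_def)

lemma clinear_on_zero: "clinear_on V T \<Longrightarrow> complex_vector.subspace V \<Longrightarrow> T 0 = 0"
  using clinear_onD(2)[of V T 0 0] complex_vector.subspace_0[of V] by simp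

lemma clinear_on_sum:
  assumes T: "clinear_on V T" and V: "complex_vector.subspace V" and x: "\<And>i. i \<in> I \<Longrightarrow> x i \<in> V"
  shows "T (\<Sum>i\<in>I. c i *\<^sub>C x i) = (\<Sum>i\<in>I. c i *\<^sub>C T (x i))"
  using x
proof (induction I rule: infinite_finite_induct)
  case (insert a I)
  have "(\<Sum>i\<in>I. c i *\<^sub>C x i) \<in> V" "c a *\<^sub>C x a \<in> V"
    using V insert by (auto intro!: complex_vector.subspace_sum complex_vector.subspace_scale)
  then show ?case using T insert by (simp add: clinear_onD)
qed (use clinear_on_zero[OF T V] in auto)

lemma clinear_on_diff:
  assumes "clinear_on V T" "complex_vector.subspace V" "x \<in> V" "y \<in> V"
  shows "T (x - y) = T x - T y"
  using clinear_onD(1)[OF assms(1) complex_vector.subspace_diff[OF assms(2-4)] assms(4)] by simp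

text \<open>The real theorem represents the real part of \<open>f\<close>; the imaginary part
  follows by evaluating at \<open>\<i> *\<^sub>C v\<close>.\<close>

lemma riesz_complex:
  assumes D: "complex_vector.subspace D" "closed D"
    and f: "clinear_on D f" and bound: "\<And>v. v \<in> D \<Longrightarrow> cmod (f v) \<le> C * norm v"
  shows "\<exists>y\<in>D. \<forall>v\<in>D. f v = cinner v y"
proof -
  note Dr = subspace_of_complex_l2[OF D(1)]
  have "\<exists>y\<in>D. \<forall>v\<in>D. Re (f v) = inner y v"
  proof (rule riesz_closed_subspace[OF Dr D(2)])
    show "\<bar>Re (f x)\<bar> \<le> C * norm x" if "x \<in> D" for x
      using bound[OF that] abs_Re_le_cmod[of "f x"] by linarith
  qed (simp_all add: clinear_onD[OF f] scaleR_scaleC_l2 scaleC_complex_def)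
  then obtain y where y: "y \<in> D" "\<And>v. v \<in> D \<Longrightarrow> Re (f v) = inner v y" by (metis inner_commute)
  have "f v = cinner v y" if v: "v \<in> D" for v
  proof (rule complex_eqI)
    show "Re (f v) = Re (cinner v y)" using y(2)[OF v] by (simp add: Re_cinner)
    have "\<i> *\<^sub>C v \<in> D" using D(1) v by (rule complex_vector.subspace_scale)
    then have "Re (f (\<i> *\<^sub>C v)) = Re (cinner (\<i> *\<^sub>C v) y)" using y(2) by (simp add: Re_cinner)
    then show "Im (f v) = Im (cinner v y)"
      using clinear_onD(2)[OF f v] by (simp add: scaleC_complex_def cinner_scaleC_left)
  qed
  with y show ?thesis by blast
qed

section \<open>Unit vectors and coordinate expansions\<close>

lift_definition basis :: "nat \<Rightarrow> l2" is "\<lambda>k i. if i = k then 1 else 0"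
proof -
  fix k :: nat
  have "(\<lambda>i. (cmod (if i = k then 1 else 0))\<^sup>2) = (\<lambda>i. if i = k then 1 else 0)" by auto
  then show "summable (\<lambda>i. (cmod (if i = k then 1 else 0))\<^sup>2)" by simp
qed

lemma Rep_l2_partial_sum: "Rep_l2 (\<Sum>k<N. c k *\<^sub>C basis k) i = (if i < N then c i else 0)"
  unfolding Rep_l2_sum by (simp add: scaleC_l2.rep_eq basis.rep_eq if_distrib[of "(*) _"] cong: if_cong)

lemma norm_partial_sum: "norm (\<Sum>k<N. c k *\<^sub>C basis k) = L2_set (\<lambda>k. cmod (c k)) {..<N}"
proof -
  have "(\<Sum>i. (cmod (Rep_l2 (\<Sum>k<N. c k *\<^sub>C basis k) i))\<^sup>2) = (\<Sum>i<N. (cmod (c i))\<^sup>2)"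
    unfolding Rep_l2_partial_sum by (subst suminf_finite[of "{..<N}"]) auto
  then show ?thesis by (simp add: norm_l2 L2_set_def)
qed

lemma basis_expansion: "(\<lambda>N. \<Sum>k<N. Rep_l2 v k *\<^sub>C basis k) \<longlonglongrightarrow> v"
proof (rule LIM_zero_cancel, rule tendsto_norm_zero_cancel)
  have "(norm ((\<Sum>k<N. Rep_l2 v k *\<^sub>C basis k) - v))\<^sup>2 = (norm v)\<^sup>2 - (\<Sum>k<N. (cmod (Rep_l2 v k))\<^sup>2)" for N
  proof -
    let ?f = "\<lambda>i. (cmod (Rep_l2 ((\<Sum>k<N. Rep_l2 v k *\<^sub>C basis k) - v) i))\<^sup>2"
    let ?g = "\<lambda>i. if i \<in> {..<N} then (cmod (Rep_l2 v i))\<^sup>2 else 0"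
    have "?f i = (cmod (Rep_l2 v i))\<^sup>2 - ?g i" for i
      by (simp add: minus_l2.rep_eq Rep_l2_partial_sum)
    moreover have "(\<lambda>i. (cmod (Rep_l2 v i))\<^sup>2 - ?g i) sums ((norm v)\<^sup>2 - (\<Sum>k<N. (cmod (Rep_l2 v k))\<^sup>2))"
      by (intro sums_diff sums_norm_l2_sq sums_If_finite_set) simp
    ultimately show ?thesis unfolding norm_l2_sq[of "_ - v"] by (simp add: sums_iff)
  qed
  moreover have "(\<lambda>N. (norm v)\<^sup>2 - (\<Sum>k<N. (cmod (Rep_l2 v k))\<^sup>2)) \<longlonglongrightarrow> (norm v)\<^sup>2 - (norm v)\<^sup>2"
    using sums_norm_l2_sq[of v] by (intro tendsto_intros) (simp add: sums_def)
  ultimately have "(\<lambda>N. (norm ((\<Sum>k<N. Rep_l2 v k *\<^sub>C basis k) - v))\<^sup>2) \<longlonglongrightarrow> 0" by simp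
  from tendsto_real_sqrt[OF this]
  show "(\<lambda>N. norm ((\<Sum>k<N. Rep_l2 v k *\<^sub>C basis k) - v)) \<longlonglongrightarrow> 0" by simp
qed

text \<open>The crude bound \<open>b\<close> supplies continuity; Cauchy-Schwarz on the finite
  expansions supplies the constant \<open>sqrt S\<close>, which survives in the limit.\<close>

lemma functional_bound_by_basis:
  assumes f: "clinear_on UNIV f" and b: "\<And>v. cmod (f v) \<le> b * norm v"
    and S: "\<And>N. (\<Sum>k<N. (cmod (f (basis k)))\<^sup>2) \<le> S"
  shows "cmod (f v) \<le> sqrt S * norm v"
proof (rule LIMSEQ_le_const2)
  let ?v = "\<lambda>N. \<Sum>k<N. Rep_l2 v k *\<^sub>C basis k"
  have "(\<lambda>N. f (?v N)) \<longlonglongrightarrow> f v"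
  proof (rule LIM_zero_cancel, rule Lim_null_comparison)
    have "norm (f (?v N) - f v) \<le> b * norm (?v N - v)" for N
      using b[of "?v N - v"] clinear_on_diff[OF f complex_vector.subspace_UNIV, of "?v N" v] by simp
    then show "\<forall>\<^sub>F N in sequentially. norm (f (?v N) - f v) \<le> b * norm (?v N - v)" by simp
    show "(\<lambda>N. b * norm (?v N - v)) \<longlonglongrightarrow> 0"
      using tendsto_mult_right_zero[OF tendsto_norm_zero[OF LIM_zero[OF basis_expansion[of v]]], of b] by simp
  qed
  then show "(\<lambda>N. cmod (f (?v N))) \<longlonglongrightarrow> cmod (f v)" by (rule tendsto_norm)
  have "cmod (f (?v N)) \<le> sqrt S * norm v" for N
  proof -
    have "f (?v N) = (\<Sum>k<N. Rep_l2 v k *\<^sub>C f (basis k))"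
      by (rule clinear_on_sum[OF f]) simp_all
    also have "cmod \<dots> \<le> (\<Sum>k<N. \<bar>cmod (f (basis k))\<bar> * \<bar>cmod (Rep_l2 v k)\<bar>)"
      by (rule order_trans[OF norm_sum]) (simp add: scaleC_complex_def norm_mult mult.commute)
    also have "\<dots> \<le> L2_set (\<lambda>k. cmod (f (basis k))) {..<N} * L2_set (\<lambda>k. cmod (Rep_l2 v k)) {..<N}"
      by (rule L2_set_mult_ineq)
    also have "\<dots> \<le> sqrt S * norm v"
    proof (rule mult_mono)
      show "L2_set (\<lambda>k. cmod (f (basis k))) {..<N} \<le> sqrt S" using S by (simp add: L2_set_def)
      show "L2_set (\<lambda>k. cmod (Rep_l2 v k)) {..<N} \<le> norm v"
        unfolding L2_set_def by (rule real_le_lsqrt) (simp_all add: sum_le_norm_l2_sq)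
      have "0 \<le> S" using S[of 0] by simp
      then show "0 \<le> sqrt S" by simp
    qed (rule L2_set_nonneg)
    finally show ?thesis .
  qed
  then show "\<exists>N. \<forall>n\<ge>N. cmod (f (?v n)) \<le> sqrt S * norm v" by blast
qed

section \<open>Bounds on matrices of vectors\<close>

text \<open>
  \<open>col_bound n x c\<close> says that the norm of \<open>x\<close> in \<open>M\<^sub>n\<close> of a column space is at most \<open>c\<close>; the norm in
  \<open>M\<^sub>n\<close> of a row space is that of the transposed matrix.
\<close>

definition col_bound :: "nat \<Rightarrow> (nat \<Rightarrow> nat \<Rightarrow> l2) \<Rightarrow> real \<Rightarrow> bool" where
  "col_bound n x c \<longleftrightarrow>
     (\<forall>t. L2_set (\<lambda>i. norm (\<Sum>j<n. t j *\<^sub>C x i j)) {..<n} \<le> c * L2_set (\<lambda>j. cmod (t j)) {..<n})"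

lemma col_boundD:
  "col_bound n x c \<Longrightarrow>
    L2_set (\<lambda>i. norm (\<Sum>j<n. t j *\<^sub>C x i j)) {..<n} \<le> c * L2_set (\<lambda>j. cmod (t j)) {..<n}"
  by (simp add: col_bound_def)

text \<open>A crude bound by the sum of all entry norms. It guarantees that the real suprema
  defining matrix norms are taken over bounded sets.\<close>

lemma col_bound_exists: "\<exists>c\<ge>0. col_bound n x c"
proof (intro exI conjI)
  define C where "C = (\<Sum>i<n. \<Sum>j<n. norm (x i j))"
  show "0 \<le> C" by (simp add: C_def sum_nonneg)
  show "col_bound n x C"
    unfolding col_bound_def
  proof
    fix t :: "nat \<Rightarrow> complex"
    have tj: "cmod (t j) \<le> L2_set (\<lambda>j. cmod (t j)) {..<n}" if "j < n" for j
      using member_le_L2_set[of "{..<n}" j "\<lambda>j. cmod (t j)"] that by simp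
    have "L2_set (\<lambda>i. norm (\<Sum>j<n. t j *\<^sub>C x i j)) {..<n} \<le> (\<Sum>i<n. norm (\<Sum>j<n. t j *\<^sub>C x i j))"
      by (rule L2_set_le_sum) simp
    also have "\<dots> \<le> (\<Sum>i<n. \<Sum>j<n. norm (x i j) * L2_set (\<lambda>j. cmod (t j)) {..<n})"
    proof (rule sum_mono, rule order_trans[OF norm_sum], rule sum_mono)
      fix i j assume "j \<in> {..<n}"
      then show "norm (t j *\<^sub>C x i j) \<le> norm (x i j) * L2_set (\<lambda>j. cmod (t j)) {..<n}"
        using mult_left_mono[OF tj[of j] norm_ge_zero[of "x i j"]] by (simp add: mult.commute)
    qed
    also have "\<dots> = C * L2_set (\<lambda>j. cmod (t j)) {..<n}"
      by (simp add: C_def sum_distrib_right)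
    finally show "L2_set (\<lambda>i. norm (\<Sum>j<n. t j *\<^sub>C x i j)) {..<n} \<le> C * L2_set (\<lambda>j. cmod (t j)) {..<n}" .
  qed
qed

lemma col_bound_1: "col_bound 1 x c \<longleftrightarrow> norm (x 0 0) \<le> c"
proof
  assume "col_bound 1 x c"
  from col_boundD[OF this, of "\<lambda>_. 1"] show "norm (x 0 0) \<le> c" by (simp add: L2_set_def)
next
  assume "norm (x 0 0) \<le> c"
  then show "col_bound 1 x c"
    by (auto simp: col_bound_def L2_set_def mult.commute[of c] mult_left_mono)
qed

text \<open>A bound on the row norm of \<open>x\<close> means that applying a different functional
  in each column is still controlled, by the square sum of the bounds \<open>r\<close>. The proof
  pairs the resulting scalar vector with its own conjugate.\<close>

lemma col_bound_functionals:
  assumes x: "col_bound n (\<lambda>i j. x j i) d" and d: "0 \<le> d"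
    and D: "complex_vector.subspace D" and xD: "\<And>i j. i < n \<Longrightarrow> j < n \<Longrightarrow> x i j \<in> D"
    and f: "\<And>j. j < n \<Longrightarrow> clinear_on D (f j)"
    and r: "\<And>j v. j < n \<Longrightarrow> v \<in> D \<Longrightarrow> cmod (f j v) \<le> r j * norm v"
  shows "L2_set (\<lambda>i. cmod (\<Sum>j<n. f j (x i j))) {..<n} \<le> d * L2_set r {..<n}"
proof -
  define w where "w i = (\<Sum>j<n. f j (x i j))" for i
  \<comment> \<open>Testing the transposed matrix with the conjugate of \<open>w\<close> yields the
    \<open>z j\<close>, whose square sum is at most \<open>d\<close> times the length of
    \<open>w\<close>; one factor \<open>?L\<close> then cancels.\<close>
  define z where "z j = (\<Sum>i<n. cnj (w i) *\<^sub>C x i j)" for j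
  let ?L = "L2_set (\<lambda>i. cmod (w i)) {..<n}"
  have "complex_of_real (?L\<^sup>2) = (\<Sum>i<n. cnj (w i) * w i)"
    by (simp add: L2_set_def sum_nonneg complex_norm_square[symmetric] mult.commute[of "cnj _"])
  also have "\<dots> = (\<Sum>j<n. \<Sum>i<n. cnj (w i) *\<^sub>C f j (x i j))"
  proof -
    have "cnj (w i) * w i = (\<Sum>j<n. cnj (w i) *\<^sub>C f j (x i j))" for i
      by (simp add: scaleC_complex_def sum_distrib_left[symmetric] flip: w_def)
    then have "(\<Sum>i<n. cnj (w i) * w i) = (\<Sum>i<n. \<Sum>j<n. cnj (w i) *\<^sub>C f j (x i j))" by simp
    also have "\<dots> = (\<Sum>j<n. \<Sum>i<n. cnj (w i) *\<^sub>C f j (x i j))" by (rule sum.swap)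
    finally show ?thesis .
  qed
  also have "\<dots> = (\<Sum>j<n. f j (z j))"
  proof (rule sum.cong[OF refl])
    fix j assume "j \<in> {..<n}"
    then show "(\<Sum>i<n. cnj (w i) *\<^sub>C f j (x i j)) = f j (z j)"
      using clinear_on_sum[OF f D, of j "{..<n}" "\<lambda>i. x i j" "\<lambda>i. cnj (w i)"] xD by (simp add: z_def)
  qed
  finally have eq: "complex_of_real (?L\<^sup>2) = (\<Sum>j<n. f j (z j))" .
  have "?L\<^sup>2 = cmod (complex_of_real (?L\<^sup>2))" unfolding norm_of_real by simp
  also have "\<dots> = cmod (\<Sum>j<n. f j (z j))" unfolding eq ..
  also have "\<dots> \<le> (\<Sum>j<n. \<bar>r j\<bar> * \<bar>norm (z j)\<bar>)"
  proof (rule order_trans[OF norm_sum], rule sum_mono)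
    fix j assume j: "j \<in> {..<n}"
    have "z j \<in> D"
      unfolding z_def using D xD j by (auto intro!: complex_vector.subspace_sum complex_vector.subspace_scale)
    then have "cmod (f j (z j)) \<le> r j * norm (z j)" using r j by simp
    also have "\<dots> \<le> \<bar>r j\<bar> * \<bar>norm (z j)\<bar>" by (simp add: mult_right_mono)
    finally show "cmod (f j (z j)) \<le> \<bar>r j\<bar> * \<bar>norm (z j)\<bar>" .
  qed
  also have "\<dots> \<le> L2_set r {..<n} * L2_set (\<lambda>j. norm (z j)) {..<n}" by (rule L2_set_mult_ineq)
  also have "\<dots> \<le> L2_set r {..<n} * (d * ?L)"
    using col_boundD[OF x, of "\<lambda>i. cnj (w i)"] by (intro mult_left_mono L2_set_nonneg) (simp add: z_def)
  finally have le: "?L * ?L \<le> ?L * (d * L2_set r {..<n})" by (simp add: power2_eq_square mult.commute mult.left_commute)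
  have "?L \<le> d * L2_set r {..<n}"
  proof (cases "?L = 0")
    case True
    then show ?thesis using d by (simp add: L2_set_nonneg)
  next
    case False
    then have "0 < ?L" using L2_set_nonneg[of "\<lambda>i. cmod (w i)" "{..<n}"] by linarith
    then show ?thesis using le by (simp only: mult_le_cancel_left_pos)
  qed
  then show ?thesis by (simp add: w_def)
qed

text \<open>A Hilbert--Schmidt map from a row space to a column space is completely bounded with cb
  norm at most its Hilbert--Schmidt norm. Each coordinate of \<open>M\<close> is a functional whose
  squared norm is at most a row sum \<open>S l\<close> of squared matrix entries; the estimate is
  made coordinate by coordinate, and the \<open>S l\<close> add up to at most
  \<open>c\<^sup>2\<close>.\<close>

lemma hilbert_schmidt_col_bound:
  assumes M: "clinear_on UNIV M" and b: "\<And>v. norm (M v) \<le> b * norm v"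
    and hs: "\<And>N. (\<Sum>k<N. (norm (M (basis k)))\<^sup>2) \<le> c\<^sup>2" and c: "0 \<le> c"
    and x: "col_bound n (\<lambda>i j. x j i) d" and d: "0 \<le> d"
  shows "col_bound n (\<lambda>i j. M (x i j)) (c * d)"
  unfolding col_bound_def
proof
  fix t :: "nat \<Rightarrow> complex"
  let ?T = "L2_set (\<lambda>j. cmod (t j)) {..<n}"
  define y where "y i = (\<Sum>j<n. t j *\<^sub>C x i j)" for i
  have My: "M (y i) = (\<Sum>j<n. t j *\<^sub>C M (x i j))" for i
    unfolding y_def by (rule clinear_on_sum[OF M]) simp_all
  define a where "a l k = (cmod (Rep_l2 (M (basis k)) l))\<^sup>2" for l k
  have asum: "(\<Sum>k<N. \<Sum>l<L. a l k) \<le> c\<^sup>2" for N L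
    unfolding a_def by (rule order_trans[OF sum_mono hs]) (simp add: sum_le_norm_l2_sq)
  have apart: "(\<Sum>k<N. a l k) \<le> c\<^sup>2" for N l
  proof -
    have "(\<Sum>k<N. a l k) \<le> (\<Sum>k<N. \<Sum>l<Suc l. a l k)"
      by (intro sum_mono) (simp add: a_def sum_nonneg)
    also have "\<dots> \<le> c\<^sup>2" by (rule asum)
    finally show ?thesis .
  qed
  have asummable: "summable (a l)" for l
    by (rule bounded_imp_summable[of _ "c\<^sup>2"])
      (use apart[of _ "Suc _"] in \<open>auto simp: lessThan_Suc_atMost a_def\<close>)
  define S where "S l = suminf (a l)" for l
  have S0: "0 \<le> S l" for l unfolding S_def by (rule suminf_nonneg[OF asummable]) (simp add: a_def)
  have Spart: "(\<Sum>k<N. a l k) \<le> S l" for N l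
    unfolding S_def by (rule sum_le_suminf[OF asummable]) (auto simp: a_def)
  have Ssum: "(\<Sum>l<L. S l) \<le> c\<^sup>2" for L
  proof -
    have "(\<Sum>l<L. S l) = (\<Sum>k. \<Sum>l<L. a l k)"
      unfolding S_def by (rule suminf_sum[symmetric]) (rule asummable)
    also have "\<dots> \<le> c\<^sup>2" by (rule suminf_le_const[OF summable_sum asum]) (rule asummable)
    finally show ?thesis .
  qed
  have coord: "cmod (Rep_l2 (M v) l) \<le> sqrt (S l) * norm v" for v l
  proof (rule functional_bound_by_basis)
    show "clinear_on UNIV (\<lambda>v. Rep_l2 (M v) l)"
      using clinear_onD[OF M] by (simp add: clinear_on_def plus_l2.rep_eq scaleC_l2.rep_eq scaleC_complex_def)
    show "cmod (Rep_l2 (M v) l) \<le> b * norm v" for v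
      using Rep_l2_le_norm[of "M v" l] b[of v] by linarith
    show "(\<Sum>k<N. (cmod (Rep_l2 (M (basis k)) l))\<^sup>2) \<le> S l" for N
      using Spart[of l N] by (simp add: a_def)
  qed
  \<comment> \<open>The functionals used in the columns \<open>j\<close> are the same coordinate
    functional scaled by \<open>t j\<close>, so their bounds have square sum
    \<open>?T\<^sup>2 * S l\<close>.\<close>
  have row: "(\<Sum>i<n. (cmod (Rep_l2 (M (y i)) l))\<^sup>2) \<le> d\<^sup>2 * ?T\<^sup>2 * S l" for l
  proof -
    have "L2_set (\<lambda>i. cmod (\<Sum>j<n. t j * Rep_l2 (M (x i j)) l)) {..<n}
        \<le> d * L2_set (\<lambda>j. cmod (t j) * sqrt (S l)) {..<n}"
    proof (rule col_bound_functionals[OF x d, of UNIV])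
      show "clinear_on UNIV (\<lambda>v. t j * Rep_l2 (M v) l)" for j
        using clinear_onD[OF M]
        by (simp add: clinear_on_def plus_l2.rep_eq scaleC_l2.rep_eq scaleC_complex_def algebra_simps)
      show "cmod (t j * Rep_l2 (M v) l) \<le> cmod (t j) * sqrt (S l) * norm v" for j v
        using coord[of v l] by (simp add: norm_mult mult.assoc mult_left_mono)
    qed simp_all
    also have "\<dots> = d * (?T * sqrt (S l))"
      using S0 by (simp add: L2_set_left_distrib)
    finally have "L2_set (\<lambda>i. cmod (Rep_l2 (M (y i)) l)) {..<n} \<le> d * (?T * sqrt (S l))"
      by (simp add: My Rep_l2_sum scaleC_l2.rep_eq)
    from power_mono[OF this L2_set_nonneg, of 2] show ?thesis
      using S0 by (simp add: L2_set_def sum_nonneg power_mult_distrib)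
  qed
  have "(\<Sum>i<n. (norm (M (y i)))\<^sup>2) \<le> d\<^sup>2 * ?T\<^sup>2 * c\<^sup>2"
  proof (rule LIMSEQ_le_const2)
    show "(\<lambda>L. \<Sum>i<n. \<Sum>l<L. (cmod (Rep_l2 (M (y i)) l))\<^sup>2) \<longlonglongrightarrow> (\<Sum>i<n. (norm (M (y i)))\<^sup>2)"
      using sums_norm_l2_sq unfolding sums_def by (intro tendsto_sum)
    have "(\<Sum>i<n. \<Sum>l<L. (cmod (Rep_l2 (M (y i)) l))\<^sup>2) \<le> d\<^sup>2 * ?T\<^sup>2 * c\<^sup>2" for L
    proof -
      have "(\<Sum>i<n. \<Sum>l<L. (cmod (Rep_l2 (M (y i)) l))\<^sup>2) \<le> (\<Sum>l<L. d\<^sup>2 * ?T\<^sup>2 * S l)"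
        by (subst sum.swap) (intro sum_mono row)
      also have "\<dots> \<le> d\<^sup>2 * ?T\<^sup>2 * c\<^sup>2"
        unfolding sum_distrib_left[symmetric] by (intro mult_left_mono Ssum) simp
      finally show ?thesis .
    qed
    then show "\<exists>N. \<forall>L\<ge>N. (\<Sum>i<n. \<Sum>l<L. (cmod (Rep_l2 (M (y i)) l))\<^sup>2) \<le> d\<^sup>2 * ?T\<^sup>2 * c\<^sup>2" by blast
  qed
  also have "\<dots> = (c * d * ?T)\<^sup>2" by (simp add: power_mult_distrib)
  finally have "L2_set (\<lambda>i. norm (M (y i))) {..<n} \<le> c * d * ?T"
    unfolding L2_set_def[of "\<lambda>i. norm (M (y i))"]
    using c d by (intro real_le_lsqrt) (simp_all add: L2_set_nonneg sum_nonneg)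
  then show "L2_set (\<lambda>i. norm (\<Sum>j<n. t j *\<^sub>C M (x i j))) {..<n} \<le> c * d * ?T" by (simp add: My)
qed

section \<open>Operator norms and matrix norms\<close>

text \<open>What rescaling to the unit ball requires. It holds for \<open>ell2\<close>, its
  subspaces, their duals and \<open>scalars\<close>, so one characterisation of operator norms
  serves all of them.\<close>

definition positively_homogeneous :: "'a::complex_vector nspace \<Rightarrow> bool" where
  "positively_homogeneous X \<longleftrightarrow> 0 \<in> vecs X \<and>
     (\<forall>x\<in>vecs X. 0 \<le> nrm X x \<and>
        (\<forall>r\<ge>0. complex_of_real r *\<^sub>C x \<in> vecs X \<and> nrm X (complex_of_real r *\<^sub>C x) = r * nrm X x))"

lemma positively_homogeneousD:
  assumes "positively_homogeneous X"
  shows "0 \<in> vecs X" "x \<in> vecs X \<Longrightarrow> 0 \<le> nrm X x"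
    "x \<in> vecs X \<Longrightarrow> 0 \<le> r \<Longrightarrow> complex_of_real r *\<^sub>C x \<in> vecs X"
    "x \<in> vecs X \<Longrightarrow> 0 \<le> r \<Longrightarrow> nrm X (complex_of_real r *\<^sub>C x) = r * nrm X x"
  using assms by (auto simp: positively_homogeneous_def)

lemma nrm_zero: "positively_homogeneous X \<Longrightarrow> nrm X 0 = 0"
  using positively_homogeneousD(1) positively_homogeneousD(4)[of X 0 0] by fastforce

context
  fixes X :: "'a::complex_vector nspace" and Y :: "'b nspace" and T :: "'a \<Rightarrow> 'b" and b :: real
  assumes X: "positively_homogeneous X"
    and hom: "\<And>x r. x \<in> vecs X \<Longrightarrow> 0 \<le> r \<Longrightarrow> nrm Y (T (complex_of_real r *\<^sub>C x)) = r * nrm Y (T x)"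
    and bound: "\<And>x. x \<in> vecs X \<Longrightarrow> nrm Y (T x) \<le> b * nrm X x"
begin

lemma bdd_above_op_norm: "bdd_above ((\<lambda>x. nrm Y (T x)) ` {x \<in> vecs X. nrm X x \<le> 1})"
proof (rule bdd_aboveI2)
  fix x assume x: "x \<in> {x \<in> vecs X. nrm X x \<le> 1}"
  have "b * nrm X x \<le> \<bar>b\<bar> * 1"
    using x positively_homogeneousD(2)[OF X, of x] by (intro mult_mono) auto
  then show "nrm Y (T x) \<le> \<bar>b\<bar>" using bound[of x] x by simp
qed

lemma op_norm_nonneg: "0 \<le> op_norm X Y T"
proof -
  have "nrm Y (T 0) \<le> op_norm X Y T"
    unfolding op_norm_def
    by (rule cSUP_upper[OF _ bdd_above_op_norm]) (simp add: positively_homogeneousD(1)[OF X] nrm_zero[OF X])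
  moreover have "nrm Y (T 0) = 0" using hom[OF positively_homogeneousD(1)[OF X], of 0] by simp
  ultimately show ?thesis by simp
qed

text \<open>The a priori bound \<open>b\<close> makes the real supremum meaningful and covers
  vectors of norm 0, which cannot be rescaled; all others are scaled to norm 1.\<close>

lemma op_norm_le_iff:
  assumes c: "0 \<le> c"
  shows "op_norm X Y T \<le> c \<longleftrightarrow> (\<forall>x\<in>vecs X. nrm Y (T x) \<le> c * nrm X x)"
proof
  note X' = positively_homogeneousD[OF X]
  let ?U = "{x \<in> vecs X. nrm X x \<le> 1}"
  {
    assume le: "op_norm X Y T \<le> c"
    show "\<forall>x\<in>vecs X. nrm Y (T x) \<le> c * nrm X x"
    proof
      fix x assume x: "x \<in> vecs X"
      show "nrm Y (T x) \<le> c * nrm X x"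
      proof (cases "nrm X x = 0")
        case True
        then show ?thesis using bound[OF x] by simp
      next
        case False
        then have pos: "0 < nrm X x" using X'(2)[OF x] by simp
        let ?r = "1 / nrm X x"
        let ?x = "complex_of_real ?r *\<^sub>C x"
        have r: "0 \<le> ?r" using pos by simp
        have "?x \<in> ?U" using X'(3,4)[OF x r] pos by simp
        then have "nrm Y (T ?x) \<le> op_norm X Y T" unfolding op_norm_def by (rule cSUP_upper[OF _ bdd_above_op_norm])
        then have "?r * nrm Y (T x) \<le> c" using hom[OF x r] le by linarith
        then show ?thesis using pos by (simp add: field_simps)
      qed
    qed
  next
    assume le: "\<forall>x\<in>vecs X. nrm Y (T x) \<le> c * nrm X x"
    show "op_norm X Y T \<le> c"
      unfolding op_norm_def
    proof (rule cSUP_least)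
      show "?U \<noteq> {}" using X'(1) nrm_zero[OF X] by auto
      fix x assume x: "x \<in> ?U"
      then have "c * nrm X x \<le> c * 1" using c by (intro mult_left_mono) auto
      then show "nrm Y (T x) \<le> c" using le x by fastforce
    qed
  }
qed

lemma le_op_norm: "x \<in> vecs X \<Longrightarrow> nrm Y (T x) \<le> op_norm X Y T * nrm X x"
  using op_norm_le_iff[OF op_norm_nonneg] by blast

end

section \<open>Matrix norms on Hilbertian direct sums\<close>

lemma nrm_hsum: "nrm (hsum n X) x = L2_set (\<lambda>i. nrm X (x i)) {..<n}"
  by (simp add: hsum_def L2_set_def)

lemma vecs_hsum: "vecs (hsum n X) = {x. (\<forall>i<n. x i \<in> vecs X) \<and> (\<forall>i\<ge>n. x i = 0)}"
  by (simp add: hsum_def)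

lemma positively_homogeneous_hsum:
  assumes "positively_homogeneous X"
  shows "positively_homogeneous (hsum n X)"
  unfolding positively_homogeneous_def vecs_hsum nrm_hsum
proof (intro conjI ballI allI impI)
  note X = positively_homogeneousD[OF assms]
  show "0 \<in> {x. (\<forall>i<n. x i \<in> vecs X) \<and> (\<forall>i\<ge>n. x i = 0)}" using X by auto
  fix x assume x: "x \<in> {x. (\<forall>i<n. x i \<in> vecs X) \<and> (\<forall>i\<ge>n. x i = 0)}"
  show "0 \<le> L2_set (\<lambda>i. nrm X (x i)) {..<n}" by (rule L2_set_nonneg)
  fix r :: real assume r: "0 \<le> r"
  show "complex_of_real r *\<^sub>C x \<in> {x. (\<forall>i<n. x i \<in> vecs X) \<and> (\<forall>i\<ge>n. x i = 0)}"
    using X x r by (auto simp: scaleC_fun_def)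
  have "L2_set (\<lambda>i. nrm X ((complex_of_real r *\<^sub>C x) i)) {..<n} = L2_set (\<lambda>i. r * nrm X (x i)) {..<n}"
    using X x r by (intro L2_set_cong) (auto simp: scaleC_fun_def)
  then show "L2_set (\<lambda>i. nrm X ((complex_of_real r *\<^sub>C x) i)) {..<n} = r * L2_set (\<lambda>i. nrm X (x i)) {..<n}"
    using r by (simp add: L2_set_right_distrib)
qed

text \<open>One argument for \<open>row_space\<close> and \<open>hilbert_row\<close>:
  \<open>\<beta>\<close> is the pairing through which a vector acts as an operator on
  \<open>X\<close>. The upper bound is \<open>col_bound_functionals\<close>; the converse tests the
  matrix on elements of \<open>X\<close> norming the combinations \<open>z j\<close>.\<close>

lemma row_norm_iff:
  fixes X :: "'x::complex_vector nspace" and \<beta> :: "'x \<Rightarrow> l2 \<Rightarrow> complex"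
  assumes X: "positively_homogeneous X"
    and D: "complex_vector.subspace D" and x: "\<And>i j. i < n \<Longrightarrow> j < n \<Longrightarrow> x i j \<in> D"
    and lin: "\<And>\<xi>. \<xi> \<in> vecs X \<Longrightarrow> clinear_on D (\<beta> \<xi>)"
    and hom: "\<And>\<xi> r v. \<xi> \<in> vecs X \<Longrightarrow> 0 \<le> r \<Longrightarrow> v \<in> D \<Longrightarrow> \<beta> (complex_of_real r *\<^sub>C \<xi>) v = r * \<beta> \<xi> v"
    and bound: "\<And>\<xi> v. \<xi> \<in> vecs X \<Longrightarrow> v \<in> D \<Longrightarrow> cmod (\<beta> \<xi> v) \<le> nrm X \<xi> * norm v"
    and norming: "\<And>v. v \<in> D \<Longrightarrow> \<exists>\<xi>\<in>vecs X. nrm X \<xi> \<le> norm v \<and> \<beta> \<xi> v = complex_of_real ((norm v)\<^sup>2)"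
    and a: "\<And>\<xi>. \<xi> \<in> vecs (hsum n X) \<Longrightarrow>
      nrm (hsum n Y) (matrix_op n a \<xi>) = L2_set (\<lambda>i. cmod (\<Sum>j<n. \<beta> (\<xi> j) (x i j))) {..<n}"
    and c: "0 \<le> c"
  shows "op_norm (hsum n X) (hsum n Y) (matrix_op n a) \<le> c \<longleftrightarrow> col_bound n (\<lambda>i j. x j i) c"
proof -
  have fwd: "nrm (hsum n Y) (matrix_op n a \<xi>) \<le> d * nrm (hsum n X) \<xi>"
    if "col_bound n (\<lambda>i j. x j i) d" "0 \<le> d" "\<xi> \<in> vecs (hsum n X)" for d \<xi>
    unfolding a[OF that(3)] unfolding nrm_hsum using that
    by (intro col_bound_functionals[OF _ _ D x]) (auto simp: vecs_hsum lin bound)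
  obtain b where b: "0 \<le> b" "col_bound n (\<lambda>i j. x j i) b" using col_bound_exists by blast
  have "op_norm (hsum n X) (hsum n Y) (matrix_op n a) \<le> c \<longleftrightarrow>
      (\<forall>\<xi>\<in>vecs (hsum n X). nrm (hsum n Y) (matrix_op n a \<xi>) \<le> c * nrm (hsum n X) \<xi>)"
  proof (rule op_norm_le_iff[OF positively_homogeneous_hsum[OF X] _ fwd[OF b(2,1)] c])
    fix \<xi> and r :: real
    assume \<xi>: "\<xi> \<in> vecs (hsum n X)" and r: "0 \<le> r"
    have "cmod (\<Sum>j<n. \<beta> ((complex_of_real r *\<^sub>C \<xi>) j) (x i j)) = r * cmod (\<Sum>j<n. \<beta> (\<xi> j) (x i j))"
      if "i < n" for i
    proof -
      have "(\<Sum>j<n. \<beta> ((complex_of_real r *\<^sub>C \<xi>) j) (x i j)) = r * (\<Sum>j<n. \<beta> (\<xi> j) (x i j))"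
        unfolding sum_distrib_left
        by (rule sum.cong[OF refl]) (use \<xi> r x that in \<open>auto simp: vecs_hsum scaleC_fun_def hom\<close>)
      then show ?thesis using r by (simp add: norm_mult)
    qed
    then have "L2_set (\<lambda>i. cmod (\<Sum>j<n. \<beta> ((complex_of_real r *\<^sub>C \<xi>) j) (x i j))) {..<n} =
        L2_set (\<lambda>i. r * cmod (\<Sum>j<n. \<beta> (\<xi> j) (x i j))) {..<n}"
      by (intro L2_set_cong) auto
    then show "nrm (hsum n Y) (matrix_op n a (complex_of_real r *\<^sub>C \<xi>)) = r * nrm (hsum n Y) (matrix_op n a \<xi>)"
      using a[OF \<xi>] a[OF positively_homogeneousD(3)[OF positively_homogeneous_hsum[OF X] \<xi> r]] r
      by (simp add: L2_set_right_distrib)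
  qed
  also have "\<dots> \<longleftrightarrow> col_bound n (\<lambda>i j. x j i) c"
  proof
    assume le: "\<forall>\<xi>\<in>vecs (hsum n X). nrm (hsum n Y) (matrix_op n a \<xi>) \<le> c * nrm (hsum n X) \<xi>"
    show "col_bound n (\<lambda>i j. x j i) c"
      unfolding col_bound_def
    proof
      fix t :: "nat \<Rightarrow> complex"
      define z where "z j = (\<Sum>i<n. t i *\<^sub>C x i j)" for j
      have zD: "z j \<in> D" if "j < n" for j
        unfolding z_def using D x that
        by (auto intro!: complex_vector.subspace_sum complex_vector.subspace_scale)
      have "\<exists>\<xi>. \<forall>j<n. \<xi> j \<in> vecs X \<and> nrm X (\<xi> j) \<le> norm (z j) \<and> \<beta> (\<xi> j) (z j) = complex_of_real ((norm (z j))\<^sup>2)"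
        using norming[OF zD] by metis
      then obtain \<eta> where \<eta>: "\<And>j. j < n \<Longrightarrow> \<eta> j \<in> vecs X \<and> nrm X (\<eta> j) \<le> norm (z j) \<and>
          \<beta> (\<eta> j) (z j) = complex_of_real ((norm (z j))\<^sup>2)" by blast
      \<comment> \<open>Elements of \<open>hsum n X\<close> must vanish from index \<open>n\<close>
        on.\<close>
      define \<xi> where "\<xi> j = (if j < n then \<eta> j else 0)" for j
      have \<xi>: "\<xi> j \<in> vecs X" "nrm X (\<xi> j) \<le> norm (z j)" "\<beta> (\<xi> j) (z j) = complex_of_real ((norm (z j))\<^sup>2)"
        if "j < n" for j using \<eta>[OF that] that by (auto simp: \<xi>_def)
      have \<xi>n: "\<xi> \<in> vecs (hsum n X)" using \<xi>(1) by (simp add: vecs_hsum) (simp add: \<xi>_def)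
      define w where "w i = (\<Sum>j<n. \<beta> (\<xi> j) (x i j))" for i
      let ?Z = "L2_set (\<lambda>j. norm (z j)) {..<n}" and ?T = "L2_set (\<lambda>i. cmod (t i)) {..<n}"
      have "complex_of_real (?Z\<^sup>2) = (\<Sum>j<n. \<beta> (\<xi> j) (z j))"
        by (simp add: L2_set_def sum_nonneg \<xi>(3))
      also have "\<dots> = (\<Sum>j<n. \<Sum>i<n. t i * \<beta> (\<xi> j) (x i j))"
      proof (rule sum.cong[OF refl])
        fix j assume j: "j \<in> {..<n}"
        then show "\<beta> (\<xi> j) (z j) = (\<Sum>i<n. t i * \<beta> (\<xi> j) (x i j))"
          using clinear_on_sum[OF lin[OF \<xi>(1)] D, of j "{..<n}" "\<lambda>i. x i j" t] x
          by (simp add: z_def scaleC_complex_def)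
      qed
      also have "\<dots> = (\<Sum>i<n. t i * w i)"
        unfolding w_def sum_distrib_left by (rule sum.swap)
      finally have eq: "complex_of_real (?Z\<^sup>2) = (\<Sum>i<n. t i * w i)" .
      have "?Z\<^sup>2 = cmod (complex_of_real (?Z\<^sup>2))" unfolding norm_of_real by simp
      also have "\<dots> = cmod (\<Sum>i<n. t i * w i)" unfolding eq ..
      also have "\<dots> \<le> (\<Sum>i<n. \<bar>cmod (t i)\<bar> * \<bar>cmod (w i)\<bar>)"
        by (rule order_trans[OF norm_sum]) (simp add: norm_mult)
      also have "\<dots> \<le> ?T * L2_set (\<lambda>i. cmod (w i)) {..<n}" by (rule L2_set_mult_ineq)
      also have "\<dots> \<le> ?T * (c * ?Z)"
      proof (rule mult_left_mono[OF _ L2_set_nonneg])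
        have "L2_set (\<lambda>i. cmod (w i)) {..<n} \<le> c * L2_set (\<lambda>j. nrm X (\<xi> j)) {..<n}"
          using bspec[OF le \<xi>n] unfolding a[OF \<xi>n] unfolding nrm_hsum w_def .
        also have "\<dots> \<le> c * ?Z"
          using \<xi>(1,2) positively_homogeneousD(2)[OF X] by (intro mult_left_mono L2_set_mono c) auto
        finally show "L2_set (\<lambda>i. cmod (w i)) {..<n} \<le> c * ?Z" .
      qed
      finally have le: "?Z * ?Z \<le> ?Z * (c * ?T)" by (simp add: power2_eq_square mult.commute mult.left_commute)
      have "?Z \<le> c * ?T"
      proof (cases "?Z = 0")
        case True
        then show ?thesis using c by (simp add: L2_set_nonneg)
      next
        case False
        then have "0 < ?Z" using L2_set_nonneg[of "\<lambda>j. norm (z j)" "{..<n}"] by linarith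
        then show ?thesis using le by (simp only: mult_le_cancel_left_pos)
      qed
      then show "L2_set (\<lambda>i. norm (\<Sum>j<n. t j *\<^sub>C x j i)) {..<n} \<le> c * ?T" by (simp add: z_def)
    qed
  qed (use fwd c in blast)
  finally show ?thesis .
qed

text \<open>One argument for \<open>col_space\<close> and \<open>hilbert_col\<close>:
  \<open>\<tau> \<xi>\<close> is the scalar by which the input \<open>\<xi>\<close> multiplies a
  column vector, namely the coordinate 0 in the first case and \<open>\<xi>\<close> itself in the
  second.\<close>

lemma col_norm_iff:
  fixes X :: "'x::complex_vector nspace" and \<tau> :: "'x \<Rightarrow> complex"
  assumes X: "positively_homogeneous X"
    and hom: "\<And>\<xi> r. \<xi> \<in> vecs X \<Longrightarrow> 0 \<le> r \<Longrightarrow> \<tau> (complex_of_real r *\<^sub>C \<xi>) = r * \<tau> \<xi>"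
    and bound: "\<And>\<xi>. \<xi> \<in> vecs X \<Longrightarrow> cmod (\<tau> \<xi>) \<le> nrm X \<xi>"
    and norming: "\<And>z. \<exists>\<xi>\<in>vecs X. \<tau> \<xi> = z \<and> nrm X \<xi> \<le> cmod z"
    and a: "\<And>\<xi>. \<xi> \<in> vecs (hsum n X) \<Longrightarrow>
      nrm (hsum n Y) (matrix_op n a \<xi>) = L2_set (\<lambda>i. norm (\<Sum>j<n. \<tau> (\<xi> j) *\<^sub>C x i j)) {..<n}"
    and c: "0 \<le> c"
  shows "op_norm (hsum n X) (hsum n Y) (matrix_op n a) \<le> c \<longleftrightarrow> col_bound n x c"
proof -
  have fwd: "nrm (hsum n Y) (matrix_op n a \<xi>) \<le> d * nrm (hsum n X) \<xi>"
    if "col_bound n x d" "0 \<le> d" and \<xi>: "\<xi> \<in> vecs (hsum n X)" for d \<xi>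
  proof -
    have "nrm (hsum n Y) (matrix_op n a \<xi>) \<le> d * L2_set (\<lambda>j. cmod (\<tau> (\<xi> j))) {..<n}"
      unfolding a[OF \<xi>] by (rule col_boundD[OF that(1)])
    also have "\<dots> \<le> d * nrm (hsum n X) \<xi>"
      unfolding nrm_hsum using \<xi> that(2) by (intro mult_left_mono L2_set_mono) (auto simp: vecs_hsum bound)
    finally show ?thesis .
  qed
  obtain b where b: "0 \<le> b" "col_bound n x b" using col_bound_exists by blast
  have "op_norm (hsum n X) (hsum n Y) (matrix_op n a) \<le> c \<longleftrightarrow>
      (\<forall>\<xi>\<in>vecs (hsum n X). nrm (hsum n Y) (matrix_op n a \<xi>) \<le> c * nrm (hsum n X) \<xi>)"
  proof (rule op_norm_le_iff[OF positively_homogeneous_hsum[OF X] _ fwd[OF b(2,1)] c])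
    fix \<xi> and r :: real
    assume \<xi>: "\<xi> \<in> vecs (hsum n X)" and r: "0 \<le> r"
    have "norm (\<Sum>j<n. \<tau> ((complex_of_real r *\<^sub>C \<xi>) j) *\<^sub>C x i j) = r * norm (\<Sum>j<n. \<tau> (\<xi> j) *\<^sub>C x i j)" for i
    proof -
      have "(\<Sum>j<n. \<tau> ((complex_of_real r *\<^sub>C \<xi>) j) *\<^sub>C x i j) =
          complex_of_real r *\<^sub>C (\<Sum>j<n. \<tau> (\<xi> j) *\<^sub>C x i j)"
        unfolding complex_vector.scale_sum_right scaleC_scaleC
        by (rule sum.cong[OF refl]) (use \<xi> r in \<open>auto simp: vecs_hsum scaleC_fun_def hom\<close>)
      then show ?thesis using r by simp
    qed
    then show "nrm (hsum n Y) (matrix_op n a (complex_of_real r *\<^sub>C \<xi>)) = r * nrm (hsum n Y) (matrix_op n a \<xi>)"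
      using a[OF \<xi>] a[OF positively_homogeneousD(3)[OF positively_homogeneous_hsum[OF X] \<xi> r]] r
      by (simp add: L2_set_right_distrib)
  qed
  also have "\<dots> \<longleftrightarrow> col_bound n x c"
  proof
    assume le: "\<forall>\<xi>\<in>vecs (hsum n X). nrm (hsum n Y) (matrix_op n a \<xi>) \<le> c * nrm (hsum n X) \<xi>"
    show "col_bound n x c"
      unfolding col_bound_def
    proof
      fix t :: "nat \<Rightarrow> complex"
      have "\<forall>j. \<exists>\<xi>. \<xi> \<in> vecs X \<and> \<tau> \<xi> = t j \<and> nrm X \<xi> \<le> cmod (t j)" using norming by blast
      from choice[OF this]
      obtain \<eta> where \<eta>: "\<And>j. \<eta> j \<in> vecs X \<and> \<tau> (\<eta> j) = t j \<and> nrm X (\<eta> j) \<le> cmod (t j)"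
        by blast
      define \<xi> where "\<xi> j = (if j < n then \<eta> j else 0)" for j
      have \<xi>n: "\<xi> \<in> vecs (hsum n X)" using \<eta> by (simp add: vecs_hsum \<xi>_def)
      have "L2_set (\<lambda>i. norm (\<Sum>j<n. t j *\<^sub>C x i j)) {..<n} = nrm (hsum n Y) (matrix_op n a \<xi>)"
        unfolding a[OF \<xi>n] using \<eta> by (intro L2_set_cong arg_cong[of _ _ norm] sum.cong) (auto simp: \<xi>_def)
      also have "\<dots> \<le> c * nrm (hsum n X) \<xi>" using le \<xi>n by blast
      also have "\<dots> \<le> c * L2_set (\<lambda>j. cmod (t j)) {..<n}"
        unfolding nrm_hsum using \<eta> positively_homogeneousD(2)[OF X]
        by (intro mult_left_mono L2_set_mono c) (auto simp: \<xi>_def)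
      finally show "L2_set (\<lambda>i. norm (\<Sum>j<n. t j *\<^sub>C x i j)) {..<n} \<le> c * L2_set (\<lambda>j. cmod (t j)) {..<n}" .
    qed
  qed (use fwd c in blast)
  finally show ?thesis .
qed

section \<open>The row and column spaces in coordinates\<close>

lift_definition conj_l2 :: "l2 \<Rightarrow> l2" is "\<lambda>x i. cnj (x i)" by simp

lemma norm_conj_l2 [simp]: "norm (conj_l2 x) = norm x"
  by (simp add: norm_l2 conj_l2.rep_eq)

lemma conj_conj_l2 [simp]: "conj_l2 (conj_l2 x) = x"
  by transfer simp

lemma vecs_ell2: "vecs ell2 = range Rep_l2"
  by (simp add: ell2_def type_definition.Rep_range[OF type_definition_l2])

lemma nrm_ell2 [simp]: "nrm ell2 (Rep_l2 x) = norm x"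
  by (simp add: ell2_def norm_l2)

section \<open>Subspaces of square summable sequences as Hilbert spaces\<close>

definition hilbert_subspace :: "l2 set \<Rightarrow> (nat \<Rightarrow> complex) nspace" where
  "hilbert_subspace D = \<lparr>vecs = Rep_l2 ` D, nrm = nrm ell2\<rparr>"

lemma vecs_hilbert_subspace [simp]: "vecs (hilbert_subspace D) = Rep_l2 ` D"
  and nrm_hilbert_subspace [simp]: "nrm (hilbert_subspace D) = nrm ell2"
  by (simp_all add: hilbert_subspace_def)

lemma Rep_l2_zero: "Rep_l2 0 = 0"
  and Rep_l2_plus: "Rep_l2 (x + y) = Rep_l2 x + Rep_l2 y"
  and Rep_l2_minus: "Rep_l2 (x - y) = Rep_l2 x - Rep_l2 y"
  and Rep_l2_scaleC: "Rep_l2 (c *\<^sub>C x) = c *\<^sub>C Rep_l2 x"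
  by (simp_all add: fun_eq_iff zero_l2.rep_eq plus_l2.rep_eq minus_l2.rep_eq scaleC_l2.rep_eq
      scaleC_fun_def scaleC_complex_def)

lemma zero_in_Rep_l2_image: "0 \<in> D \<Longrightarrow> 0 \<in> Rep_l2 ` D"
  using Rep_l2_zero by force

lemma Rep_l2_sum_fun: "Rep_l2 (sum f A) = (\<Sum>a\<in>A. Rep_l2 (f a))"
  by (induction A rule: infinite_finite_induct) (simp_all add: Rep_l2_zero Rep_l2_plus)

lemma ell2_as_hilbert_subspace: "ell2 = hilbert_subspace UNIV"
  by (simp add: hilbert_subspace_def vecs_ell2[symmetric])

lemma positively_homogeneous_hilbert_subspace:
  assumes "complex_vector.subspace D"
  shows "positively_homogeneous (hilbert_subspace D)"
  unfolding positively_homogeneous_def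
  using assms zero_in_Rep_l2_image[OF complex_vector.subspace_0[OF assms]]
  by (auto simp: Rep_l2_scaleC[symmetric] complex_vector.subspace_scale)

lemma positively_homogeneous_ell2: "positively_homogeneous ell2"
  unfolding ell2_as_hilbert_subspace by (rule positively_homogeneous_hilbert_subspace) simp

lemma hilbert_space_hilbert_subspace:
  assumes D: "complex_vector.subspace D" "closed D"
  shows "hilbert_space (hilbert_subspace D)"
  unfolding hilbert_space_def
proof (intro conjI)
  show "complex_vector.subspace (vecs (hilbert_subspace D))"
    using D(1) unfolding complex_vector.subspace_def vecs_hilbert_subspace
    by (auto simp: Rep_l2_scaleC[symmetric] Rep_l2_plus[symmetric] zero_in_Rep_l2_image)
  show "\<exists>ip :: (nat \<Rightarrow> complex) \<Rightarrow> (nat \<Rightarrow> complex) \<Rightarrow> complex.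
      (\<forall>x\<in>vecs (hilbert_subspace D). \<forall>y\<in>vecs (hilbert_subspace D). \<forall>z\<in>vecs (hilbert_subspace D).
        ip (x + y) z = ip x z + ip y z) \<and>
      (\<forall>c. \<forall>x\<in>vecs (hilbert_subspace D). \<forall>y\<in>vecs (hilbert_subspace D). ip (c *\<^sub>C x) y = c * ip x y) \<and>
      (\<forall>x\<in>vecs (hilbert_subspace D). \<forall>y\<in>vecs (hilbert_subspace D). ip y x = cnj (ip x y)) \<and>
      (\<forall>x\<in>vecs (hilbert_subspace D). nrm (hilbert_subspace D) x \<ge> 0 \<and>
        ip x x = complex_of_real ((nrm (hilbert_subspace D) x)\<^sup>2)) \<and>
      (\<forall>x\<in>vecs (hilbert_subspace D). nrm (hilbert_subspace D) x = 0 \<longrightarrow> x = 0)"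
    by (rule exI[of _ "\<lambda>x y. cinner (Abs_l2 x) (Abs_l2 y)"])
      (auto simp: Rep_l2_scaleC[symmetric] Rep_l2_plus[symmetric] Rep_l2_inverse cinner_add_left
        cinner_scaleC_left cinner_self Rep_l2_zero intro: cinner_commute)
  show "\<forall>s. (\<forall>n. s n \<in> vecs (hilbert_subspace D)) \<and>
        (\<forall>e>0. \<exists>N. \<forall>m\<ge>N. \<forall>n\<ge>N. nrm (hilbert_subspace D) (s m - s n) < e) \<longrightarrow>
        (\<exists>l\<in>vecs (hilbert_subspace D). (\<lambda>n. nrm (hilbert_subspace D) (s n - l)) \<longlonglongrightarrow> 0)"
  proof (intro allI impI)
    fix s :: "nat \<Rightarrow> nat \<Rightarrow> complex"
    assume s: "(\<forall>n. s n \<in> vecs (hilbert_subspace D)) \<and>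
        (\<forall>e>0. \<exists>N. \<forall>m\<ge>N. \<forall>n\<ge>N. nrm (hilbert_subspace D) (s m - s n) < e)"
    then have "\<forall>n. \<exists>x. x \<in> D \<and> s n = Rep_l2 x" by auto
    from choice[OF this] obtain x where x: "\<And>n. x n \<in> D" "\<And>n. s n = Rep_l2 (x n)" by blast
    have "Cauchy x"
      using s by (intro CauchyI) (simp add: x Rep_l2_minus[symmetric])
    then obtain l where l: "x \<longlonglongrightarrow> l" unfolding Cauchy_convergent_iff convergent_def by blast
    have "l \<in> D" using closed_sequentially[OF D(2)] x l by blast
    moreover have "(\<lambda>n. nrm (hilbert_subspace D) (s n - Rep_l2 l)) \<longlonglongrightarrow> 0"
      using tendsto_norm_zero[OF LIM_zero[OF l]] by (simp add: x Rep_l2_minus[symmetric])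
    ultimately show "\<exists>l\<in>vecs (hilbert_subspace D). (\<lambda>n. nrm (hilbert_subspace D) (s n - l)) \<longlonglongrightarrow> 0"
      by auto
  qed
qed

lemma cinner_conj_add: "cinner x (conj_l2 (u + v)) = cinner x (conj_l2 u) + cinner x (conj_l2 v)"
proof -
  have conj: "conj_l2 (u + v) = conj_l2 u + conj_l2 v" by transfer simp
  show ?thesis
    unfolding conj by (subst (1 2 3) cinner_commute) (simp add: cinner_add_left)
qed

lemma cinner_conj_scaleC: "cinner x (conj_l2 (c *\<^sub>C v)) = c * cinner x (conj_l2 v)"
proof -
  have conj: "conj_l2 (c *\<^sub>C v) = cnj c *\<^sub>C conj_l2 v" by transfer simp
  show ?thesis
    unfolding conj by (subst (1 2) cinner_commute) (simp add: cinner_scaleC_left)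
qed

text \<open>The conjugation turns the sesquilinear \<open>cinner\<close> into the bilinear pairing
  of coordinates, so the operator is linear and depends linearly on \<open>x\<close>.\<close>

definition row_op :: "l2 \<Rightarrow> (nat \<Rightarrow> complex) \<Rightarrow> (nat \<Rightarrow> complex)" where
  "row_op x \<xi> = (if \<xi> \<in> vecs ell2 then cinner x (conj_l2 (Abs_l2 \<xi>)) *\<^sub>C Rep_l2 (basis 0) else 0)"

definition col_op :: "l2 \<Rightarrow> (nat \<Rightarrow> complex) \<Rightarrow> (nat \<Rightarrow> complex)" where
  "col_op y \<xi> = (if \<xi> \<in> vecs ell2 then \<xi> 0 *\<^sub>C Rep_l2 y else 0)"

lemma row_op_Rep: "row_op x (Rep_l2 e) = Rep_l2 (cinner x (conj_l2 e) *\<^sub>C basis 0)"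
  by (simp add: row_op_def vecs_ell2 Rep_l2_inverse Rep_l2_scaleC)

lemma col_op_Rep: "col_op y (Rep_l2 e) = Rep_l2 (Rep_l2 e 0 *\<^sub>C y)"
  by (simp add: col_op_def vecs_ell2 Rep_l2_scaleC)

lemma norm_basis [simp]: "norm (basis k) = 1"
proof -
  have "(\<lambda>i. (cmod (Rep_l2 (basis k) i))\<^sup>2) = (\<lambda>i. if i = k then 1 else 0)" by (auto simp: basis.rep_eq)
  then show ?thesis using sums_unique[OF sums_single[of k "\<lambda>_. 1 :: real"]] by (simp add: norm_l2)
qed

lemma row_op_add: "row_op (x + y) = row_op x + row_op y"
  by (auto simp: fun_eq_iff row_op_def cinner_add_left scaleC_add_left)

lemma row_op_scaleC: "row_op (c *\<^sub>C x) = c *\<^sub>C row_op x"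
  by (auto simp: fun_eq_iff row_op_def cinner_scaleC_left scaleC_fun_def scaleC_complex_def)

lemma col_op_add: "col_op (x + y) = col_op x + col_op y"
  by (auto simp: fun_eq_iff col_op_def Rep_l2_plus scaleC_add_right)

lemma col_op_scaleC: "col_op (c *\<^sub>C x) = c *\<^sub>C col_op x"
  by (auto simp: fun_eq_iff col_op_def Rep_l2_scaleC scaleC_fun_def scaleC_complex_def)

lemma mnorm_row_op:
  assumes a: "\<And>i j. i < n \<Longrightarrow> j < n \<Longrightarrow> a i j = row_op (x i j)" and c: "0 \<le> c"
  shows "mnorm row_space n a \<le> c \<longleftrightarrow> col_bound n (\<lambda>i j. x j i) c"
  unfolding row_space_def sub_opspace_def op_algebra_def opspace.simps
proof (rule row_norm_iff[where D = UNIV and \<beta> = "\<lambda>\<xi> v. cinner v (conj_l2 (Abs_l2 \<xi>))"])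
  show "clinear_on UNIV (\<lambda>v. cinner v (conj_l2 (Abs_l2 \<xi>)))" for \<xi>
    by (simp add: clinear_on_def cinner_add_left cinner_scaleC_left scaleC_complex_def)
  fix v :: l2
  show "cmod (cinner v (conj_l2 (Abs_l2 \<xi>))) \<le> nrm ell2 \<xi> * norm v" if "\<xi> \<in> vecs ell2" for \<xi>
    using that cmod_cinner_le[of v "conj_l2 (Abs_l2 \<xi>)"]
    by (auto simp: vecs_ell2 Rep_l2_inverse mult.commute)
  show "\<exists>\<xi>\<in>vecs ell2. nrm ell2 \<xi> \<le> norm v \<and> cinner v (conj_l2 (Abs_l2 \<xi>)) = complex_of_real ((norm v)\<^sup>2)"
    by (rule bexI[of _ "Rep_l2 (conj_l2 v)"]) (simp_all add: Rep_l2_inverse cinner_self vecs_ell2)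
  fix \<xi> and r :: real
  assume "\<xi> \<in> vecs ell2"
  then obtain e where e: "\<xi> = Rep_l2 e" by (auto simp: vecs_ell2)
  show "cinner v (conj_l2 (Abs_l2 (complex_of_real r *\<^sub>C \<xi>))) = complex_of_real r * cinner v (conj_l2 (Abs_l2 \<xi>))"
    unfolding e Rep_l2_scaleC[symmetric] Rep_l2_inverse by (simp add: cinner_conj_scaleC)
next
  fix \<xi> :: "nat \<Rightarrow> nat \<Rightarrow> complex" assume \<xi>: "\<xi> \<in> vecs (hsum n ell2)"
  show "nrm (hsum n ell2) (matrix_op n a \<xi>) =
      L2_set (\<lambda>i. cmod (\<Sum>j<n. cinner (x i j) (conj_l2 (Abs_l2 (\<xi> j))))) {..<n}"
    unfolding nrm_hsum
  proof (rule L2_set_cong[OF refl])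
    fix i assume i: "i \<in> {..<n}"
    have "matrix_op n a \<xi> i = (\<Sum>j<n. Rep_l2 (cinner (x i j) (conj_l2 (Abs_l2 (\<xi> j))) *\<^sub>C basis 0))"
      using i a \<xi> by (auto simp: matrix_op_def vecs_hsum row_op_def Rep_l2_scaleC intro!: sum.cong)
    also have "\<dots> = Rep_l2 ((\<Sum>j<n. cinner (x i j) (conj_l2 (Abs_l2 (\<xi> j)))) *\<^sub>C basis 0)"
      by (simp add: Rep_l2_sum_fun[symmetric] complex_vector.scale_sum_left)
    finally show "nrm ell2 (matrix_op n a \<xi> i) = cmod (\<Sum>j<n. cinner (x i j) (conj_l2 (Abs_l2 (\<xi> j))))"
      by simp
  qed
qed (simp_all add: positively_homogeneous_ell2 c)

lemma mnorm_col_op: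
  assumes a: "\<And>i j. i < n \<Longrightarrow> j < n \<Longrightarrow> a i j = col_op (x i j)" and c: "0 \<le> c"
  shows "mnorm col_space n a \<le> c \<longleftrightarrow> col_bound n x c"
  unfolding col_space_def sub_opspace_def op_algebra_def opspace.simps
proof (rule col_norm_iff[where \<tau> = "\<lambda>\<xi>. \<xi> 0"])
  show "cmod (\<xi> 0) \<le> nrm ell2 \<xi>" if "\<xi> \<in> vecs ell2" for \<xi>
    using that Rep_l2_le_norm[of "Abs_l2 \<xi>" 0] by (auto simp: vecs_ell2 Rep_l2_inverse)
  show "\<exists>\<xi>\<in>vecs ell2. \<xi> 0 = z \<and> nrm ell2 \<xi> \<le> cmod z" for z
  proof (intro bexI[of _ "Rep_l2 (z *\<^sub>C basis 0)"] conjI)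
    show "Rep_l2 (z *\<^sub>C basis 0) 0 = z" by (simp add: scaleC_l2.rep_eq basis.rep_eq)
  qed (simp_all add: vecs_ell2)
next
  fix \<xi> :: "nat \<Rightarrow> nat \<Rightarrow> complex" assume \<xi>: "\<xi> \<in> vecs (hsum n ell2)"
  show "nrm (hsum n ell2) (matrix_op n a \<xi>) = L2_set (\<lambda>i. norm (\<Sum>j<n. \<xi> j 0 *\<^sub>C x i j)) {..<n}"
    unfolding nrm_hsum
  proof (rule L2_set_cong[OF refl])
    fix i assume i: "i \<in> {..<n}"
    have "matrix_op n a \<xi> i = Rep_l2 (\<Sum>j<n. \<xi> j 0 *\<^sub>C x i j)"
      unfolding Rep_l2_sum_fun
      using i a \<xi> by (auto simp: matrix_op_def vecs_hsum col_op_def Rep_l2_scaleC intro!: sum.cong)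
    then show "nrm ell2 (matrix_op n a \<xi> i) = norm (\<Sum>j<n. \<xi> j 0 *\<^sub>C x i j)" by simp
  qed
qed (simp_all add: positively_homogeneous_ell2 c scaleC_fun_def scaleC_complex_def)

lemma row_op_in_bounded_ops: "row_op x \<in> bounded_ops ell2 ell2"
proof -
  have "clinear_on (vecs ell2) (row_op x)"
    unfolding clinear_on_def vecs_ell2
    by (auto simp: Rep_l2_plus[symmetric] Rep_l2_scaleC[symmetric] row_op_Rep cinner_conj_add
        cinner_conj_scaleC scaleC_add_left scaleC_scaleC)
  moreover have "\<exists>c. \<forall>\<xi>\<in>vecs ell2. nrm ell2 (row_op x \<xi>) \<le> c * nrm ell2 \<xi>"
    using cmod_cinner_le[of x "conj_l2 _"]
    by (intro exI[of _ "norm x"]) (auto simp: vecs_ell2 row_op_Rep)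
  ultimately show ?thesis
    by (auto simp: bounded_ops_def vecs_ell2 row_op_Rep) (simp add: row_op_def vecs_ell2)
qed

lemma col_op_in_bounded_ops: "col_op y \<in> bounded_ops ell2 ell2"
proof -
  have "clinear_on (vecs ell2) (col_op y)"
    unfolding clinear_on_def vecs_ell2
    by (auto simp: Rep_l2_plus[symmetric] Rep_l2_scaleC[symmetric] col_op_Rep)
      (auto simp: plus_l2.rep_eq scaleC_l2.rep_eq scaleC_add_left scaleC_scaleC Rep_l2_plus[symmetric])
  moreover have "\<exists>c. \<forall>\<xi>\<in>vecs ell2. nrm ell2 (col_op y \<xi>) \<le> c * nrm ell2 \<xi>"
    using mult_right_mono[OF Rep_l2_le_norm norm_ge_zero[of y]]
    by (intro exI[of _ "norm y"]) (auto simp: vecs_ell2 col_op_Rep mult.commute)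
  ultimately show ?thesis
    by (auto simp: bounded_ops_def vecs_ell2 col_op_Rep) (simp add: col_op_def vecs_ell2)
qed

lemma cinner_basis: "cinner (basis j) y = cnj (Rep_l2 y j)"
proof -
  have "(\<lambda>i. Rep_l2 (basis j) i * cnj (Rep_l2 y i)) = (\<lambda>i. if i = j then cnj (Rep_l2 y i) else 0)"
    by (auto simp: basis.rep_eq)
  then show ?thesis
    using sums_unique[OF sums_single[of j "\<lambda>i. cnj (Rep_l2 y i)"]] by (simp add: cinner_def)
qed

lemma matrix_unit_row: "matrix_unit 0 j = row_op (basis j)"
  by (auto simp: fun_eq_iff matrix_unit_def vecs_ell2 row_op_def cinner_basis conj_l2.rep_eq
      Rep_l2_inverse scaleC_fun_def scaleC_complex_def basis.rep_eq)

lemma matrix_unit_col: "matrix_unit i 0 = col_op (basis i)"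
  by (auto simp: fun_eq_iff matrix_unit_def vecs_ell2 col_op_def scaleC_fun_def scaleC_complex_def
      basis.rep_eq)

lemma row_op_diff: "row_op (x - y) = row_op x - row_op y"
  using row_op_add[of "x - y" y] by simp

lemma col_op_diff: "col_op (x - y) = col_op x - col_op y"
  using col_op_add[of "x - y" y] by simp

section \<open>Norm closures of the spans of matrix units\<close>

lemma bounded_ops_ell2_diff:
  assumes f: "f \<in> bounded_ops ell2 ell2" and g: "g \<in> bounded_ops ell2 ell2"
  shows "f - g \<in> bounded_ops ell2 ell2"
proof -
  have lin: "clinear_on (vecs ell2) (f - g)"
    using f g by (auto simp: bounded_ops_def clinear_on_def complex_vector.scale_right_diff_distrib)
  have img: "f \<xi> \<in> range Rep_l2" "g \<xi> \<in> range Rep_l2" if "\<xi> \<in> vecs ell2" for \<xi>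
    using f g that by (auto simp: bounded_ops_def vecs_ell2)
  have "(f - g) \<xi> \<in> vecs ell2" if "\<xi> \<in> vecs ell2" for \<xi>
    using img[OF that] by (auto simp: vecs_ell2 Rep_l2_minus[symmetric])
  moreover obtain b c where bc: "\<forall>\<xi>\<in>vecs ell2. nrm ell2 (f \<xi>) \<le> b * nrm ell2 \<xi>"
      "\<forall>\<xi>\<in>vecs ell2. nrm ell2 (g \<xi>) \<le> c * nrm ell2 \<xi>"
    using f g unfolding bounded_ops_def by blast
  have "nrm ell2 ((f - g) \<xi>) \<le> (b + c) * nrm ell2 \<xi>" if \<xi>: "\<xi> \<in> vecs ell2" for \<xi>
  proof -
    obtain u v where uv: "f \<xi> = Rep_l2 u" "g \<xi> = Rep_l2 v" using img[OF \<xi>] by blast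
    have "nrm ell2 ((f - g) \<xi>) = norm (u - v)" by (simp add: uv Rep_l2_minus[symmetric])
    also have "\<dots> \<le> norm u + norm v" by (rule norm_triangle_ineq4)
    also have "\<dots> \<le> b * nrm ell2 \<xi> + c * nrm ell2 \<xi>"
      using bspec[OF bc(1) \<xi>] bspec[OF bc(2) \<xi>] by (simp add: uv)
    finally show ?thesis by (simp add: distrib_right)
  qed
  moreover have "\<forall>\<xi>. \<xi> \<notin> vecs ell2 \<longrightarrow> (f - g) \<xi> = 0" using f g by (simp add: bounded_ops_def)
  ultimately show ?thesis using lin unfolding bounded_ops_def by blast
qed

lemma Rep_bounded_op:
  assumes "f \<in> bounded_ops ell2 ell2"
  shows "Rep_l2 (Abs_l2 (f (Rep_l2 v))) = f (Rep_l2 v)"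
proof -
  have "f (Rep_l2 v) \<in> range Rep_l2" using assms by (auto simp: bounded_ops_def vecs_ell2)
  then show ?thesis by (auto simp: Rep_l2_inverse)
qed

text \<open>The norm at matrix level one lives on \<open>hsum 1 ell2\<close>. Identifying that space
  with \<open>ell2\<close> turns approximation in \<open>enorm\<close> into pointwise
  estimates.\<close>

lemma nrm_le_enorm:
  assumes f: "f \<in> bounded_ops ell2 ell2" and e: "enorm (op_algebra ell2 ell2) f \<le> e" "0 \<le> e"
  shows "norm (Abs_l2 (f (Rep_l2 v))) \<le> e * norm v"
proof -
  note Rep = Rep_bounded_op[OF f]
  have lin: "clinear_on (vecs ell2) f" using f by (simp add: bounded_ops_def)
  obtain b where b: "\<forall>\<xi>\<in>vecs ell2. nrm ell2 (f \<xi>) \<le> b * nrm ell2 \<xi>"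
    using f unfolding bounded_ops_def by blast
  have nrm_f: "nrm (hsum 1 ell2) (matrix_op 1 (\<lambda>i j. f) \<xi>) = nrm ell2 (f (\<xi> 0))" if \<xi>: "\<xi> 0 \<in> vecs ell2" for \<xi>
  proof -
    obtain u where u: "\<xi> 0 = Rep_l2 u" using \<xi> by (auto simp: vecs_ell2)
    have "nrm ell2 (f (\<xi> 0)) = norm (Abs_l2 (f (\<xi> 0)))" unfolding u by (metis Rep nrm_ell2)
    then show ?thesis by (simp add: nrm_hsum matrix_op_def L2_set_def)
  qed
  have "op_norm (hsum 1 ell2) (hsum 1 ell2) (matrix_op 1 (\<lambda>i j. f)) \<le> e \<longleftrightarrow>
    (\<forall>\<xi>\<in>vecs (hsum 1 ell2). nrm (hsum 1 ell2) (matrix_op 1 (\<lambda>i j. f) \<xi>) \<le> e * nrm (hsum 1 ell2) \<xi>)"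
  proof (rule op_norm_le_iff[OF positively_homogeneous_hsum[OF positively_homogeneous_ell2] _ _ e(2)])
    fix \<xi> assume "\<xi> \<in> vecs (hsum 1 ell2)"
    then have \<xi>: "\<xi> 0 \<in> vecs ell2" by (simp add: vecs_hsum)
    then obtain u where u: "\<xi> 0 = Rep_l2 u" by (auto simp: vecs_ell2)
    show "nrm (hsum 1 ell2) (matrix_op 1 (\<lambda>i j. f) \<xi>) \<le> b * nrm (hsum 1 ell2) \<xi>"
      unfolding nrm_f[of \<xi>, OF \<xi>] using bspec[OF b \<xi>] by (simp add: nrm_hsum L2_set_def u)
    fix r :: real assume r: "0 \<le> r"
    let ?\<xi> = "complex_of_real r *\<^sub>C \<xi>"
    have r\<xi>: "?\<xi> 0 = Rep_l2 (complex_of_real r *\<^sub>C u)" by (simp add: scaleC_fun_def[of _ \<xi>] u Rep_l2_scaleC)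
    then have r\<xi>': "?\<xi> 0 \<in> vecs ell2" by (simp add: vecs_ell2)
    have "f (?\<xi> 0) = complex_of_real r *\<^sub>C f (\<xi> 0)"
      using clinear_onD(2)[OF lin \<xi>] by (simp add: scaleC_fun_def[of _ \<xi>])
    also have "\<dots> = Rep_l2 (complex_of_real r *\<^sub>C Abs_l2 (f (\<xi> 0)))"
      by (simp add: Rep_l2_scaleC u Rep)
    finally have "nrm ell2 (f (?\<xi> 0)) = r * norm (Abs_l2 (f (\<xi> 0)))" using r by simp
    also have "norm (Abs_l2 (f (\<xi> 0))) = nrm ell2 (f (\<xi> 0))" by (metis Rep u nrm_ell2)
    finally show "nrm (hsum 1 ell2) (matrix_op 1 (\<lambda>i j. f) ?\<xi>) = r * nrm (hsum 1 ell2) (matrix_op 1 (\<lambda>i j. f) \<xi>)"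
      unfolding nrm_f[of \<xi>, OF \<xi>] nrm_f[of ?\<xi>, OF r\<xi>'] .
  qed
  then have all: "\<forall>\<xi>\<in>vecs (hsum 1 ell2). nrm (hsum 1 ell2) (matrix_op 1 (\<lambda>i j. f) \<xi>) \<le> e * nrm (hsum 1 ell2) \<xi>"
    using e(1) by (simp add: enorm_def op_algebra_def)
  let ?\<xi> = "\<lambda>i::nat. if i = 0 then Rep_l2 v else 0"
  have "?\<xi> \<in> vecs (hsum 1 ell2)" by (auto simp: vecs_hsum vecs_ell2)
  from bspec[OF all this]
  have "nrm ell2 (f (?\<xi> 0)) \<le> e * nrm (hsum 1 ell2) ?\<xi>" by (subst (asm) nrm_f) (simp_all add: vecs_ell2)
  then have "nrm ell2 (f (Rep_l2 v)) \<le> e * norm v" by (simp add: nrm_hsum L2_set_def)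
  then show ?thesis by (metis Rep nrm_ell2)
qed

lemma enorm_row_op: "0 \<le> c \<Longrightarrow> enorm (op_algebra ell2 ell2) (row_op x) \<le> c \<longleftrightarrow> norm x \<le> c"
  using mnorm_row_op[of 1 "\<lambda>i j. row_op x" "\<lambda>i j. x" c]
  by (simp only: col_bound_1) (simp add: enorm_def row_space_def sub_opspace_def)

lemma enorm_col_op: "0 \<le> c \<Longrightarrow> enorm (op_algebra ell2 ell2) (col_op x) \<le> c \<longleftrightarrow> norm x \<le> c"
  using mnorm_col_op[of 1 "\<lambda>i j. col_op x" "\<lambda>i j. x" c]
  by (simp only: col_bound_1) (simp add: enorm_def col_space_def sub_opspace_def)

lemma basis_dense: "0 < e \<Longrightarrow> \<exists>N. norm (x - (\<Sum>k<N. Rep_l2 x k *\<^sub>C basis k)) < e"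
  using LIMSEQ_D[OF basis_expansion[of x], of e] by (metis norm_minus_commute order_refl)

text \<open>In the next two lemmas \<open>T\<close> stands for \<open>row_op\<close> or \<open>col_op\<close>.\<close>

lemma range_subset_norm_closure:
  fixes T :: "l2 \<Rightarrow> (nat \<Rightarrow> complex) \<Rightarrow> (nat \<Rightarrow> complex)"
  assumes add: "\<And>x y. T (x + y) = T x + T y" and scale: "\<And>c x. T (c *\<^sub>C x) = c *\<^sub>C T x"
    and T: "\<And>x. T x \<in> bounded_ops ell2 ell2"
    and norm: "\<And>x. enorm (op_algebra ell2 ell2) (T x) \<le> norm x"
  shows "range T \<subseteq> norm_closure (op_algebra ell2 ell2) (complex_vector.span (range (\<lambda>k. T (basis k))))"
proof
  fix f assume "f \<in> range T"
  then obtain x where f: "f = T x" by blast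
  have diff: "T (x - y) = T x - T y" for x y using add[of "x - y" y] by simp
  have "T 0 = 0" using scale[of 0 0] by simp
  then have Tsum: "T (\<Sum>k<N. c k *\<^sub>C basis k) = (\<Sum>k<N. c k *\<^sub>C T (basis k))" for N c
    by (induction N) (simp_all add: add scale)
  have "\<exists>a\<in>complex_vector.span (range (\<lambda>k. T (basis k))). enorm (op_algebra ell2 ell2) (f - a) < e"
    if "0 < e" for e
  proof -
    obtain N where N: "norm (x - (\<Sum>k<N. Rep_l2 x k *\<^sub>C basis k)) < e" using basis_dense[OF \<open>0 < e\<close>] by blast
    let ?y = "\<Sum>k<N. Rep_l2 x k *\<^sub>C basis k"
    have "T ?y \<in> complex_vector.span (range (\<lambda>k. T (basis k)))"
      unfolding Tsum
      by (intro complex_vector.span_sum complex_vector.span_scale complex_vector.span_base) blast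
    moreover have "enorm (op_algebra ell2 ell2) (f - T ?y) < e"
      using norm[of "x - ?y"] N by (simp add: f diff)
    ultimately show ?thesis by blast
  qed
  then show "f \<in> norm_closure (op_algebra ell2 ell2) (complex_vector.span (range (\<lambda>k. T (basis k))))"
    by (simp add: norm_closure_def f op_algebra_def T)
qed

lemma norm_closure_approx:
  fixes T :: "l2 \<Rightarrow> (nat \<Rightarrow> complex) \<Rightarrow> (nat \<Rightarrow> complex)"
  assumes add: "\<And>x y. T (x + y) = T x + T y" and scale: "\<And>c x. T (c *\<^sub>C x) = c *\<^sub>C T x"
    and T: "\<And>x. T x \<in> bounded_ops ell2 ell2"
    and f: "f \<in> norm_closure (op_algebra ell2 ell2) (complex_vector.span (range (\<lambda>k. T (basis k))))"
    and e: "0 < e"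
  shows "\<exists>x. \<forall>v. norm (Abs_l2 (f (Rep_l2 v)) - Abs_l2 (T x (Rep_l2 v))) \<le> e * norm v"
proof -
  have "T 0 = 0" using scale[of 0 0] by simp
  then have "complex_vector.subspace (range T)"
    by (intro complex_vector.subspaceI) (auto simp: add[symmetric] scale[symmetric] intro: image_eqI[of _ T 0])
  then have span: "complex_vector.span (range (\<lambda>k. T (basis k))) \<subseteq> range T"
    by (intro complex_vector.span_minimal) auto
  have fb: "f \<in> bounded_ops ell2 ell2" using f by (simp add: norm_closure_def op_algebra_def)
  obtain x where x: "enorm (op_algebra ell2 ell2) (f - T x) < e"
    using f e span unfolding norm_closure_def by blast
  note Rep = Rep_bounded_op
  have "Abs_l2 ((f - T x) (Rep_l2 v)) = Abs_l2 (f (Rep_l2 v)) - Abs_l2 (T x (Rep_l2 v))" for v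
    unfolding Rep_l2_inject[symmetric] Rep_l2_minus Rep[OF fb] Rep[OF T] Rep[OF bounded_ops_ell2_diff[OF fb T]]
    by simp
  then show ?thesis
    using nrm_le_enorm[OF bounded_ops_ell2_diff[OF fb T] less_imp_le[OF x] less_imp_le[OF e]] by metis
qed

lemma le_mult_all_imp_zero:
  fixes a b :: real
  assumes "\<And>e. 0 < e \<Longrightarrow> a \<le> e * b"
  shows "a \<le> 0"
proof (rule field_le_epsilon)
  fix e :: real assume e: "0 < e"
  have pos: "0 < \<bar>b\<bar> + 1" by linarith
  have "a \<le> e / (\<bar>b\<bar> + 1) * b" using e pos by (intro assms) simp
  also have "\<dots> \<le> e / (\<bar>b\<bar> + 1) * (\<bar>b\<bar> + 1)" using e pos by (intro mult_left_mono) auto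
  finally show "a \<le> 0 + e" using pos by simp
qed

lemma clinear_on_bounded_op:
  assumes f: "f \<in> bounded_ops ell2 ell2"
  shows "clinear_on UNIV (\<lambda>v. Abs_l2 (f (Rep_l2 v)))"
proof -
  have lin: "clinear_on (range Rep_l2) f" using f by (simp add: bounded_ops_def vecs_ell2)
  show ?thesis
    unfolding clinear_on_def
  proof (intro conjI ballI allI)
    fix u v c
    show "Abs_l2 (f (Rep_l2 (u + v))) = Abs_l2 (f (Rep_l2 u)) + Abs_l2 (f (Rep_l2 v))"
      unfolding Rep_l2_inject[symmetric] Rep_l2_plus[of "Abs_l2 _"] Rep_bounded_op[OF f]
      by (simp add: Rep_l2_plus clinear_onD(1)[OF lin])
    show "Abs_l2 (f (Rep_l2 (c *\<^sub>C u))) = c *\<^sub>C Abs_l2 (f (Rep_l2 u))"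
      unfolding Rep_l2_inject[symmetric] Rep_l2_scaleC[of _ "Abs_l2 _"] Rep_bounded_op[OF f]
      by (simp add: Rep_l2_scaleC clinear_onD(2)[OF lin])
  qed
qed

lemma bounded_op_eqI:
  assumes "f \<in> bounded_ops ell2 ell2" "g \<in> bounded_ops ell2 ell2"
    and "\<And>v. Abs_l2 (f (Rep_l2 v)) = Abs_l2 (g (Rep_l2 v))"
  shows "f = g"
proof
  fix \<xi>
  show "f \<xi> = g \<xi>"
  proof (cases "\<xi> \<in> vecs ell2")
    case True
    then obtain v where "\<xi> = Rep_l2 v" by (auto simp: vecs_ell2)
    then show ?thesis using assms(3)[of v] Rep_bounded_op[OF assms(1)] Rep_bounded_op[OF assms(2)] by metis
  next
    case False
    then show ?thesis using assms(1,2) by (simp add: bounded_ops_def)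
  qed
qed

text \<open>Coordinates of the output other than 0 vanish for all approximants, hence for their
  limit. The coordinate 0 is a bounded functional, and its Riesz vector, conjugated, is the
  coordinate vector sought.\<close>

lemma elems_row_space: "elems row_space = range row_op"
proof
  let ?C = "norm_closure (op_algebra ell2 ell2) (complex_vector.span (range (\<lambda>k. row_op (basis k))))"
  have E: "elems row_space = ?C" by (simp add: row_space_def sub_opspace_def matrix_unit_row)
  show "range row_op \<subseteq> elems row_space"
    unfolding E
    by (rule range_subset_norm_closure)
      (simp_all add: row_op_add row_op_scaleC row_op_in_bounded_ops enorm_row_op)
  show "elems row_space \<subseteq> range row_op"
  proof
    fix f assume "f \<in> elems row_space"
    then have f: "f \<in> ?C" by (simp add: E)
    then have fb: "f \<in> bounded_ops ell2 ell2" by (simp add: norm_closure_def op_algebra_def)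
    define F where "F v = Abs_l2 (f (Rep_l2 v))" for v
    have Flin: "clinear_on UNIV F" unfolding F_def by (rule clinear_on_bounded_op[OF fb])
    have app: "\<exists>x. \<forall>v. norm (F v - cinner x (conj_l2 v) *\<^sub>C basis 0) \<le> e * norm v" if "0 < e" for e
      using norm_closure_approx[OF row_op_add row_op_scaleC row_op_in_bounded_ops f that]
      by (simp add: F_def row_op_Rep Rep_l2_inverse)
    have off: "Rep_l2 (F v) k = 0" if "k \<noteq> 0" for v k
    proof -
      have "cmod (Rep_l2 (F v) k) \<le> e * norm v" if "0 < e" for e
      proof -
        obtain x where x: "norm (F v - cinner x (conj_l2 v) *\<^sub>C basis 0) \<le> e * norm v"
          using app[OF \<open>0 < e\<close>] by blast
        then show ?thesis
          using Rep_l2_le_norm[of "F v - cinner x (conj_l2 v) *\<^sub>C basis 0" k] \<open>k \<noteq> 0\<close>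
          by (simp add: minus_l2.rep_eq scaleC_l2.rep_eq basis.rep_eq)
      qed
      then have "cmod (Rep_l2 (F v) k) \<le> 0" by (rule le_mult_all_imp_zero)
      then show ?thesis by simp
    qed
    obtain b where b: "\<forall>\<xi>\<in>vecs ell2. nrm ell2 (f \<xi>) \<le> b * nrm ell2 \<xi>"
      using fb unfolding bounded_ops_def by blast
    have "cmod (Rep_l2 (F v) 0) \<le> b * norm v" for v
    proof -
      have "norm (F v) = nrm ell2 (f (Rep_l2 v))"
        unfolding F_def by (metis Rep_bounded_op[OF fb] nrm_ell2)
      also have "\<dots> \<le> b * norm v" using bspec[OF b, of "Rep_l2 v"] by (simp add: vecs_ell2)
      finally show ?thesis using Rep_l2_le_norm[of "F v" 0] by linarith
    qed
    moreover have "clinear_on UNIV (\<lambda>v. Rep_l2 (F v) 0)"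
      using clinear_onD[OF Flin]
      by (simp add: clinear_on_def plus_l2.rep_eq scaleC_l2.rep_eq scaleC_complex_def)
    ultimately obtain y where y: "\<And>v. Rep_l2 (F v) 0 = cinner v y"
      using riesz_complex[of UNIV "\<lambda>v. Rep_l2 (F v) 0" b] by auto
    have "cinner v y = cinner (conj_l2 y) (conj_l2 v)" for v
      by (simp add: cinner_def conj_l2.rep_eq mult.commute)
    then have "F v = cinner (conj_l2 y) (conj_l2 v) *\<^sub>C basis 0" for v
      using y off
      by (intro Rep_l2_inject[THEN iffD1] ext) (auto simp: scaleC_l2.rep_eq basis.rep_eq)
    then have "f = row_op (conj_l2 y)"
      by (intro bounded_op_eqI fb row_op_in_bounded_ops) (simp add: F_def row_op_Rep Rep_l2_inverse)
    then show "f \<in> range row_op" by blast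
  qed
qed

text \<open>The approximants depend only on the coordinate 0 of the input, so a limit is determined
  by its value at \<open>basis 0\<close>.\<close>

lemma elems_col_space: "elems col_space = range col_op"
proof
  let ?C = "norm_closure (op_algebra ell2 ell2) (complex_vector.span (range (\<lambda>k. col_op (basis k))))"
  have E: "elems col_space = ?C" by (simp add: col_space_def sub_opspace_def matrix_unit_col)
  show "range col_op \<subseteq> elems col_space"
    unfolding E
    by (rule range_subset_norm_closure)
      (simp_all add: col_op_add col_op_scaleC col_op_in_bounded_ops enorm_col_op)
  show "elems col_space \<subseteq> range col_op"
  proof
    fix f assume "f \<in> elems col_space"
    then have f: "f \<in> ?C" by (simp add: E)
    then have fb: "f \<in> bounded_ops ell2 ell2" by (simp add: norm_closure_def op_algebra_def)
    define F where "F v = Abs_l2 (f (Rep_l2 v))" for v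
    define y where "y = F (basis 0)"
    \<comment> \<open>The approximant enters twice, at \<open>v\<close> and at
      \<open>basis 0\<close>, and each time the error is at most \<open>e * norm v\<close>.\<close>
    have "norm (F v - Rep_l2 v 0 *\<^sub>C y) \<le> e * (2 * norm v)" if e: "0 < e" for v e
    proof -
      obtain x where x: "\<And>v. norm (F v - Rep_l2 v 0 *\<^sub>C x) \<le> e * norm v"
        using norm_closure_approx[OF col_op_add col_op_scaleC col_op_in_bounded_ops f e]
        by (auto simp: F_def col_op_Rep Rep_l2_inverse)
      have "norm (y - x) \<le> e" using x[of "basis 0"] by (simp add: y_def basis.rep_eq)
      then have "cmod (Rep_l2 v 0) * norm (y - x) \<le> norm v * e"
        by (intro mult_mono Rep_l2_le_norm) auto
      moreover have eq: "F v - Rep_l2 v 0 *\<^sub>C y = (F v - Rep_l2 v 0 *\<^sub>C x) - Rep_l2 v 0 *\<^sub>C (y - x)"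
        by (simp add: complex_vector.scale_right_diff_distrib)
      ultimately show ?thesis
        using x[of v] norm_triangle_ineq4[of "F v - Rep_l2 v 0 *\<^sub>C x" "Rep_l2 v 0 *\<^sub>C (y - x)"]
        unfolding eq norm_scaleC_l2 by argo
    qed
    then have "norm (F v - Rep_l2 v 0 *\<^sub>C y) \<le> 0" for v by (rule le_mult_all_imp_zero)
    then have "f = col_op y"
      by (intro bounded_op_eqI fb col_op_in_bounded_ops) (simp add: F_def col_op_Rep Rep_l2_inverse)
    then show "f \<in> range col_op" by blast
  qed
qed

section \<open>Hilbertian row and column spaces in coordinates\<close>

text \<open>\<open>B(H*, C)\<close> is the bidual of \<open>H\<close>; a vector enters it as
  evaluation.\<close>

definition hrow_op :: "l2 set \<Rightarrow> l2 \<Rightarrow> ((nat \<Rightarrow> complex) \<Rightarrow> complex) \<Rightarrow> complex" where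
  "hrow_op D h \<phi> = (if \<phi> \<in> vecs (dual (hilbert_subspace D)) then \<phi> (Rep_l2 h) else 0)"

definition hcol_op :: "l2 \<Rightarrow> complex \<Rightarrow> (nat \<Rightarrow> complex)" where
  "hcol_op y t = Rep_l2 (t *\<^sub>C y)"

text \<open>The Riesz functional of \<open>y\<close>. It is conjugate linear in \<open>y\<close>,
  which is why conjugates appear in the description of the bidual.\<close>

definition dual_vec :: "l2 set \<Rightarrow> l2 \<Rightarrow> (nat \<Rightarrow> complex) \<Rightarrow> complex" where
  "dual_vec D y s = (if s \<in> Rep_l2 ` D then cinner (Abs_l2 s) y else 0)"

lemma vecs_dual: "vecs (dual X) = bounded_ops X scalars"
  and nrm_dual: "nrm (dual X) \<phi> = op_norm X scalars \<phi>"
  by (simp_all add: dual_def)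

lemma vecs_scalars [simp]: "vecs scalars = UNIV" and nrm_scalars [simp]: "nrm scalars z = cmod z"
  by (simp_all add: scalars_def)

lemma hcol_op_add: "hcol_op (x + y) = hcol_op x + hcol_op y"
  by (simp add: fun_eq_iff hcol_op_def scaleC_add_right plus_l2.rep_eq)

lemma hcol_op_scaleC: "hcol_op (c *\<^sub>C x) = c *\<^sub>C hcol_op x"
  by (simp add: fun_eq_iff hcol_op_def scaleC_l2.rep_eq scaleC_fun_def scaleC_complex_def)

lemma mnorm_hcol_op:
  assumes a: "\<And>i j. i < n \<Longrightarrow> j < n \<Longrightarrow> a i j = hcol_op (x i j)" and c: "0 \<le> c"
  shows "mnorm (hilbert_col (hilbert_subspace D)) n a \<le> c \<longleftrightarrow> col_bound n x c"
  unfolding hilbert_col_def op_algebra_def opspace.simps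
proof (rule col_norm_iff[where \<tau> = "\<lambda>t. t"])
  show "positively_homogeneous scalars"
    by (simp add: positively_homogeneous_def scaleC_complex_def norm_mult)
  fix \<xi> assume \<xi>: "\<xi> \<in> vecs (hsum n scalars)"
  show "nrm (hsum n (hilbert_subspace D)) (matrix_op n a \<xi>) = L2_set (\<lambda>i. norm (\<Sum>j<n. \<xi> j *\<^sub>C x i j)) {..<n}"
    unfolding nrm_hsum
  proof (rule L2_set_cong[OF refl])
    fix i assume i: "i \<in> {..<n}"
    have "matrix_op n a \<xi> i = Rep_l2 (\<Sum>j<n. \<xi> j *\<^sub>C x i j)"
      unfolding Rep_l2_sum_fun using i a by (auto simp: matrix_op_def hcol_op_def intro!: sum.cong)
    then show "nrm (hilbert_subspace D) (matrix_op n a \<xi> i) = norm (\<Sum>j<n. \<xi> j *\<^sub>C x i j)" by simp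
  qed
qed (auto simp: c scaleC_complex_def)

lemma inj_hcol_op: "inj hcol_op"
proof (rule injI)
  fix x y assume "hcol_op x = hcol_op y"
  from fun_cong[OF this, of 1] show "x = y" by (simp add: hcol_op_def Rep_l2_inject scaleC_one)
qed

section \<open>The dual of a Hilbert space and the operator spaces built on it\<close>

context
  fixes D :: "l2 set"
  assumes D: "complex_vector.subspace D" "closed D"
begin

lemma dual_elem:
  assumes "\<phi> \<in> vecs (dual (hilbert_subspace D))"
  shows "clinear_on D (\<lambda>v. \<phi> (Rep_l2 v))" "s \<notin> Rep_l2 ` D \<Longrightarrow> \<phi> s = 0"
    "0 \<le> nrm (dual (hilbert_subspace D)) \<phi>"
    "v \<in> D \<Longrightarrow> cmod (\<phi> (Rep_l2 v)) \<le> nrm (dual (hilbert_subspace D)) \<phi> * norm v"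
    "0 \<le> c \<Longrightarrow> (\<And>v. v \<in> D \<Longrightarrow> cmod (\<phi> (Rep_l2 v)) \<le> c * norm v) \<Longrightarrow> nrm (dual (hilbert_subspace D)) \<phi> \<le> c"
proof -
  have lin: "clinear_on (Rep_l2 ` D) \<phi>"
    using assms by (simp add: vecs_dual bounded_ops_def)
  then show "clinear_on D (\<lambda>v. \<phi> (Rep_l2 v))"
    by (simp add: clinear_on_def Rep_l2_plus Rep_l2_scaleC)
  show "s \<notin> Rep_l2 ` D \<Longrightarrow> \<phi> s = 0" using assms by (simp add: vecs_dual bounded_ops_def)
  obtain b where b: "\<forall>s\<in>Rep_l2 ` D. cmod (\<phi> s) \<le> b * nrm ell2 s"
    using assms by (auto simp: vecs_dual bounded_ops_def)
  have hom: "nrm scalars (\<phi> (complex_of_real r *\<^sub>C s)) = r * nrm scalars (\<phi> s)"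
    if "s \<in> vecs (hilbert_subspace D)" "0 \<le> r" for s r
    using clinear_onD(2)[OF lin, of s "complex_of_real r"] that by (simp add: scaleC_complex_def norm_mult)
  have bound: "nrm scalars (\<phi> s) \<le> b * nrm (hilbert_subspace D) s" if "s \<in> vecs (hilbert_subspace D)" for s
    using b that by auto
  note ph = positively_homogeneous_hilbert_subspace[OF D(1)]
  show "0 \<le> nrm (dual (hilbert_subspace D)) \<phi>"
    unfolding nrm_dual by (rule op_norm_nonneg[OF ph hom bound])
  show "cmod (\<phi> (Rep_l2 v)) \<le> nrm (dual (hilbert_subspace D)) \<phi> * norm v" if "v \<in> D"
    using le_op_norm[OF ph hom bound, of "Rep_l2 v"] that by (simp add: nrm_dual)
  show "nrm (dual (hilbert_subspace D)) \<phi> \<le> c"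
    if "0 \<le> c" "\<And>v. v \<in> D \<Longrightarrow> cmod (\<phi> (Rep_l2 v)) \<le> c * norm v"
    using op_norm_le_iff[OF ph hom bound that(1)] that(2) by (simp add: nrm_dual)
qed

lemma dualI:
  assumes lin: "clinear_on D (\<lambda>v. \<phi> (Rep_l2 v))" and off: "\<And>s. s \<notin> Rep_l2 ` D \<Longrightarrow> \<phi> s = 0"
    and b: "\<And>v. v \<in> D \<Longrightarrow> cmod (\<phi> (Rep_l2 v)) \<le> b * norm v"
  shows "\<phi> \<in> vecs (dual (hilbert_subspace D))"
proof -
  have "clinear_on (Rep_l2 ` D) \<phi>"
    using lin by (auto simp: clinear_on_def Rep_l2_plus Rep_l2_scaleC)
  then show ?thesis using off b by (auto simp: vecs_dual bounded_ops_def)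
qed

lemma dual_scaleC:
  assumes \<phi>: "\<phi> \<in> vecs (dual (hilbert_subspace D))"
  shows "c *\<^sub>C \<phi> \<in> vecs (dual (hilbert_subspace D))"
    "nrm (dual (hilbert_subspace D)) (c *\<^sub>C \<phi>) \<le> cmod c * nrm (dual (hilbert_subspace D)) \<phi>"
proof -
  have bound: "cmod ((c *\<^sub>C \<phi>) (Rep_l2 v)) \<le> cmod c * nrm (dual (hilbert_subspace D)) \<phi> * norm v"
    if "v \<in> D" for v
    using mult_left_mono[OF dual_elem(4)[OF \<phi> that] norm_ge_zero[of c]]
    by (simp add: scaleC_fun_def scaleC_complex_def norm_mult mult.assoc)
  show in_dual: "c *\<^sub>C \<phi> \<in> vecs (dual (hilbert_subspace D))"
  proof (rule dualI[OF _ _ bound])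
    show "clinear_on D (\<lambda>v. (c *\<^sub>C \<phi>) (Rep_l2 v))"
      using dual_elem(1)[OF \<phi>]
      by (simp add: clinear_on_def scaleC_fun_def scaleC_complex_def algebra_simps)
    show "(c *\<^sub>C \<phi>) s = 0" if "s \<notin> Rep_l2 ` D" for s
      using dual_elem(2)[OF \<phi> that] by (simp add: scaleC_fun_def)
  qed
  show "nrm (dual (hilbert_subspace D)) (c *\<^sub>C \<phi>) \<le> cmod c * nrm (dual (hilbert_subspace D)) \<phi>"
    by (rule dual_elem(5)[OF in_dual _ bound]) (simp_all add: dual_elem(3)[OF \<phi>])
qed

lemma zero_in_dual: "0 \<in> vecs (dual (hilbert_subspace D))"
  by (rule dualI[where b = 0]) (simp_all add: clinear_on_def)

lemma positively_homogeneous_dual: "positively_homogeneous (dual (hilbert_subspace D))"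
  unfolding positively_homogeneous_def
proof (intro conjI ballI allI impI)
  let ?N = "nrm (dual (hilbert_subspace D))"
  fix \<phi> and r :: real assume \<phi>: "\<phi> \<in> vecs (dual (hilbert_subspace D))" and r: "0 \<le> r"
  show "complex_of_real r *\<^sub>C \<phi> \<in> vecs (dual (hilbert_subspace D))" by (rule dual_scaleC[OF \<phi>])
  have le: "?N (complex_of_real r *\<^sub>C \<phi>) \<le> r * ?N \<phi>"
    using dual_scaleC(2)[OF \<phi>, of "complex_of_real r"] r by simp
  \<comment> \<open>The upper estimate for scalar multiples, applied to the inverse scalar, gives
    the lower one.\<close>
  have "r * ?N \<phi> \<le> ?N (complex_of_real r *\<^sub>C \<phi>)"
  proof (cases "r = 0")
    case True
    then show ?thesis using dual_elem(3)[OF zero_in_dual] by simp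
  next
    case False
    have "\<phi> = complex_of_real (1 / r) *\<^sub>C complex_of_real r *\<^sub>C \<phi>"
      using False by (simp add: scaleC_scaleC scaleC_one)
    then have "?N \<phi> \<le> 1 / r * ?N (complex_of_real r *\<^sub>C \<phi>)"
      using dual_scaleC(2)[OF dual_scaleC(1)[OF \<phi>], of "complex_of_real (1 / r)" "complex_of_real r"] r
      by (simp add: norm_divide)
    then show ?thesis using r False by (simp add: field_simps)
  qed
  with le show "?N (complex_of_real r *\<^sub>C \<phi>) = r * ?N \<phi>" by simp
qed (simp_all add: zero_in_dual dual_elem(3))

lemma dual_vec_Rep: "v \<in> D \<Longrightarrow> dual_vec D y (Rep_l2 v) = cinner v y"
  by (simp add: dual_vec_def Rep_l2_inverse)

lemma dual_vec_in_dual: "dual_vec D y \<in> vecs (dual (hilbert_subspace D))"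
  and nrm_dual_vec: "nrm (dual (hilbert_subspace D)) (dual_vec D y) \<le> norm y"
proof -
  have bound: "cmod (dual_vec D y (Rep_l2 v)) \<le> norm y * norm v" if "v \<in> D" for v
    using cmod_cinner_le[of v y] that by (simp add: dual_vec_Rep mult.commute)
  show in_dual: "dual_vec D y \<in> vecs (dual (hilbert_subspace D))"
  proof (rule dualI[OF _ _ bound])
    show "clinear_on D (\<lambda>v. dual_vec D y (Rep_l2 v))"
      using D(1) by (simp add: clinear_on_def dual_vec_Rep complex_vector.subspace_add
          complex_vector.subspace_scale cinner_add_left cinner_scaleC_left scaleC_complex_def)
  qed (simp add: dual_vec_def)
  show "nrm (dual (hilbert_subspace D)) (dual_vec D y) \<le> norm y"
    by (rule dual_elem(5)[OF in_dual _ bound]) simp_all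
qed

lemma dual_is_dual_vec:
  assumes \<phi>: "\<phi> \<in> vecs (dual (hilbert_subspace D))"
  obtains y where "y \<in> D" "\<phi> = dual_vec D y"
proof -
  obtain y where y: "y \<in> D" "\<forall>v\<in>D. \<phi> (Rep_l2 v) = cinner v y"
    using riesz_complex[OF D dual_elem(1)[OF \<phi>] dual_elem(4)[OF \<phi>]] by blast
  have "\<phi> = dual_vec D y"
  proof
    fix s
    show "\<phi> s = dual_vec D y s"
    proof (cases "s \<in> Rep_l2 ` D")
      case True
      then show ?thesis using y(2) by (auto simp: dual_vec_Rep)
    next
      case False
      then show ?thesis using dual_elem(2)[OF \<phi>] by (simp add: dual_vec_def)
    qed
  qed
  with y(1) show ?thesis by (rule that)
qed

text \<open>The Riesz functional of \<open>v\<close> itself norms \<open>v\<close>, so the general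
  description of row norms applies.\<close>

lemma mnorm_hrow_op:
  assumes x: "\<And>i j. i < n \<Longrightarrow> j < n \<Longrightarrow> x i j \<in> D"
    and a: "\<And>i j. i < n \<Longrightarrow> j < n \<Longrightarrow> a i j = hrow_op D (x i j)" and c: "0 \<le> c"
  shows "mnorm (hilbert_row (hilbert_subspace D)) n a \<le> c \<longleftrightarrow> col_bound n (\<lambda>i j. x j i) c"
  unfolding hilbert_row_def op_algebra_def opspace.simps
proof (rule row_norm_iff[where D = D and \<beta> = "\<lambda>\<phi> v. \<phi> (Rep_l2 v)"])
  fix v assume v: "v \<in> D"
  show "\<exists>\<xi>\<in>vecs (dual (hilbert_subspace D)). nrm (dual (hilbert_subspace D)) \<xi> \<le> norm v \<and>
      \<xi> (Rep_l2 v) = complex_of_real ((norm v)\<^sup>2)"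
    by (rule bexI[OF _ dual_vec_in_dual[of v]]) (simp add: nrm_dual_vec dual_vec_Rep v cinner_self)
next
  fix \<xi> assume \<xi>: "\<xi> \<in> vecs (hsum n (dual (hilbert_subspace D)))"
  show "nrm (hsum n scalars) (matrix_op n a \<xi>) = L2_set (\<lambda>i. cmod (\<Sum>j<n. \<xi> j (Rep_l2 (x i j)))) {..<n}"
    unfolding nrm_hsum
    using \<xi> a by (intro L2_set_cong) (auto simp: matrix_op_def vecs_hsum hrow_op_def intro!: arg_cong[of _ _ cmod] sum.cong)
qed (simp_all add: positively_homogeneous_dual D x dual_elem scaleC_fun_def scaleC_complex_def c)

lemma hrow_op_add:
  assumes "x \<in> D" "y \<in> D"
  shows "hrow_op D (x + y) = hrow_op D x + hrow_op D y"
  using assms by (auto simp: fun_eq_iff hrow_op_def clinear_onD[OF dual_elem(1)])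

lemma hrow_op_scaleC:
  assumes "x \<in> D"
  shows "hrow_op D (c *\<^sub>C x) = c *\<^sub>C hrow_op D x"
  using assms by (auto simp: fun_eq_iff hrow_op_def clinear_onD[OF dual_elem(1)] scaleC_fun_def)

lemma elems_hilbert_row: "elems (hilbert_row (hilbert_subspace D)) = hrow_op D ` D"
proof
  let ?X = "dual (hilbert_subspace D)"
  have E: "elems (hilbert_row (hilbert_subspace D)) = bounded_ops ?X scalars"
    by (simp add: hilbert_row_def op_algebra_def)
  show "hrow_op D ` D \<subseteq> elems (hilbert_row (hilbert_subspace D))"
  proof (clarify, unfold E)
    fix h assume h: "h \<in> D"
    have "clinear_on (vecs ?X) (hrow_op D h)"
      unfolding clinear_on_def
    proof (intro conjI ballI allI)
      fix \<phi> \<psi> assume \<phi>: "\<phi> \<in> vecs ?X" and \<psi>: "\<psi> \<in> vecs ?X"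
      have "\<phi> + \<psi> \<in> vecs ?X"
      proof (rule dualI)
        show "clinear_on D (\<lambda>v. (\<phi> + \<psi>) (Rep_l2 v))"
          using dual_elem(1)[OF \<phi>] dual_elem(1)[OF \<psi>]
          by (simp add: clinear_on_def scaleC_complex_def algebra_simps)
        show "cmod ((\<phi> + \<psi>) (Rep_l2 v)) \<le> (nrm ?X \<phi> + nrm ?X \<psi>) * norm v" if "v \<in> D" for v
          using norm_triangle_ineq[of "\<phi> (Rep_l2 v)" "\<psi> (Rep_l2 v)"] dual_elem(4)[OF \<phi> that]
            dual_elem(4)[OF \<psi> that]
          by (simp add: distrib_right)
      qed (simp add: dual_elem(2)[OF \<phi>] dual_elem(2)[OF \<psi>])
      then show "hrow_op D h (\<phi> + \<psi>) = hrow_op D h \<phi> + hrow_op D h \<psi>"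
        using \<phi> \<psi> by (simp add: hrow_op_def)
      show "hrow_op D h (c *\<^sub>C \<phi>) = c *\<^sub>C hrow_op D h \<phi>" for c
        using \<phi> dual_scaleC(1)[OF \<phi>] by (simp add: hrow_op_def scaleC_fun_def)
    qed
    moreover have "cmod (hrow_op D h \<phi>) \<le> norm h * nrm ?X \<phi>" if "\<phi> \<in> vecs ?X" for \<phi>
      using dual_elem(4)[OF that h] that by (simp add: hrow_op_def mult.commute)
    ultimately show "hrow_op D h \<in> bounded_ops ?X scalars"
      by (auto simp: bounded_ops_def) (simp add: hrow_op_def)
  qed
  show "elems (hilbert_row (hilbert_subspace D)) \<subseteq> hrow_op D ` D"
  proof
    fix F assume "F \<in> elems (hilbert_row (hilbert_subspace D))"
    then have F: "F \<in> bounded_ops ?X scalars" by (simp add: E)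
    then have Flin: "clinear_on (vecs ?X) F" and Foff: "\<And>\<phi>. \<phi> \<notin> vecs ?X \<Longrightarrow> F \<phi> = 0"
      by (auto simp: bounded_ops_def)
    obtain b where b: "\<And>\<phi>. \<phi> \<in> vecs ?X \<Longrightarrow> cmod (F \<phi>) \<le> b * nrm ?X \<phi>"
      using F by (auto simp: bounded_ops_def)
    \<comment> \<open>Reflexivity by a second use of Riesz: the conjugate undoes the conjugate
      linearity of \<open>dual_vec\<close>, so \<open>g\<close> is linear, and the vector
      representing it is the point of evaluation.\<close>
    define g where "g v = cnj (F (dual_vec D v))" for v
    have vadd: "dual_vec D (u + v) = dual_vec D u + dual_vec D v" for u v
    proof
      fix s
      have "cinner (Abs_l2 s) (u + v) = cinner (Abs_l2 s) u + cinner (Abs_l2 s) v"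
        by (subst (1 2 3) cinner_commute) (simp add: cinner_add_left)
      then show "dual_vec D (u + v) s = (dual_vec D u + dual_vec D v) s" by (simp add: dual_vec_def)
    qed
    have vscale: "dual_vec D (c *\<^sub>C v) = cnj c *\<^sub>C dual_vec D v" for c v
    proof
      fix s
      have "cinner (Abs_l2 s) (c *\<^sub>C v) = cnj c * cinner (Abs_l2 s) v"
        by (subst (1 2) cinner_commute) (simp add: cinner_scaleC_left)
      then show "dual_vec D (c *\<^sub>C v) s = (cnj c *\<^sub>C dual_vec D v) s"
        by (simp add: dual_vec_def scaleC_fun_def scaleC_complex_def)
    qed
    have "clinear_on D g"
      by (simp add: clinear_on_def g_def vadd vscale clinear_onD[OF Flin] dual_vec_in_dual scaleC_complex_def)
    moreover have "cmod (g v) \<le> \<bar>b\<bar> * norm v" for v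
    proof -
      have "cmod (g v) \<le> b * nrm ?X (dual_vec D v)" using b[OF dual_vec_in_dual] by (simp add: g_def)
      also have "\<dots> \<le> \<bar>b\<bar> * norm v"
        using nrm_dual_vec[of v] dual_elem(3)[OF dual_vec_in_dual[of v]] by (intro mult_mono) auto
      finally show ?thesis .
    qed
    ultimately obtain h where h: "h \<in> D" "\<forall>v\<in>D. g v = cinner v h"
      using riesz_complex[OF D, of g "\<bar>b\<bar>"] by blast
    have "F = hrow_op D h"
    proof
      fix \<phi>
      show "F \<phi> = hrow_op D h \<phi>"
      proof (cases "\<phi> \<in> vecs ?X")
        case True
        then obtain y where y: "y \<in> D" "\<phi> = dual_vec D y" by (rule dual_is_dual_vec)
        have "F \<phi> = cnj (g y)" by (simp add: g_def y(2))
        also have "\<dots> = cinner h y" using h(2) y(1) by (simp add: cinner_commute[of h y])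
        also have "\<dots> = hrow_op D h \<phi>"
          using dual_vec_in_dual[of y] h(1) by (simp add: hrow_op_def y(2) dual_vec_Rep)
        finally show ?thesis .
      next
        case False
        then show ?thesis by (simp add: Foff hrow_op_def)
      qed
    qed
    with h(1) show "F \<in> hrow_op D ` D" by blast
  qed
qed

lemma elems_hilbert_col: "elems (hilbert_col (hilbert_subspace D)) = hcol_op ` D"
proof
  have E: "elems (hilbert_col (hilbert_subspace D)) = bounded_ops scalars (hilbert_subspace D)"
    by (simp add: hilbert_col_def op_algebra_def)
  show "hcol_op ` D \<subseteq> elems (hilbert_col (hilbert_subspace D))"
  proof (clarify, unfold E)
    fix y assume y: "y \<in> D"
    have "clinear_on UNIV (hcol_op y)"
      by (simp add: clinear_on_def hcol_op_def scaleC_add_left Rep_l2_plus scaleC_complex_def)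
        (simp add: Rep_l2_scaleC[symmetric] scaleC_scaleC)
    moreover have "hcol_op y t \<in> Rep_l2 ` D" for t
      using complex_vector.subspace_scale[OF D(1) y] by (simp add: hcol_op_def)
    moreover have "nrm ell2 (hcol_op y t) \<le> norm y * cmod t" for t
      by (simp add: hcol_op_def)
    ultimately show "hcol_op y \<in> bounded_ops scalars (hilbert_subspace D)"
      by (auto simp: bounded_ops_def)
  qed
  show "elems (hilbert_col (hilbert_subspace D)) \<subseteq> hcol_op ` D"
  proof
    fix f assume "f \<in> elems (hilbert_col (hilbert_subspace D))"
    then have f: "f \<in> bounded_ops scalars (hilbert_subspace D)" by (simp add: E)
    then obtain y where y: "y \<in> D" "f 1 = Rep_l2 y" by (auto simp: bounded_ops_def)
    have lin: "clinear_on UNIV f" using f by (simp add: bounded_ops_def)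
    have "f = hcol_op y"
    proof
      fix t :: complex
      show "f t = hcol_op y t"
        using clinear_onD(2)[OF lin, of 1 t] by (simp add: scaleC_complex_def hcol_op_def y(2) Rep_l2_scaleC)
    qed
    with y(1) show "f \<in> hcol_op ` D" by blast
  qed
qed

lemma inj_on_hrow_op: "inj_on (hrow_op D) D"
proof (rule inj_onI)
  fix x y assume x: "x \<in> D" and y: "y \<in> D" and eq: "hrow_op D x = hrow_op D y"
  have xy: "x - y \<in> D" using D(1) x y by (rule complex_vector.subspace_diff)
  have "cinner x (x - y) = cinner y (x - y)"
    using fun_cong[OF eq, of "dual_vec D (x - y)"] x y by (simp add: hrow_op_def dual_vec_in_dual dual_vec_Rep)
  then have "cinner (x - y) (x - y) = 0"
    using cinner_add_left[of "x - y" y "x - y"] by simp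
  then show "x = y" by (simp add: cinner_self)
qed

end

section \<open>Completely complemented subspaces\<close>

lemma col_bound_zero: "0 \<le> c \<Longrightarrow> col_bound n (\<lambda>i j. 0) c"
  by (simp add: col_bound_def L2_set_0')

text \<open>The comparison is made on linear combinations along a row, so estimates between norms of
  vectors in a subspace can be used even when no linear map realises them.\<close>

lemma col_bound_triangle:
  assumes y: "col_bound n y c" and z: "col_bound n z d"
    and le: "\<And>t i. i < n \<Longrightarrow> norm (\<Sum>j<n. t j *\<^sub>C x i j) \<le> norm (\<Sum>j<n. t j *\<^sub>C y i j) + norm (\<Sum>j<n. t j *\<^sub>C z i j)"
  shows "col_bound n x (c + d)"
  unfolding col_bound_def
proof
  fix t :: "nat \<Rightarrow> complex"
  let ?T = "L2_set (\<lambda>j. cmod (t j)) {..<n}"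
  have "L2_set (\<lambda>i. norm (\<Sum>j<n. t j *\<^sub>C x i j)) {..<n} \<le>
      L2_set (\<lambda>i. norm (\<Sum>j<n. t j *\<^sub>C y i j) + norm (\<Sum>j<n. t j *\<^sub>C z i j)) {..<n}"
    using le by (intro L2_set_mono) auto
  also have "\<dots> \<le> L2_set (\<lambda>i. norm (\<Sum>j<n. t j *\<^sub>C y i j)) {..<n} + L2_set (\<lambda>i. norm (\<Sum>j<n. t j *\<^sub>C z i j)) {..<n}"
    by (rule L2_set_triangle_ineq)
  also have "\<dots> \<le> c * ?T + d * ?T" by (intro add_mono col_boundD y z)
  finally show "L2_set (\<lambda>i. norm (\<Sum>j<n. t j *\<^sub>C x i j)) {..<n} \<le> (c + d) * ?T" by (simp add: distrib_right)
qed

lemma col_bound_dominated: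
  assumes "col_bound n y c"
    and "\<And>t i. i < n \<Longrightarrow> norm (\<Sum>j<n. t j *\<^sub>C x i j) \<le> norm (\<Sum>j<n. t j *\<^sub>C y i j)"
  shows "col_bound n x c"
  using col_bound_triangle[OF assms(1) col_bound_zero[of 0 n], of x] assms(2) by simp

text \<open>In a column space a single row of orthonormal vectors has norm at most 1, however long
  it is; in a row space the same holds for a single column. On such matrices a map between the two
  spaces reveals its Hilbert--Schmidt norm.\<close>

lemma col_bound_basis: "col_bound n (\<lambda>i j. if i = 0 then basis j else 0) 1"
  unfolding col_bound_def
proof
  fix t :: "nat \<Rightarrow> complex"
  have "L2_set (\<lambda>i. norm (\<Sum>j<n. t j *\<^sub>C (if i = 0 then basis j else 0))) {..<n} =
      L2_set (\<lambda>i. if i = 0 then norm (\<Sum>j<n. t j *\<^sub>C basis j) else 0) {..<n}"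
    by (intro L2_set_cong) auto
  also have "\<dots> = (if n = 0 then 0 else norm (\<Sum>j<n. t j *\<^sub>C basis j))"
    by (simp add: L2_set_def if_distrib[of "\<lambda>r. r\<^sup>2"] cong: if_cong)
  finally show "L2_set (\<lambda>i. norm (\<Sum>j<n. t j *\<^sub>C (if i = 0 then basis j else 0))) {..<n}
      \<le> 1 * L2_set (\<lambda>j. cmod (t j)) {..<n}"
    by (simp add: norm_partial_sum L2_set_nonneg)
qed

lemma sum_squares_le_of_col_bound:
  assumes "col_bound n (\<lambda>i j. if j = 0 then m i else 0) c" and c: "0 \<le> c"
  shows "(\<Sum>i<n. (norm (m i))\<^sup>2) \<le> c\<^sup>2"
proof (cases "n = 0")
  case False
  let ?t = "\<lambda>j::nat. if j = 0 then 1 else 0 :: complex"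
  have s: "(\<Sum>j<n. ?t j *\<^sub>C (if j = 0 then m i else 0)) = m i" for i
  proof -
    have "(\<Sum>j<n. ?t j *\<^sub>C (if j = 0 then m i else 0)) = (\<Sum>j<n. if j = 0 then m i else 0)"
      by (rule sum.cong) (auto simp: scaleC_one)
    then show ?thesis using False by simp
  qed
  have t: "L2_set (\<lambda>j. cmod (?t j)) {..<n} = 1"
    using False by (simp add: L2_set_def if_distrib[of cmod] if_distrib[of "\<lambda>r. r\<^sup>2"] cong: if_cong)
  have "L2_set (\<lambda>i. norm (m i)) {..<n} \<le> c"
    using col_boundD[OF assms(1), of ?t] unfolding s t by simp
  then have "(L2_set (\<lambda>i. norm (m i)) {..<n})\<^sup>2 \<le> c\<^sup>2" by (intro power_mono) (simp_all add: L2_set_nonneg)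
  then show ?thesis by (simp add: L2_set_def sum_nonneg)
qed simp

lemma fst_scaleC [simp]: "fst (c *\<^sub>C p) = c *\<^sub>C fst p" and snd_scaleC [simp]: "snd (c *\<^sub>C p) = c *\<^sub>C snd p"
  by (simp_all add: scaleC_prod_def)

lemma fst_sum_scaleC: "fst (\<Sum>j\<in>A. t j *\<^sub>C x j) = (\<Sum>j\<in>A. t j *\<^sub>C fst (x j))"
  and snd_sum_scaleC: "snd (\<Sum>j\<in>A. t j *\<^sub>C x j) = (\<Sum>j\<in>A. t j *\<^sub>C snd (x j))"
  by (simp_all add: fst_sum snd_sum)

lemma norm_clinear_le:
  fixes M :: "l2 \<Rightarrow> l2"
  assumes M: "clinear_on UNIV M" and unit: "\<And>y. norm y \<le> 1 \<Longrightarrow> norm (M y) \<le> c"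
  shows "norm (M y) \<le> c * norm y"
proof (cases "y = 0")
  case True
  then show ?thesis using clinear_on_zero[OF M] by simp
next
  case False
  then have pos: "0 < norm y" by simp
  have "norm (M (complex_of_real (1 / norm y) *\<^sub>C y)) \<le> c" using pos by (intro unit) (simp add: norm_divide)
  then have "1 / norm y * norm (M y) \<le> c" by (simp add: clinear_onD(2)[OF M] norm_divide)
  then show ?thesis using pos by (simp add: field_simps)
qed

text \<open>Domination gives the row norm of the \<open>B\<close> entries the same bound 1 as that
  of the \<open>A\<close> entries. The Hilbert--Schmidt maps \<open>M\<close> and \<open>N\<close>
  then convert both into column bounds \<open>c\<close>, whose sum is \<open>2 * c\<close>. The
  components \<open>A\<close> and \<open>B\<close> are left open because the roles of
  \<open>fst\<close> and \<open>snd\<close> are exchanged on \<open>K\<close>.\<close>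

lemma off_diagonal_col_bound:
  fixes A B :: "l2 \<times> l2 \<Rightarrow> l2" and M N :: "l2 \<Rightarrow> l2"
  assumes H: "complex_vector.subspace H" and A: "clinear_on UNIV A" and B: "clinear_on UNIV B"
    and dom: "\<And>h. h \<in> H \<Longrightarrow> norm (B h) \<le> norm (A h)"
    and est: "\<And>h. h \<in> H \<Longrightarrow> norm (B h) \<le> norm (M (A h)) + norm (N (B h))"
    and M: "clinear_on UNIV M" "\<And>v. norm (M v) \<le> c * norm v" "\<And>K. (\<Sum>k<K. (norm (M (basis k)))\<^sup>2) \<le> c\<^sup>2"
    and N: "clinear_on UNIV N" "\<And>v. norm (N v) \<le> c * norm v" "\<And>K. (\<Sum>k<K. (norm (N (basis k)))\<^sup>2) \<le> c\<^sup>2"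
    and c: "0 \<le> c"
    and x: "\<And>i j. i < n \<Longrightarrow> j < n \<Longrightarrow> x i j \<in> H" and bound: "col_bound n (\<lambda>i j. A (x j i)) 1"
  shows "col_bound n (\<lambda>i j. B (x i j)) (2 * c)"
proof -
  have comb: "(\<Sum>j<n. t j *\<^sub>C y j) \<in> H" if "\<And>j. j < n \<Longrightarrow> y j \<in> H" for t y
    using H that by (auto intro!: complex_vector.subspace_sum complex_vector.subspace_scale)
  have lin: "T (\<Sum>j<n. t j *\<^sub>C y j) = (\<Sum>j<n. t j *\<^sub>C T (y j))" if "clinear_on UNIV T"
    for T :: "l2 \<times> l2 \<Rightarrow> l2" and t y
    by (rule clinear_on_sum[OF that]) simp_all
  have lin': "T (\<Sum>j<n. t j *\<^sub>C y j) = (\<Sum>j<n. t j *\<^sub>C T (y j))" if "clinear_on UNIV T"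
    for T :: "l2 \<Rightarrow> l2" and t y
    by (rule clinear_on_sum[OF that]) simp_all
  have "col_bound n (\<lambda>i j. B (x j i)) 1"
    using bound by (rule col_bound_dominated) (simp add: lin[OF A, symmetric] lin[OF B, symmetric] dom comb x)
  then have "col_bound n (\<lambda>i j. N (B (x i j))) (c * 1)"
    by (intro hilbert_schmidt_col_bound[OF N c]) simp_all
  moreover have "col_bound n (\<lambda>i j. M (A (x i j))) (c * 1)"
    using bound by (intro hilbert_schmidt_col_bound[OF M c]) simp_all
  ultimately have "col_bound n (\<lambda>i j. B (x i j)) (c * 1 + c * 1)"
    by (intro col_bound_triangle[of n "\<lambda>i j. M (A (x i j))" _ "\<lambda>i j. N (B (x i j))"])
      (simp_all add: lin'[OF M(1), symmetric] lin'[OF N(1), symmetric] lin[OF A, symmetric]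
        lin[OF B, symmetric] est comb x)
  then show ?thesis by simp
qed

lemma clinear_on_fst: "clinear_on UNIV (fst :: l2 \<times> l2 \<Rightarrow> l2)"
  and clinear_on_snd: "clinear_on UNIV (snd :: l2 \<times> l2 \<Rightarrow> l2)"
  by (simp_all add: clinear_on_def)

section \<open>The projection in coordinates, with cb norm at most \<open>c\<close>\<close>

context
  fixes V :: "(l2 \<times> l2) set" and Q :: "l2 \<times> l2 \<Rightarrow> l2 \<times> l2" and c :: real
  assumes V: "complex_vector.subspace V" "closed V"
    and Q_lin: "clinear_on UNIV Q" and QV: "\<And>p. Q p \<in> V" and Q_id: "\<And>v. v \<in> V \<Longrightarrow> Q v = v"
    and c: "0 \<le> c"
    and test: "\<And>n x. col_bound n (\<lambda>i j. fst (x j i)) 1 \<Longrightarrow> col_bound n (\<lambda>i j. snd (x i j)) 1 \<Longrightarrow>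
      col_bound n (\<lambda>i j. fst (Q (x j i))) c \<and> col_bound n (\<lambda>i j. snd (Q (x i j))) c"
begin

lemma test_1:
  assumes "norm (fst p) \<le> 1" "norm (snd p) \<le> 1"
  shows "norm (fst (Q p)) \<le> c" "norm (snd (Q p)) \<le> c"
  using test[of 1 "\<lambda>i j. p"] assms by (simp_all only: col_bound_1)

text \<open>Scaled so that the larger of its two parts has norm exactly 1, the vector is a fixed
  point of \<open>Q\<close> in the unit ball.\<close>

lemma one_le_of_nonzero:
  assumes v: "v \<in> V" "v \<noteq> 0"
  shows "1 \<le> c"
proof -
  define m where "m = max (norm (fst v)) (norm (snd v))"
  have m: "0 < m"
    using v(2) by (auto simp: m_def prod_eq_iff less_max_iff_disj)
  let ?w = "complex_of_real (1 / m) *\<^sub>C v"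
  have "?w \<in> V" using V(1) v(1) by (rule complex_vector.subspace_scale)
  then have Qw: "Q ?w = ?w" by (rule Q_id)
  have n: "norm (fst ?w) = norm (fst v) / m" "norm (snd ?w) = norm (snd v) / m"
    using m by (simp_all add: norm_divide)
  have "norm (fst ?w) \<le> 1" "norm (snd ?w) \<le> 1" unfolding n using m by (simp_all add: m_def)
  then have "norm (fst ?w) \<le> c" "norm (snd ?w) \<le> c" using test_1[of ?w] unfolding Qw by blast+
  then have "norm (fst v) \<le> c * m" "norm (snd v) \<le> c * m"
    unfolding n using m by (simp_all add: field_simps)
  then have "m \<le> c * m" by (simp add: m_def)
  then show ?thesis using m by simp
qed

definition offdiag_21 :: "l2 \<Rightarrow> l2" where "offdiag_21 y = snd (Q (y, 0))"
definition offdiag_12 :: "l2 \<Rightarrow> l2" where "offdiag_12 y = fst (Q (0, y))"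

lemma offdiag_linear: "clinear_on UNIV offdiag_21" "clinear_on UNIV offdiag_12"
proof -
  have "Q (x + y, 0) = Q (x, 0) + Q (y, 0)" "Q (0, x + y) = Q (0, x) + Q (0, y)"
    "Q (s *\<^sub>C x, 0) = s *\<^sub>C Q (x, 0)" "Q (0, s *\<^sub>C x) = s *\<^sub>C Q (0, x)" for x y s
    using clinear_onD(1)[OF Q_lin, of "(x, 0)" "(y, 0)"] clinear_onD(1)[OF Q_lin, of "(0, x)" "(0, y)"]
      clinear_onD(2)[OF Q_lin, of "(x, 0)" s] clinear_onD(2)[OF Q_lin, of "(0, x)" s]
    by (simp_all add: scaleC_prod_def[of s "(_, _)"])
  then show "clinear_on UNIV offdiag_21" "clinear_on UNIV offdiag_12"
    by (simp_all add: clinear_on_def offdiag_21_def offdiag_12_def)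
qed

lemma offdiag_bounded: "norm (offdiag_21 y) \<le> c * norm y" "norm (offdiag_12 y) \<le> c * norm y"
  by (rule norm_clinear_le[OF offdiag_linear(1)], simp add: offdiag_21_def test_1)
    (rule norm_clinear_le[OF offdiag_linear(2)], simp add: offdiag_12_def test_1)

text \<open>Complete boundedness is used on matrices of norm at most 1, independently of their size,
  whose images have at least the square root of the Hilbert--Schmidt sum as norm.\<close>

lemma offdiag_hilbert_schmidt:
  "(\<Sum>k<n. (norm (offdiag_21 (basis k)))\<^sup>2) \<le> c\<^sup>2" "(\<Sum>k<n. (norm (offdiag_12 (basis k)))\<^sup>2) \<le> c\<^sup>2"
proof -
  have Q0: "Q 0 = 0" using clinear_on_zero[OF Q_lin] by simp
  \<comment> \<open>A column of unit vectors in the row component: its norm is at most 1 there,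
    while its image is a column in the column component, where the norm is the square sum.\<close>
  let ?x = "\<lambda>(i :: nat) (j :: nat). if j = 0 then (basis i, 0) else 0 :: l2 \<times> l2"
  have "col_bound n (\<lambda>i j. snd (Q (?x i j))) c"
  proof (rule test[THEN conjunct2])
    have "(\<lambda>i j. fst (?x j i)) = (\<lambda>i j. if i = 0 then basis j else 0)" by (auto simp: fun_eq_iff)
    then show "col_bound n (\<lambda>i j. fst (?x j i)) 1" by (simp only: col_bound_basis)
    have "(\<lambda>i j. snd (?x i j)) = (\<lambda>i j. 0)" by (auto simp: fun_eq_iff)
    then show "col_bound n (\<lambda>i j. snd (?x i j)) 1" by (simp only: col_bound_zero zero_le_one)
  qed
  moreover have "(\<lambda>i j. snd (Q (?x i j))) = (\<lambda>i j. if j = 0 then offdiag_21 (basis i) else 0)"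
    by (auto simp: fun_eq_iff offdiag_21_def Q0)
  ultimately show "(\<Sum>k<n. (norm (offdiag_21 (basis k)))\<^sup>2) \<le> c\<^sup>2"
    by (intro sum_squares_le_of_col_bound c) simp
  \<comment> \<open>The transposed choice, a row of unit vectors in the column component.\<close>
  let ?y = "\<lambda>(i :: nat) (j :: nat). if i = 0 then (0, basis j) else 0 :: l2 \<times> l2"
  have "col_bound n (\<lambda>i j. fst (Q (?y j i))) c"
  proof (rule test[THEN conjunct1])
    have "(\<lambda>i j. snd (?y i j)) = (\<lambda>i j. if i = 0 then basis j else 0)" by (auto simp: fun_eq_iff)
    then show "col_bound n (\<lambda>i j. snd (?y i j)) 1" by (simp only: col_bound_basis)
    have "(\<lambda>i j. fst (?y j i)) = (\<lambda>i j. 0)" by (auto simp: fun_eq_iff)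
    then show "col_bound n (\<lambda>i j. fst (?y j i)) 1" by (simp only: col_bound_zero zero_le_one)
  qed
  moreover have "(\<lambda>i j. fst (Q (?y j i))) = (\<lambda>i j. if j = 0 then offdiag_12 (basis i) else 0)"
    by (auto simp: fun_eq_iff offdiag_12_def Q0)
  ultimately show "(\<Sum>k<n. (norm (offdiag_12 (basis k)))\<^sup>2) \<le> c\<^sup>2"
    by (intro sum_squares_le_of_col_bound c) simp
qed

text \<open>
  On \<open>H\<close> the column part is controlled by the row part: decompose \<open>h = Q (fst h, 0) + Q (0, snd h)\<close>
  and project both summands to \<open>H\<close>; only the off-diagonal entries of \<open>Q\<close> survive in the estimate.
\<close>

lemma splitting_estimates:
  obtains H K \<pi> \<rho> where "complex_vector.subspace H" "closed H" "H \<subseteq> V"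
    "complex_vector.subspace K" "closed K" "K \<subseteq> V"
    "\<And>v. v \<in> V \<Longrightarrow> \<pi> v \<in> H" "\<And>v. v \<in> V \<Longrightarrow> \<rho> v \<in> K" "\<And>v. v \<in> V \<Longrightarrow> \<pi> v + \<rho> v = v"
    "\<And>h k. h \<in> H \<Longrightarrow> k \<in> K \<Longrightarrow> \<pi> (h + k) = h \<and> \<rho> (h + k) = k"
    "\<And>v. v \<in> V \<Longrightarrow> norm (fst (\<pi> v)) \<le> norm (fst v)" "\<And>v. v \<in> V \<Longrightarrow> norm (snd (\<rho> v)) \<le> norm (snd v)"
    "\<And>h. h \<in> H \<Longrightarrow> norm (snd h) \<le> norm (fst h)" "\<And>k. k \<in> K \<Longrightarrow> norm (fst k) \<le> norm (snd k)"
    "\<And>n x. (\<And>i j. i < n \<Longrightarrow> j < n \<Longrightarrow> x i j \<in> H) \<Longrightarrow> col_bound n (\<lambda>i j. fst (x j i)) 1 \<Longrightarrow>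
      col_bound n (\<lambda>i j. snd (x i j)) (2 * c)"
    "\<And>n x. (\<And>i j. i < n \<Longrightarrow> j < n \<Longrightarrow> x i j \<in> K) \<Longrightarrow> col_bound n (\<lambda>i j. snd (x i j)) 1 \<Longrightarrow>
      col_bound n (\<lambda>i j. fst (x j i)) (2 * c)"
proof -
  show ?thesis
  proof (rule two_projections_decomposition[OF V])
    fix H K
    assume H: "complex_vector.subspace H" "closed H" "H \<subseteq> V"
      and K: "complex_vector.subspace K" "closed K" "K \<subseteq> V"
      and ex: "\<And>v. v \<in> V \<Longrightarrow> \<exists>h\<in>H. \<exists>k\<in>K. v = h + k"
      and orth: "\<And>h k. h \<in> H \<Longrightarrow> k \<in> K \<Longrightarrow> inner (fst h) (fst k) = 0 \<and> inner (snd h) (snd k) = 0"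
      and domH: "\<And>h. h \<in> H \<Longrightarrow> norm (snd h) \<le> norm (fst h)"
      and domK: "\<And>k. k \<in> K \<Longrightarrow> norm (fst k) \<le> norm (snd k)"
    have triv: "x = 0" if "x \<in> H" "x \<in> K" for x
      using orth[OF that] by (simp add: prod_eq_iff)
    have uniq: "h = h' \<and> k = k'" if "h \<in> H" "k \<in> K" "h' \<in> H" "k' \<in> K" "h + k = h' + k'" for h k h' k'
    proof -
      have "h - h' = k' - k" using that(5) by (simp add: algebra_simps)
      moreover have "h - h' \<in> H" "k' - k \<in> K"
        using H(1) K(1) that by (auto intro: complex_vector.subspace_diff)
      ultimately have "h - h' = 0" by (intro triv) simp_all
      then show ?thesis using that(5) by simp
    qed
    define \<pi> where "\<pi> v = (THE h. h \<in> H \<and> v - h \<in> K)" for v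
    define \<rho> where "\<rho> v = v - \<pi> v" for v
    have \<pi>: "\<pi> (h + k) = h \<and> \<rho> (h + k) = k" if "h \<in> H" "k \<in> K" for h k
    proof -
      have "\<pi> (h + k) = h"
        unfolding \<pi>_def
      proof (rule the_equality)
        show "h \<in> H \<and> h + k - h \<in> K" using that by simp
        fix g assume g: "g \<in> H \<and> h + k - g \<in> K"
        then have "g = h \<and> h + k - g = k" using that by (intro uniq) simp_all
        then show "g = h" ..
      qed
      then show ?thesis by (simp add: \<rho>_def)
    qed
    have split: "\<pi> v \<in> H" "\<rho> v \<in> K" "\<pi> v + \<rho> v = v" if v: "v \<in> V" for v
    proof -
      obtain h k where "h \<in> H" "k \<in> K" "v = h + k" using ex[OF v] by blast
      then show "\<pi> v \<in> H" "\<rho> v \<in> K" "\<pi> v + \<rho> v = v" using \<pi> by auto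
    qed
    have pythagoras: "norm a \<le> norm (a + b)" "norm b \<le> norm (a + b)" if "inner a b = 0" for a b :: l2
    proof -
      have "(norm (a + b))\<^sup>2 = (norm a)\<^sup>2 + (norm b)\<^sup>2"
        using that by (simp add: power2_norm_eq_inner inner_add inner_commute)
      then have "(norm a)\<^sup>2 \<le> (norm (a + b))\<^sup>2" "(norm b)\<^sup>2 \<le> (norm (a + b))\<^sup>2" by simp_all
      then show "norm a \<le> norm (a + b)" "norm b \<le> norm (a + b)"
        by (simp_all only: power2_le_iff_abs_le norm_ge_zero abs_norm_cancel)
    qed
    \<comment> \<open>Orthogonality holds in each component separately, so Pythagoras applies to the
      row parts and to the column parts independently.\<close>
    have contr: "norm (fst (\<pi> v)) \<le> norm (fst v)" "norm (snd (\<pi> v)) \<le> norm (snd v)"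
        "norm (fst (\<rho> v)) \<le> norm (fst v)" "norm (snd (\<rho> v)) \<le> norm (snd v)" if v: "v \<in> V" for v
    proof -
      note o = orth[OF split(1)[OF v] split(2)[OF v]]
      have "fst v = fst (\<pi> v) + fst (\<rho> v)" "snd v = snd (\<pi> v) + snd (\<rho> v)"
        using arg_cong[OF split(3)[OF v], of fst] arg_cong[OF split(3)[OF v], of snd] by simp_all
      then show "norm (fst (\<pi> v)) \<le> norm (fst v)" "norm (snd (\<pi> v)) \<le> norm (snd v)"
        "norm (fst (\<rho> v)) \<le> norm (fst v)" "norm (snd (\<rho> v)) \<le> norm (snd v)"
        using pythagoras[of "fst (\<pi> v)" "fst (\<rho> v)"] pythagoras[of "snd (\<pi> v)" "snd (\<rho> v)"] o
        by simp_all
    qed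
    have \<pi>_add: "\<pi> (v + w) = \<pi> v + \<pi> w \<and> \<rho> (v + w) = \<rho> v + \<rho> w" if "v \<in> V" "w \<in> V" for v w
    proof -
      have "v + w = (\<pi> v + \<pi> w) + (\<rho> v + \<rho> w)"
        using arg_cong2[OF split(3)[OF that(1)] split(3)[OF that(2)], of plus] by (simp add: algebra_simps)
      moreover have "\<pi> v + \<pi> w \<in> H" "\<rho> v + \<rho> w \<in> K"
        by (intro complex_vector.subspace_add H(1) K(1) split that)+
      ultimately show ?thesis using \<pi>[of "\<pi> v + \<pi> w" "\<rho> v + \<rho> w"] by simp
    qed
    have Q_split: "v = Q (fst v, 0) + Q (0, snd v)" if "v \<in> V" for v
    proof -
      have "Q ((fst v, 0) + (0, snd v)) = Q (fst v, 0) + Q (0, snd v)"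
        by (rule clinear_onD(1)[OF Q_lin]) simp_all
      then show ?thesis using Q_id[OF that] by simp
    qed
    have estH: "norm (snd h) \<le> norm (offdiag_21 (fst h)) + norm (offdiag_12 (snd h))" if h: "h \<in> H" for h
    proof -
      let ?v = "Q (fst h, 0)" and ?w = "Q (0, snd h)"
      have "\<pi> h = h" using \<pi>[OF h complex_vector.subspace_0[OF K(1)]] by simp
      then have "h = \<pi> ?v + \<pi> ?w" using \<pi>_add[OF QV QV] Q_split[of h] h H(3) by (metis subsetD)
      then have "norm (snd h) \<le> norm (snd (\<pi> ?v)) + norm (snd (\<pi> ?w))"
        by (metis norm_triangle_ineq snd_add)
      moreover have "norm (snd (\<pi> ?v)) \<le> norm (offdiag_21 (fst h))"
        using contr(2)[OF QV] by (simp add: offdiag_21_def)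
      \<comment> \<open>Here \<open>domH\<close> passes from the column part to the row part,
        replacing a diagonal corner of \<open>Q\<close> by an off-diagonal one.\<close>
      moreover have "norm (snd (\<pi> ?w)) \<le> norm (offdiag_12 (snd h))"
        using order_trans[OF domH[OF split(1)[OF QV]] contr(1)[OF QV]] by (simp add: offdiag_12_def)
      ultimately show ?thesis by linarith
    qed
    have estK: "norm (fst k) \<le> norm (offdiag_12 (snd k)) + norm (offdiag_21 (fst k))" if k: "k \<in> K" for k
    proof -
      let ?v = "Q (fst k, 0)" and ?w = "Q (0, snd k)"
      have "\<rho> k = k" using \<pi>[OF complex_vector.subspace_0[OF H(1)] k] by simp
      then have "k = \<rho> ?v + \<rho> ?w" using \<pi>_add[OF QV QV] Q_split[of k] k K(3) by (metis subsetD)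
      then have "norm (fst k) \<le> norm (fst (\<rho> ?v)) + norm (fst (\<rho> ?w))"
        by (metis norm_triangle_ineq fst_add)
      moreover have "norm (fst (\<rho> ?w)) \<le> norm (offdiag_12 (snd k))"
        using contr(3)[OF QV] by (simp add: offdiag_12_def)
      moreover have "norm (fst (\<rho> ?v)) \<le> norm (offdiag_21 (fst k))"
        using order_trans[OF domK[OF split(2)[OF QV]] contr(4)[OF QV]] by (simp add: offdiag_21_def)
      ultimately show ?thesis by linarith
    qed
    note hs21 = offdiag_linear(1) offdiag_bounded(1) offdiag_hilbert_schmidt(1)
    note hs12 = offdiag_linear(2) offdiag_bounded(2) offdiag_hilbert_schmidt(2)
    have FH: "col_bound n (\<lambda>i j. snd (x i j)) (2 * c)"
      if "\<And>i j. i < n \<Longrightarrow> j < n \<Longrightarrow> x i j \<in> H" "col_bound n (\<lambda>i j. fst (x j i)) 1" for n x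
      by (rule off_diagonal_col_bound[OF H(1) clinear_on_fst clinear_on_snd domH estH hs21 hs12 c that])
    \<comment> \<open>Exchanging the components exchanges rows and columns, so the lemma is applied
      to the transposed matrix.\<close>
    have FK: "col_bound n (\<lambda>i j. fst (x j i)) (2 * c)"
      if "\<And>i j. i < n \<Longrightarrow> j < n \<Longrightarrow> x i j \<in> K" "col_bound n (\<lambda>i j. snd (x i j)) 1" for n x
      by (rule off_diagonal_col_bound[OF K(1) clinear_on_snd clinear_on_fst domK estK hs12 hs21 c,
            of n "\<lambda>i j. x j i"]) (use that in simp_all)
    show ?thesis
      by (rule that[of H K \<pi> \<rho>, OF H K split \<pi> contr(1,4) domH domK FH FK])
  qed
qed

end

section \<open>Transfer to the row and column spaces\<close>

lemma cb_norm_leI: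
  assumes "\<And>n a. a \<in> mats n E \<Longrightarrow> mnorm E n a \<le> 1 \<Longrightarrow> mnorm F n (\<lambda>i j. u (a i j)) \<le> r"
  shows "cb_norm E F u \<le> ennreal r"
  unfolding cb_norm_def by (intro SUP_least ennreal_leI) (auto intro: assms)

lemma mnorm_le_cb_norm:
  assumes "cb_norm E F u = ennreal r" "0 \<le> r" "a \<in> mats n E" "mnorm E n a \<le> 1"
  shows "mnorm F n (\<lambda>i j. u (a i j)) \<le> r"
proof -
  have "ennreal (mnorm F n (\<lambda>i j. u (a i j))) \<le> cb_norm E F u"
    unfolding cb_norm_def using assms(3,4) by (intro SUP_upper2[of n] SUP_upper) auto
  then show ?thesis using assms(1,2) by simp
qed

lemma clinear_on_inv_into:
  assumes u: "clinear_on S u" and S: "complex_vector.subspace S" and inj: "inj_on u S"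
  shows "clinear_on (u ` S) (inv_into S u)"
  unfolding clinear_on_def
proof (intro conjI ballI allI; elim imageE; hypsubst)
  fix x y c assume x: "x \<in> S" and y: "y \<in> S"
  have "u x + u y = u (x + y)" "c *\<^sub>C u x = u (c *\<^sub>C x)" using clinear_onD[OF u] x y by simp_all
  moreover have "x + y \<in> S" "c *\<^sub>C x \<in> S"
    using S x y by (simp_all add: complex_vector.subspace_add complex_vector.subspace_scale)
  ultimately show "inv_into S u (u x + u y) = inv_into S u (u x) + inv_into S u (u y)"
    "inv_into S u (c *\<^sub>C u x) = c *\<^sub>C inv_into S u (u x)"
    using inj x y by simp_all
qed

definition embed :: "l2 \<times> l2 \<Rightarrow> ((nat \<Rightarrow> complex) \<Rightarrow> nat \<Rightarrow> complex) \<times> ((nat \<Rightarrow> complex) \<Rightarrow> nat \<Rightarrow> complex)" where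
  "embed p = (row_op (fst p), col_op (snd p))"

lemma elems_RC: "elems (row_space \<oplus>\<^sub>\<infinity> col_space) = range embed"
  by (auto simp: dsum_def elems_row_space elems_col_space embed_def image_iff)

lemma embed_add: "embed (p + q) = embed p + embed q"
  by (simp add: embed_def row_op_add col_op_add)

lemma embed_scaleC: "embed (c *\<^sub>C p) = c *\<^sub>C embed p"
  by (simp add: embed_def row_op_scaleC col_op_scaleC scaleC_prod_def)

lemma embed_diff: "embed (p - q) = embed p - embed q"
  by (simp add: embed_def row_op_diff col_op_diff)

lemma embed_zero: "embed 0 = 0"
  using embed_scaleC[of 0 0] by simp

lemma mnorm_embed:
  assumes a: "\<And>i j. i < n \<Longrightarrow> j < n \<Longrightarrow> a i j = embed (x i j)" and c: "0 \<le> c"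
  shows "mnorm (row_space \<oplus>\<^sub>\<infinity> col_space) n a \<le> c \<longleftrightarrow>
    col_bound n (\<lambda>i j. fst (x j i)) c \<and> col_bound n (\<lambda>i j. snd (x i j)) c"
  using mnorm_row_op[of n "\<lambda>i j. fst (a i j)" "\<lambda>i j. fst (x i j)", OF _ c]
    mnorm_col_op[of n "\<lambda>i j. snd (a i j)" "\<lambda>i j. snd (x i j)", OF _ c] a
  by (simp add: dsum_def embed_def)

lemma enorm_embed:
  assumes "0 \<le> c"
  shows "enorm (row_space \<oplus>\<^sub>\<infinity> col_space) (embed p) \<le> c \<longleftrightarrow> norm (fst p) \<le> c \<and> norm (snd p) \<le> c"
  using mnorm_embed[of 1 "\<lambda>i j. embed p" "\<lambda>i j. p" c] assms
  by (simp only: col_bound_1 enorm_def simp_thms)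

lemma inj_embed: "inj embed"
proof (rule injI)
  fix p q assume "embed p = embed q"
  then have "embed (p - q) = embed 0" by (simp add: embed_diff embed_zero)
  then have "norm (fst (p - q)) \<le> 0 \<and> norm (snd (p - q)) \<le> 0"
    using enorm_embed[of 0 "p - q"] enorm_embed[of 0 0] by simp
  then show "p = q" by (simp add: prod_eq_iff)
qed

text \<open>\<open>enorm\<close> of \<open>embed p\<close> is the larger of the norms of the two
  parts, hence at most \<open>norm p\<close>. Convergence in the product therefore implies
  approximation in \<open>enorm\<close>, under which \<open>S\<close> is closed.\<close>

lemma closed_vimage_embed:
  assumes S: "closed_subspace S (row_space \<oplus>\<^sub>\<infinity> col_space)"
  shows "closed (embed -` S)" "complex_vector.subspace (embed -` S)" "embed ` (embed -` S) = S"
proof -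
  have sub: "complex_vector.subspace S" and SE: "S \<subseteq> range embed"
    and cl: "norm_closure (row_space \<oplus>\<^sub>\<infinity> col_space) S = S"
    using S by (auto simp: closed_subspace_def elems_RC)
  show "embed ` (embed -` S) = S" using SE by blast
  show "complex_vector.subspace (embed -` S)"
    using sub unfolding complex_vector.subspace_def by (simp add: embed_add embed_scaleC embed_zero)
  show "closed (embed -` S)"
    unfolding closed_sequential_limits
  proof (intro allI impI; elim conjE)
    fix x l assume x: "\<forall>n. x n \<in> embed -` S" and l: "x \<longlonglongrightarrow> l"
    have "\<exists>a\<in>S. enorm (row_space \<oplus>\<^sub>\<infinity> col_space) (embed l - a) < e" if e: "0 < e" for e
    proof -
      obtain n where "norm (x n - l) < e / 2" using LIMSEQ_D[OF l, of "e / 2"] e by auto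
      then have n: "norm (l - x n) \<le> e / 2" by (simp add: norm_minus_commute)
      have "enorm (row_space \<oplus>\<^sub>\<infinity> col_space) (embed (l - x n)) \<le> e / 2"
        using norm_fst_le[of "fst (l - x n)" "snd (l - x n)"] norm_snd_le[of "snd (l - x n)" "fst (l - x n)"] n e
        by (subst enorm_embed) (simp_all del: fst_diff snd_diff)
      then show ?thesis using x e by (intro bexI[of _ "embed (x n)"]) (auto simp: embed_diff)
    qed
    then have "embed l \<in> norm_closure (row_space \<oplus>\<^sub>\<infinity> col_space) S"
      by (simp add: norm_closure_def elems_RC)
    then show "l \<in> embed -` S" by (simp add: cl)
  qed
qed

text \<open>A bounded operator that is bounded below has closed range. This makes the row parts of
  \<open>H\<close> and the column parts of \<open>K\<close> Hilbert spaces; the 2 stems from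
  bounding the norm of a pair by the sum of the norms of its parts.\<close>

lemma closed_image_bounded_below:
  fixes H :: "(l2 \<times> l2) set" and A :: "l2 \<times> l2 \<Rightarrow> l2"
  assumes H: "complex_vector.subspace H" "closed H" and A: "bounded_linear A" "clinear_on UNIV A"
    and below: "\<And>h. h \<in> H \<Longrightarrow> norm h \<le> 2 * norm (A h)"
  shows "complex_vector.subspace (A ` H)" "closed (A ` H)"
proof -
  have "\<forall>h\<in>H. 1 / 2 * norm h \<le> norm (A h)" using below by fastforce
  then have "complete (A ` H)"
    using H(2) complete_isometric_image[of "1/2" H A, OF _ subspace_of_complex_prod[OF H(1)] A(1)]
    by (simp add: complete_eq_closed)
  then show "closed (A ` H)" by (simp add: complete_eq_closed)
  show "complex_vector.subspace (A ` H)"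
  proof (rule complex_vector.subspaceI; (elim imageE, hypsubst)?)
    show "0 \<in> A ` H"
      using clinear_on_zero[OF A(2)] complex_vector.subspace_0[OF H(1)] by (auto intro: image_eqI[of _ A 0])
    fix x y s assume "x \<in> H" "y \<in> H"
    then have "A (x + y) \<in> A ` H" "A (s *\<^sub>C x) \<in> A ` H"
      using H(1) by (simp_all add: complex_vector.subspace_add complex_vector.subspace_scale)
    then show "A x + A y \<in> A ` H" "s *\<^sub>C A x \<in> A ` H" by (simp_all add: clinear_onD[OF A(2)])
  qed
qed

lemma norm_prod_le_two: "norm (snd p) \<le> norm (fst p) \<Longrightarrow> norm p \<le> 2 * norm (fst p)"
  "norm (fst p) \<le> norm (snd p) \<Longrightarrow> norm p \<le> 2 * norm (snd p)"
  for p :: "l2 \<times> l2"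
  using norm_Pair_le[of "fst p" "snd p"] by simp_all

lemma sub_opspace_simps [simp]: "elems (sub_opspace E S) = S" "mnorm (sub_opspace E S) = mnorm E"
  by (simp_all add: sub_opspace_def)

lemma d_cb_complemented_le:
  assumes S: "closed_subspace S (row_space \<oplus>\<^sub>\<infinity> col_space)"
    and P: "cb_projection (row_space \<oplus>\<^sub>\<infinity> col_space) S P"
  shows "\<exists>(H :: (nat \<Rightarrow> complex) nspace) (K :: (nat \<Rightarrow> complex) nspace).
    hilbert_space H \<and> hilbert_space K \<and>
    completely_isomorphic (sub_opspace (row_space \<oplus>\<^sub>\<infinity> col_space) S) (hilbert_row H \<oplus>\<^sub>\<infinity> hilbert_col K) \<and>
    d_cb (sub_opspace (row_space \<oplus>\<^sub>\<infinity> col_space) S) (hilbert_row H \<oplus>\<^sub>\<infinity> hilbert_col K)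
      \<le> ennreal 3 * cb_norm (row_space \<oplus>\<^sub>\<infinity> col_space) (sub_opspace (row_space \<oplus>\<^sub>\<infinity> col_space) S) P"
proof -
  let ?E = "row_space \<oplus>\<^sub>\<infinity> col_space"
  let ?S = "sub_opspace ?E S"
  define V where "V = embed -` S"
  have V: "complex_vector.subspace V" "closed V" and SV: "S = embed ` V"
    using closed_vimage_embed[OF S] by (simp_all add: V_def)
  have P_lin: "clinear_on (range embed) P" and P_fin: "cb_norm ?E ?S P < \<infinity>"
    and P_range: "P ` range embed = S" and P_idem: "\<And>x. x \<in> range embed \<Longrightarrow> P (P x) = P x"
    using P by (auto simp: cb_projection_def cb_map_def elems_RC)
  obtain c where c: "0 \<le> c" and Pc: "cb_norm ?E ?S P = ennreal c"
    using P_fin by (cases "cb_norm ?E ?S P") auto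
  define Q where "Q p = inv embed (P (embed p))" for p
  have eQ: "embed (Q p) = P (embed p)" for p
    unfolding Q_def using P_range SV by (intro f_inv_into_f) blast
  have QV: "Q p \<in> V" for p using P_range by (auto simp: V_def eQ)
  have Q_lin: "clinear_on UNIV Q"
    unfolding clinear_on_def
  proof (intro conjI ballI allI)
    fix p q s
    show "Q (p + q) = Q p + Q q"
      by (rule injD[OF inj_embed]) (simp add: eQ embed_add clinear_onD(1)[OF P_lin])
    show "Q (s *\<^sub>C p) = s *\<^sub>C Q p"
      by (rule injD[OF inj_embed]) (simp add: eQ embed_scaleC clinear_onD(2)[OF P_lin])
  qed
  have Q_id: "Q v = v" if "v \<in> V" for v
  proof (rule injD[OF inj_embed])
    have "embed v \<in> P ` range embed" using that P_range by (simp add: V_def)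
    then obtain x where "x \<in> range embed" "embed v = P x" by blast
    then show "embed (Q v) = embed v" using P_idem[of x] by (simp add: eQ)
  qed
  have test: "col_bound n (\<lambda>i j. fst (Q (x j i))) c \<and> col_bound n (\<lambda>i j. snd (Q (x i j))) c"
    if "col_bound n (\<lambda>i j. fst (x j i)) 1" "col_bound n (\<lambda>i j. snd (x i j)) 1" for n x
  proof -
    have "mnorm ?S n (\<lambda>i j. P (embed (x i j))) \<le> c"
    proof (rule mnorm_le_cb_norm[OF Pc c])
      show "(\<lambda>i j. embed (x i j)) \<in> mats n ?E" by (simp add: mats_def elems_RC)
      show "mnorm ?E n (\<lambda>i j. embed (x i j)) \<le> 1"
        using that by (subst mnorm_embed) simp_all
    qed
    then have "mnorm ?E n (\<lambda>i j. embed (Q (x i j))) \<le> c" by (simp add: eQ)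
    then show ?thesis by (subst (asm) mnorm_embed) (simp_all add: c)
  qed
  note Vfacts = V Q_lin QV Q_id c test
  show ?thesis
  proof (rule splitting_estimates[OF Vfacts])
    fix H K \<pi> \<rho>
    assume H: "complex_vector.subspace H" "closed H" "H \<subseteq> V"
      and K: "complex_vector.subspace K" "closed K" "K \<subseteq> V"
      and \<pi>: "\<And>v. v \<in> V \<Longrightarrow> \<pi> v \<in> H" and \<rho>: "\<And>v. v \<in> V \<Longrightarrow> \<rho> v \<in> K"
      and split: "\<And>v. v \<in> V \<Longrightarrow> \<pi> v + \<rho> v = v"
      and uniq: "\<And>h k. h \<in> H \<Longrightarrow> k \<in> K \<Longrightarrow> \<pi> (h + k) = h \<and> \<rho> (h + k) = k"
      and contr: "\<And>v. v \<in> V \<Longrightarrow> norm (fst (\<pi> v)) \<le> norm (fst v)"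
        "\<And>v. v \<in> V \<Longrightarrow> norm (snd (\<rho> v)) \<le> norm (snd v)"
      and domH: "\<And>h. h \<in> H \<Longrightarrow> norm (snd h) \<le> norm (fst h)"
      and domK: "\<And>k. k \<in> K \<Longrightarrow> norm (fst k) \<le> norm (snd k)"
      and FH: "\<And>n x. (\<And>i j. i < n \<Longrightarrow> j < n \<Longrightarrow> x i j \<in> H) \<Longrightarrow> col_bound n (\<lambda>i j. fst (x j i)) 1 \<Longrightarrow>
        col_bound n (\<lambda>i j. snd (x i j)) (2 * c)"
      and FK: "\<And>n x. (\<And>i j. i < n \<Longrightarrow> j < n \<Longrightarrow> x i j \<in> K) \<Longrightarrow> col_bound n (\<lambda>i j. snd (x i j)) 1 \<Longrightarrow>
        col_bound n (\<lambda>i j. fst (x j i)) (2 * c)"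
    define D1 where "D1 = fst ` H"
    define D2 where "D2 = snd ` K"
    have D1: "complex_vector.subspace D1" "closed D1"
      unfolding D1_def
      by (rule closed_image_bounded_below[OF H(1,2) bounded_linear_fst clinear_on_fst],
          simp add: norm_prod_le_two domH)+
    have D2: "complex_vector.subspace D2" "closed D2"
      unfolding D2_def
      by (rule closed_image_bounded_below[OF K(1,2) bounded_linear_snd clinear_on_snd],
          simp add: norm_prod_le_two domK)+
    have \<pi>\<rho>_add: "\<pi> (v + w) = \<pi> v + \<pi> w \<and> \<rho> (v + w) = \<rho> v + \<rho> w" if "v \<in> V" "w \<in> V" for v w
    proof -
      have "(\<pi> v + \<pi> w) + (\<rho> v + \<rho> w) = v + w"
        using arg_cong2[OF split[OF that(1)] split[OF that(2)], of plus] by (simp add: algebra_simps)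
      moreover have "\<pi> v + \<pi> w \<in> H" "\<rho> v + \<rho> w \<in> K"
        by (intro complex_vector.subspace_add H(1) K(1) \<pi> \<rho> that)+
      ultimately show ?thesis using uniq[of "\<pi> v + \<pi> w" "\<rho> v + \<rho> w"] by simp
    qed
    have \<pi>\<rho>_scale: "\<pi> (s *\<^sub>C v) = s *\<^sub>C \<pi> v \<and> \<rho> (s *\<^sub>C v) = s *\<^sub>C \<rho> v" if v: "v \<in> V" for s v
    proof -
      have "s *\<^sub>C \<pi> v + s *\<^sub>C \<rho> v = s *\<^sub>C v" by (simp add: split[OF v] scaleC_add_right[symmetric])
      moreover have "s *\<^sub>C \<pi> v \<in> H" "s *\<^sub>C \<rho> v \<in> K"
        by (intro complex_vector.subspace_scale H(1) K(1) \<pi> \<rho> v)+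
      ultimately show ?thesis using uniq[of "s *\<^sub>C \<pi> v" "s *\<^sub>C \<rho> v"] by simp
    qed
    have V_add: "h + k \<in> V" if "h \<in> H" "k \<in> K" for h k
      using that H(3) K(3) V(1) by (auto intro: complex_vector.subspace_add)
    let ?H = "hilbert_subspace D1" and ?K = "hilbert_subspace D2"
    let ?F = "hilbert_row ?H \<oplus>\<^sub>\<infinity> hilbert_col ?K"
    define g where "g v = (hrow_op D1 (fst (\<pi> v)), hcol_op (snd (\<rho> v)))" for v
    have D1_in: "fst (\<pi> v) \<in> D1" and D2_in: "snd (\<rho> v) \<in> D2" if "v \<in> V" for v
      using \<pi>[OF that] \<rho>[OF that] by (simp_all add: D1_def D2_def)
    have elems_F: "elems ?F = hrow_op D1 ` D1 \<times> hcol_op ` D2"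
      by (simp add: dsum_def elems_hilbert_row[OF D1] elems_hilbert_col[OF D2])
    have mnorm_F: "mnorm ?F n a \<le> r \<longleftrightarrow>
        col_bound n (\<lambda>i j. fst (\<pi> (v j i))) r \<and> col_bound n (\<lambda>i j. snd (\<rho> (v i j))) r"
      if "\<And>i j. i < n \<Longrightarrow> j < n \<Longrightarrow> v i j \<in> V" "\<And>i j. i < n \<Longrightarrow> j < n \<Longrightarrow> a i j = g (v i j)" "0 \<le> r" for n a v r
      using mnorm_hrow_op[OF D1, of n "\<lambda>i j. fst (\<pi> (v i j))" "\<lambda>i j. fst (a i j)" r]
        mnorm_hcol_op[of n "\<lambda>i j. snd (a i j)" "\<lambda>i j. snd (\<rho> (v i j))" r D2] that D1_in
      by (simp add: dsum_def g_def)
    \<comment> \<open>The dominating part determines the vector: an element of \<open>H\<close> with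
      row part 0 vanishes, as does an element of \<open>K\<close> with column part 0.\<close>
    have g_inj: "inj_on g V"
    proof (rule inj_onI)
      fix v w assume v: "v \<in> V" and w: "w \<in> V" and eq: "g v = g w"
      have e1: "fst (\<pi> v - \<pi> w) = 0"
        using inj_onD[OF inj_on_hrow_op[OF D1] _ D1_in[OF v] D1_in[OF w]] eq by (simp add: g_def)
      have "\<pi> v - \<pi> w \<in> H" by (intro complex_vector.subspace_diff H(1) \<pi> v w)
      then have "norm (snd (\<pi> v - \<pi> w)) \<le> 0" using domH[of "\<pi> v - \<pi> w"] unfolding e1 by simp
      then have 1: "\<pi> v = \<pi> w" using e1 by (simp add: prod_eq_iff)
      have e2: "snd (\<rho> v - \<rho> w) = 0"
        using injD[OF inj_hcol_op] eq by (simp add: g_def)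
      have "\<rho> v - \<rho> w \<in> K" by (intro complex_vector.subspace_diff K(1) \<rho> v w)
      then have "norm (fst (\<rho> v - \<rho> w)) \<le> 0" using domK[of "\<rho> v - \<rho> w"] unfolding e2 by simp
      then have 2: "\<rho> v = \<rho> w" using e2 by (simp add: prod_eq_iff)
      have "v = \<pi> v + \<rho> v" by (rule split[OF v, symmetric])
      also have "\<dots> = w" unfolding 1 2 by (rule split[OF w])
      finally show "v = w" .
    qed
    have g_image: "g ` V = elems ?F"
    proof
      show "g ` V \<subseteq> elems ?F" unfolding elems_F using D1_in D2_in by (auto simp: g_def)
      show "elems ?F \<subseteq> g ` V"
      proof
        fix z assume "z \<in> elems ?F"
        then have "z \<in> hrow_op D1 ` D1 \<times> hcol_op ` D2" by (simp only: elems_F)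
        then obtain h k where "h \<in> H" "k \<in> K" "z = (hrow_op D1 (fst h), hcol_op (snd k))"
          by (auto simp: D1_def D2_def)
        then have "z = g (h + k)" "h + k \<in> V" using uniq V_add by (simp_all add: g_def)
        then show "z \<in> g ` V" by blast
      qed
    qed
    have g_lin: "clinear_on V g"
      unfolding clinear_on_def
      by (simp add: g_def \<pi>\<rho>_add \<pi>\<rho>_scale hrow_op_add[OF D1] hrow_op_scaleC[OF D1] hcol_op_add
          hcol_op_scaleC D1_in scaleC_prod_def[of _ "(_, _)"])
    define u where "u s = g (inv embed s)" for s
    have u_embed: "u (embed v) = g v" for v by (simp add: u_def inv_f_f[OF inj_embed])
    have u_lin: "clinear_on S u"
      unfolding clinear_on_def SV
      by (auto simp: embed_add[symmetric] embed_scaleC[symmetric] u_embed clinear_onD[OF g_lin])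
    have u_inj: "inj_on u S"
      unfolding SV using g_inj by (auto simp: inj_on_def u_embed)
    have u_image: "u ` S = elems ?F"
      unfolding SV g_image[symmetric] image_image u_embed ..
    have S_sub: "complex_vector.subspace S" using S by (simp add: closed_subspace_def)
    let ?w = "inv_into S u"
    have w_g: "?w (g v) = embed v" if "v \<in> V" for v
      using inv_into_f_f[OF u_inj, of "embed v"] that by (simp add: SV u_embed)
    \<comment> \<open>The bound \<open>r\<close> is left general: \<open>r = 1\<close> gives
      complete contractivity, and \<open>r = 0\<close> is needed when \<open>S\<close> is
      trivial.\<close>
    have u_cb: "mnorm ?F n (\<lambda>i j. u (a i j)) \<le> r"
      if a: "a \<in> mats n ?S" "mnorm ?S n a \<le> r" and r: "0 \<le> r" for n a r
    proof -
      define v where "v i j = inv embed (a i j)" for i j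
      have v: "v i j \<in> V" "a i j = embed (v i j)" if "i < n" "j < n" for i j
      proof -
        have "a i j \<in> embed ` V" using a(1) that by (simp add: mats_def SV)
        then show "v i j \<in> V" "a i j = embed (v i j)" by (auto simp: v_def inv_f_f[OF inj_embed])
      qed
      have b: "col_bound n (\<lambda>i j. fst (v j i)) r" "col_bound n (\<lambda>i j. snd (v i j)) r"
        using a(2) mnorm_embed[of n a v, OF v(2) r] by simp_all
      have comb: "(\<Sum>j<n. t j *\<^sub>C y j) \<in> V \<and> \<pi> (\<Sum>j<n. t j *\<^sub>C y j) = (\<Sum>j<n. t j *\<^sub>C \<pi> (y j)) \<and>
          \<rho> (\<Sum>j<n. t j *\<^sub>C y j) = (\<Sum>j<n. t j *\<^sub>C \<rho> (y j))" if "\<And>j. j < n \<Longrightarrow> y j \<in> V" for t y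
        using that V(1) \<pi>\<rho>_add \<pi>\<rho>_scale
        by (auto intro!: complex_vector.subspace_sum complex_vector.subspace_scale clinear_on_sum[of V]
            simp: clinear_on_def)
      have "col_bound n (\<lambda>i j. fst (\<pi> (v j i))) r"
      proof (rule col_bound_dominated[OF b(1)])
        fix t i assume i: "i < n"
        show "norm (\<Sum>j<n. t j *\<^sub>C fst (\<pi> (v j i))) \<le> norm (\<Sum>j<n. t j *\<^sub>C fst (v j i))"
          using comb[of "\<lambda>j. v j i" t] contr(1)[of "\<Sum>j<n. t j *\<^sub>C v j i"] v(1) i
          by (simp add: fst_sum_scaleC)
      qed
      moreover have "col_bound n (\<lambda>i j. snd (\<rho> (v i j))) r"
      proof (rule col_bound_dominated[OF b(2)])
        fix t i assume i: "i < n"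
        show "norm (\<Sum>j<n. t j *\<^sub>C snd (\<rho> (v i j))) \<le> norm (\<Sum>j<n. t j *\<^sub>C snd (v i j))"
          using comb[of "\<lambda>j. v i j" t] contr(2)[of "\<Sum>j<n. t j *\<^sub>C v i j"] v(1) i
          by (simp add: snd_sum_scaleC)
      qed
      ultimately show ?thesis using mnorm_F[of n v "\<lambda>i j. u (a i j)" r] v r by (simp add: u_embed)
    qed
    \<comment> \<open>In each component, 1 comes from the part that is read off directly and
      \<open>2 * c\<close> from the part recovered through the off-diagonal estimate.\<close>
    have w_cb: "mnorm ?S n (\<lambda>i j. ?w (b i j)) \<le> 1 + 2 * c"
      if b: "b \<in> mats n ?F" "mnorm ?F n b \<le> 1" for n b
    proof -
      define v where "v i j = inv_into V g (b i j)" for i j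
      have v: "v i j \<in> V" "b i j = g (v i j)" if "i < n" "j < n" for i j
      proof -
        have "b i j \<in> g ` V" using b(1) that by (simp add: mats_def g_image)
        then show "v i j \<in> V" "b i j = g (v i j)"
          by (simp_all add: v_def inv_into_into f_inv_into_f)
      qed
      have bd: "col_bound n (\<lambda>i j. fst (\<pi> (v j i))) 1" "col_bound n (\<lambda>i j. snd (\<rho> (v i j))) 1"
        using b(2) mnorm_F[of n v b 1] v by simp_all
      have sp: "fst (v i j) = fst (\<pi> (v i j)) + fst (\<rho> (v i j))" "snd (v i j) = snd (\<rho> (v i j)) + snd (\<pi> (v i j))"
        if "i < n" "j < n" for i j
        using arg_cong[OF split[OF v(1)[OF that]], of fst] arg_cong[OF split[OF v(1)[OF that]], of snd]
        by (simp_all add: add.commute)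
      have "col_bound n (\<lambda>i j. fst (\<rho> (v j i))) (2 * c)" by (rule FK[OF _ bd(2)]) (simp add: v \<rho>)
      then have "col_bound n (\<lambda>i j. fst (v j i)) (1 + 2 * c)"
        by (rule col_bound_triangle[OF bd(1)])
          (simp add: sp scaleC_add_right sum.distrib norm_triangle_ineq)
      moreover have "col_bound n (\<lambda>i j. snd (\<pi> (v i j))) (2 * c)" by (rule FH[OF _ bd(1)]) (simp add: v \<pi>)
      then have "col_bound n (\<lambda>i j. snd (v i j)) (1 + 2 * c)"
        by (rule col_bound_triangle[OF bd(2)])
          (simp add: sp scaleC_add_right sum.distrib norm_triangle_ineq)
      ultimately show ?thesis
        using mnorm_embed[of n "\<lambda>i j. ?w (b i j)" v "1 + 2 * c"] v w_g c by simp
    qed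
    have u_norm: "cb_norm ?S ?F u \<le> ennreal 1" by (rule cb_norm_leI) (rule u_cb, simp_all)
    have w_norm: "cb_norm ?F ?S ?w \<le> ennreal (1 + 2 * c)" by (rule cb_norm_leI) (rule w_cb)
    have iso: "complete_iso ?S ?F u"
      unfolding complete_iso_def cb_map_def sub_opspace_simps
    proof (intro conjI)
      show "bij_betw u S (elems ?F)" by (simp add: bij_betw_def u_inj u_image)
      show "clinear_on S u" by (rule u_lin)
      show "u ` S \<subseteq> elems ?F" by (simp add: u_image)
      show "cb_norm ?S ?F u < \<infinity>" using u_norm by (auto intro: order.strict_trans1)
      show "clinear_on (elems ?F) ?w"
        using clinear_on_inv_into[OF u_lin S_sub u_inj] by (simp add: u_image)
      show "?w ` elems ?F \<subseteq> S" unfolding u_image[symmetric] using u_inj by auto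
      show "cb_norm ?F ?S ?w < \<infinity>" using w_norm by (auto intro: order.strict_trans1)
    qed
    have "d_cb ?S ?F \<le> cb_norm ?S ?F u * cb_norm ?F ?S (inv_into (elems ?S) u)"
      unfolding d_cb_def by (rule INF_lower) (simp add: iso)
    also have "\<dots> \<le> ennreal 3 * ennreal c"
    proof (cases "V = {0}")
      case True
      \<comment> \<open>For trivial \<open>S\<close> the number \<open>c\<close> may be 0, so
        \<open>1 + 2 * c \<le> 3 * c\<close> can fail. The product of cb norms is still small
        enough, as that of \<open>u\<close> is 0.\<close>
      have "cb_norm ?S ?F u \<le> ennreal 0"
      proof (rule cb_norm_leI)
        fix n a assume a: "a \<in> mats n ?S" "mnorm ?S n a \<le> 1"
        have "a i j = embed 0" if "i < n" "j < n" for i j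
          using a(1) that True by (simp add: mats_def SV)
        then have "mnorm ?S n a \<le> 0"
          using mnorm_embed[of n a "\<lambda>i j. 0" 0] by (simp add: col_bound_zero)
        then show "mnorm ?F n (\<lambda>i j. u (a i j)) \<le> 0" using a(1) by (intro u_cb) simp_all
      qed
      then show ?thesis by simp
    next
      case False
      then obtain v where v: "v \<in> V" "v \<noteq> 0" using complex_vector.subspace_0[OF V(1)] by blast
      have c1: "1 \<le> c" by (rule one_le_of_nonzero[where v = v, OF Vfacts]) (use v in simp_all)
      have "cb_norm ?S ?F u * cb_norm ?F ?S (inv_into (elems ?S) u) \<le> ennreal 1 * ennreal (1 + 2 * c)"
        using u_norm w_norm by (intro mult_mono) simp_all
      also have "\<dots> = ennreal (1 + 2 * c)" using c by (subst ennreal_mult[symmetric]) simp_all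
      also have "\<dots> \<le> ennreal (3 * c)" using c1 by (intro ennreal_leI) simp
      also have "\<dots> = ennreal 3 * ennreal c" using c by (simp add: ennreal_mult)
      finally show ?thesis .
    qed
    finally have "d_cb ?S ?F \<le> ennreal 3 * cb_norm ?E ?S P" by (simp add: Pc)
    moreover have "hilbert_space ?H" "hilbert_space ?K"
      by (rule hilbert_space_hilbert_subspace[OF D1], rule hilbert_space_hilbert_subspace[OF D2])
    moreover have "completely_isomorphic ?S ?F" unfolding completely_isomorphic_def using iso by blast
    ultimately show ?thesis by blast
  qed
qed

theorem theorem8:
  shows "\<exists>\<kappa>::real. \<kappa> > 0 \<and>
    (\<forall>S P. closed_subspace S (row_space \<oplus>\<^sub>\<infinity> col_space) \<longrightarrow>
       cb_projection (row_space \<oplus>\<^sub>\<infinity> col_space) S P \<longrightarrow>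
       (\<exists>(H :: (nat \<Rightarrow> complex) nspace) (K :: (nat \<Rightarrow> complex) nspace).
          hilbert_space H \<and> hilbert_space K \<and>
          completely_isomorphic (sub_opspace (row_space \<oplus>\<^sub>\<infinity> col_space) S)
            (hilbert_row H \<oplus>\<^sub>\<infinity> hilbert_col K) \<and>
          d_cb (sub_opspace (row_space \<oplus>\<^sub>\<infinity> col_space) S) (hilbert_row H \<oplus>\<^sub>\<infinity> hilbert_col K)
            \<le> ennreal \<kappa> * cb_norm (row_space \<oplus>\<^sub>\<infinity> col_space)
                 (sub_opspace (row_space \<oplus>\<^sub>\<infinity> col_space) S) P))"
  using d_cb_complemented_le by (intro exI[of _ 3]) simp

end
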